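(* Let $\Omega_0,\Omega_1\subseteq\mathbb{R}^n$ be bounded domains and let $V:\overline{\Omega_0\cup\Omega_1}\to\mathbb{R}$ be a potential. Assume that $\Omega_0,\Omega_1$ and $V$ are sufficiently regular that the first Dirichlet eigenfunctions $u_0,u_1$ of $-\Delta+V$ on $\Omega_0$ and $\Omega_1$ respectively are $C^1$ up to the boundary, and assume that $V$ extends to a convex function (still denoted $V$) on the convex hull of $\Omega_0\cup\Omega_1$. For $t\in[0,1]$ let $\Omega_t=(1-t)\Omega_0+t\Omega_1$ and let $\lambda_t=\lambda(\Omega_t)$ be the first Dirichlet eigenvalue of $-\Delta+V$ on $\Omega_t$. Then for every $t\in[0,1]$, $$\lambda_t\le(1-t)\lambda_0+t\lambda_1 .$$
   Context: A domain is a connected open set. The Minkowski combination is $(1-t)\Omega_0+t\Omega_1:=\{(1-t)x_0+tx_1: x_0\in\Omega_0,\ x_1\in\Omega_1\}$, which is contained in the convex hull of $\Omega_0\cup\Omega_1$, so that the extended $V$ is defined on it. The first Dirichlet eigenvalue of $-\Delta+V$ on a bounded domain $\Omega$ is $$\lambda(\Omega)=\inf\left\{\frac{\int_\Omega |\nabla u|^2+Vu^2\,dx}{\int_\Omega u^2\,dx}: u\in W^{1,2}_0(\Omega)\setminus\{0\}\right\}.$$ A first Dirichlet eigenfunction $u_i$ on $\Omega_i$ is the (unique up to scaling) positive function with $-\Delta u_i+Vu_i=\lambda_iu_i$ in $\Omega_i$ and $u_i=0$ on $\partial\Omega_i$. A function is $C^1$ up to the boundary of $\Omega$ if it has a $C^1$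 extension to an open neighbourhood of $\overline\Omega$. (For example, the regularity assumption holds when $\Omega_0,\Omega_1$ have $C^{1,1}$ boundary and $V\in C^\alpha(\overline{\Omega_0\cup\Omega_1})$.) *)

theory Defs
  imports "HOL-Analysis.Analysis"
begin

section \<open>Classical derivatives\<close>

definition partial_deriv :: "'a::euclidean_space \<Rightarrow> ('a \<Rightarrow> real) \<Rightarrow> 'a \<Rightarrow> real" where
  "partial_deriv b f x = frechet_derivative f (at x) b"

definition laplacian :: "('a::euclidean_space \<Rightarrow> real) \<Rightarrow> 'a \<Rightarrow> real" where
  "laplacian f x = (\<Sum>b\<in>Basis. partial_deriv b (partial_deriv b f) x)"

text \<open>Only meant for open sets: the derivatives are two-sided.\<close>

fun Ck_on :: "nat \<Rightarrow> ('a::euclidean_space \<Rightarrow> real) \<Rightarrow> 'a set \<Rightarrow> bool" where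
  "Ck_on 0 f U \<longleftrightarrow> continuous_on U f"
| "Ck_on (Suc k) f U \<longleftrightarrow>
     (\<forall>x\<in>U. f differentiable (at x)) \<and> (\<forall>b\<in>Basis. Ck_on k (partial_deriv b f) U)"

definition C1_up_to_boundary :: "'a::euclidean_space set \<Rightarrow> ('a \<Rightarrow> real) \<Rightarrow> bool" where
  "C1_up_to_boundary \<Omega> u \<longleftrightarrow>
     (\<exists>U v. open U \<and> closure \<Omega> \<subseteq> U \<and> Ck_on 1 v U \<and> (\<forall>x\<in>closure \<Omega>. v x = u x))"


section \<open>Sobolev spaces\<close>

text \<open>Elements of \<open>L\<^sup>2\<close> and of the Sobolev spaces are represented by functions on the whole space;
  only their values almost everywhere in \<open>\<Omega>\<close> matter.\<close>

definition L2_on :: "'a::euclidean_space set \<Rightarrow> ('a \<Rightarrow> 'b::euclidean_space) \<Rightarrow> bool" where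
  "L2_on \<Omega> f \<longleftrightarrow> f \<in> borel_measurable (lebesgue_on \<Omega>) \<and>
     integrable (lebesgue_on \<Omega>) (\<lambda>x. (norm (f x))\<^sup>2)"

definition test_functions :: "'a::euclidean_space set \<Rightarrow> ('a \<Rightarrow> real) set" where
  "test_functions \<Omega> = {\<phi>. (\<forall>k. Ck_on k \<phi> UNIV) \<and>
     compact (closure {x. \<phi> x \<noteq> 0}) \<and> closure {x. \<phi> x \<noteq> 0} \<subseteq> \<Omega>}"

definition is_weak_gradient ::
  "'a::euclidean_space set \<Rightarrow> ('a \<Rightarrow> real) \<Rightarrow> ('a \<Rightarrow> 'a) \<Rightarrow> bool" where
  "is_weak_gradient \<Omega> u g \<longleftrightarrow> L2_on \<Omega> g \<and>
     (\<forall>\<phi>\<in>test_functions \<Omega>. \<forall>b\<in>Basis.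
        (LINT x|lebesgue_on \<Omega>. u x * partial_deriv b \<phi> x) =
        - (LINT x|lebesgue_on \<Omega>. (g x \<bullet> b) * \<phi> x))"

definition W12 :: "'a::euclidean_space set \<Rightarrow> ('a \<Rightarrow> real) set" where
  "W12 \<Omega> = {u. L2_on \<Omega> u \<and> (\<exists>g. is_weak_gradient \<Omega> u g)}"

text \<open>Determined up to a null set of \<open>\<Omega>\<close>; meaningful for \<open>u \<in> W12 \<Omega>\<close>.\<close>

definition weak_gradient :: "'a::euclidean_space set \<Rightarrow> ('a \<Rightarrow> real) \<Rightarrow> 'a \<Rightarrow> 'a" where
  "weak_gradient \<Omega> u = (SOME g. is_weak_gradient \<Omega> u g)"

definition W12_norm :: "'a::euclidean_space set \<Rightarrow> ('a \<Rightarrow> real) \<Rightarrow> real" where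
  "W12_norm \<Omega> u =
     sqrt (LINT x|lebesgue_on \<Omega>. (u x)\<^sup>2 + (norm (weak_gradient \<Omega> u x))\<^sup>2)"

definition W12_0 :: "'a::euclidean_space set \<Rightarrow> ('a \<Rightarrow> real) set" where
  "W12_0 \<Omega> = {u \<in> W12 \<Omega>. \<exists>\<phi>. (\<forall>k::nat. \<phi> k \<in> test_functions \<Omega>) \<and>
     (\<lambda>k. W12_norm \<Omega> (\<lambda>x. \<phi> k x - u x)) \<longlonglongrightarrow> 0}"


section \<open>The first Dirichlet eigenvalue and eigenfunction\<close>

definition rayleigh_quotient ::
  "('a::euclidean_space \<Rightarrow> real) \<Rightarrow> 'a set \<Rightarrow> ('a \<Rightarrow> real) \<Rightarrow> real" where
  "rayleigh_quotient V \<Omega> u =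
     (LINT x|lebesgue_on \<Omega>. (norm (weak_gradient \<Omega> u x))\<^sup>2 + V x * (u x)\<^sup>2) /
     (LINT x|lebesgue_on \<Omega>. (u x)\<^sup>2)"

text \<open>The potential may be unbounded above near the boundary of \<open>\<Omega>\<close>. Where it is bounded below
  (as a convex function on a bounded set is), the functions excluded by the integrability
  condition are those whose quotient is \<open>+\<infinity>\<close>; they do not affect the infimum. Without the
  condition the integral of a non-integrable function, which is \<open>0\<close> by convention, would count.\<close>

definition dirichlet_eigenvalue :: "('a::euclidean_space \<Rightarrow> real) \<Rightarrow> 'a set \<Rightarrow> real" where
  "dirichlet_eigenvalue V \<Omega> = Inf {rayleigh_quotient V \<Omega> u | u.
     u \<in> W12_0 \<Omega> \<and> \<not> (AE x in lebesgue_on \<Omega>. u x = 0) \<and>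
     integrable (lebesgue_on \<Omega>) (\<lambda>x. V x * (u x)\<^sup>2)}"

text \<open>The boundary value problem is understood classically. The potentials of interest are convex
  on an open set containing \<open>\<Omega>\<close>, hence locally Lipschitz, so that weak solutions of the equation
  are twice continuously differentiable in \<open>\<Omega>\<close> anyway.\<close>

definition first_dirichlet_eigenfunction ::
  "('a::euclidean_space \<Rightarrow> real) \<Rightarrow> 'a set \<Rightarrow> ('a \<Rightarrow> real) \<Rightarrow> bool" where
  "first_dirichlet_eigenfunction V \<Omega> u \<longleftrightarrow>
     Ck_on 2 u \<Omega> \<and> continuous_on (closure \<Omega>) u \<and>
     (\<forall>x\<in>\<Omega>. 0 < u x) \<and>
     (\<forall>x\<in>\<Omega>. - laplacian u x + V x * u x = dirichlet_eigenvalue V \<Omega> * u x) \<and>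
     (\<forall>x\<in>frontier \<Omega>. u x = 0)"


section \<open>Domains\<close>

definition bounded_domain :: "'a::euclidean_space set \<Rightarrow> bool" where
  "bounded_domain \<Omega> \<longleftrightarrow> open \<Omega> \<and> connected \<Omega> \<and> \<Omega> \<noteq> {} \<and> bounded \<Omega>"

definition minkowski_combination ::
  "real \<Rightarrow> 'a::euclidean_space set \<Rightarrow> 'a set \<Rightarrow> 'a set" where
  "minkowski_combination t A B = {(1 - t) *\<^sub>R x + t *\<^sub>R y | x y. x \<in> A \<and> y \<in> B}"

end

theory Submission
  imports Defs
begin

text \<open>The eigenvalue \<open>\<lambda>\<^sub>t\<close> is bounded by testing its variational characterisation. For large \<open>p\<close> put
  \<open>W(z) = \<integral> u\<^sub>0(x)\<^bsup>(1-t)p\<^esup> u\<^sub>1(y)\<^bsup>tp\<^esup>\<close>, integrated over all \<open>(x, y)\<close> with \<open>(1-t)x + ty = z\<close>; the function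
  \<open>W\<^bsup>1/p\<^esup>\<close> is a smooth substitute for the sup-convolution
  \<open>sup {u\<^sub>0(x)\<^bsup>1-t\<^esup> u\<^sub>1(y)\<^bsup>t\<^esup>}\<close>. As \<open>W\<close> is a convolution, each of the
  derivatives in its Laplacian may be put on either factor. With both on the first, both on the
  second, or one on each, this gives three expressions for \<open>\<Delta>W\<close>. Combining them with weights
  \<open>(1-t)\<^sup>2(1+2/p)\<close>, \<open>t\<^sup>2(1+2/p)\<close> and the remainder, inserting the two eigenvalue equations and using
  the convexity of \<open>V\<close>, one is left with a quadratic form in the logarithmic gradients that is
  nonnegative for large \<open>p\<close>, so that \<open>w = W\<^bsup>1/p\<^esup>\<close> satisfies
  \<open>-\<Delta>w + (1+2/p)(V - (1-t)\<lambda>\<^sub>0 - t\<lambda>\<^sub>1) w \<le> (2/p) |\<nabla>w|\<^sup>2 / w\<close>. Multiply by \<open>w\<close>, integrate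
  and let \<open>p \<rightarrow> \<infinity>\<close>.

  To avoid all boundary terms, \<open>u\<^sub>i\<close> is replaced by \<open>(u\<^sub>i - \<epsilon>)\<^sub>+\<close>, whose powers are \<open>C\<^sup>2\<close> with compact
  support in \<open>\<Omega>\<^sub>i\<close>, and \<open>w\<close> by \<open>(W + \<delta>)\<^bsup>1/p\<^esup> - \<delta>\<^bsup>1/p\<^esup>\<close>; the errors vanish as first \<open>\<epsilon> \<rightarrow> 0\<close>
  and then \<open>\<delta> \<rightarrow> 0\<close>.\<close>

section \<open>Calculus of continuously differentiable functions\<close>

text \<open>Write \<open>a = 1-t\<close>, \<open>x\<close>, \<open>y\<close> for the logarithmic
  gradients of the two factors, \<open>A = ax + ty\<close> and \<open>D = x - y\<close>. A
  sup-convolution is in general not differentiable; a finite \<open>p\<close> restores smoothness at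
  the cost of terms of order \<open>1/p\<close>. Weights proportional to \<open>a^2\<close> and
  \<open>t^2\<close> are dictated by the potentials: after rescaling they give these the
  coefficients \<open>a\<close> and \<open>t\<close> of the convexity inequality. The plain weights
  \<open>a^2\<close>, \<open>t^2\<close>, \<open>2at\<close> would leave \<open>-p a t D^2\<close>,
  which nothing absorbs; the factor \<open>1+2/p\<close> turns this into
  \<open>(p-2) a t D^2\<close> and adds a cross term \<open>2p(1-2t) A D\<close>, small against
  \<open>p^2 A^2\<close>. The quotient \<open>|\<nabla>W|^2 / W\<close> is not linear in the
  integrand; it enters as the maximum over \<open>\<xi>\<close> of an expression linear in
  \<open>W\<close> and \<open>\<nabla>W\<close>, and \<open>\<xi>\<close> is chosen only after
  integration. On the Sobolev side, bounding an infimum from above takes a single admissible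
  function. But \<open>weak_gradient\<close> is a \<open>SOME\<close> choice, so its agreement with
  the classical gradient has to be derived from the fundamental lemma of the calculus of
  variations.\<close>

lemma partial_deriv_eq:
  "(f has_derivative D) (at x) \<Longrightarrow> partial_deriv b f x = D b"
  unfolding partial_deriv_def by (metis frechet_derivative_at)

lemma has_derivative_partial_deriv:
  fixes f :: "'a::euclidean_space \<Rightarrow> real"
  assumes "f differentiable (at x)"
  shows "(f has_derivative (\<lambda>h. \<Sum>b\<in>Basis. (h \<bullet> b) * partial_deriv b f x)) (at x)"
proof -
  let ?D = "frechet_derivative f (at x)"
  have D: "(f has_derivative ?D) (at x)"
    using assms frechet_derivative_works by blast
  then have lin: "linear ?D"
    by (rule has_derivative_linear)
  have "?D h = (\<Sum>b\<in>Basis. (h \<bullet> b) * partial_deriv b f x)" for h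
  proof -
    have "?D h = ?D (\<Sum>b\<in>Basis. (h \<bullet> b) *\<^sub>R b)"
      by (simp add: euclidean_representation)
    also have "\<dots> = (\<Sum>b\<in>Basis. (h \<bullet> b) * ?D b)"
      by (simp add: linear_sum[OF lin] linear_cmul[OF lin])
    finally show ?thesis by (simp add: partial_deriv_def)
  qed
  then have "?D = (\<lambda>h. \<Sum>b\<in>Basis. (h \<bullet> b) * partial_deriv b f x)" by blast
  then show ?thesis using D by simp
qed

lemma has_derivative_cong_open:
  assumes "open U" "x \<in> U" "\<And>y. y \<in> U \<Longrightarrow> f y = g y"
  shows "(f has_derivative D) (at x) \<longleftrightarrow> (g has_derivative D) (at x)"
  using has_derivative_transform_within_open[of f D x UNIV U g]
    has_derivative_transform_within_open[of g D x UNIV U f] assms by auto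

lemma partial_deriv_cong:
  assumes "open U" "x \<in> U" "\<And>y. y \<in> U \<Longrightarrow> f y = g y"
  shows "partial_deriv b f x = partial_deriv b g x"
  unfolding partial_deriv_def frechet_derivative_def
  using has_derivative_cong_open[OF assms] by simp

lemma differentiable_cong_open:
  assumes "open U" "x \<in> U" "\<And>y. y \<in> U \<Longrightarrow> f y = g y"
  shows "f differentiable (at x) \<longleftrightarrow> g differentiable (at x)"
  unfolding differentiable_def using has_derivative_cong_open[OF assms] by simp

lemma Ck_on_cong:
  assumes "open U" "\<And>x. x \<in> U \<Longrightarrow> f x = g x"
  shows "Ck_on k f U \<longleftrightarrow> Ck_on k g U"
  using assms(2)
proof (induction k arbitrary: f g)
  case 0
  then show ?case by (auto cong: continuous_on_cong)
next
  case (Suc k)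
  have "Ck_on k (partial_deriv b f) U \<longleftrightarrow> Ck_on k (partial_deriv b g) U" for b
    by (rule Suc.IH) (rule partial_deriv_cong[OF assms(1)], auto simp: Suc.prems)
  moreover have "f differentiable (at x) \<longleftrightarrow> g differentiable (at x)" if "x \<in> U" for x
    by (rule differentiable_cong_open[OF assms(1) that]) (simp add: Suc.prems)
  ultimately show ?case by simp
qed

text \<open>Serves to glue a function given by a formula on \<open>\<Omega>\<close> to the zero
  function off a compact subset of \<open>\<Omega>\<close>.\<close>

lemma Ck_on_Un:
  assumes "open U" "open U'" "Ck_on k f U" "Ck_on k f U'"
  shows "Ck_on k f (U \<union> U')"
  using assms(3,4)
  by (induction k arbitrary: f) (auto intro: continuous_on_open_Un assms(1,2))

lemma Ck_on_imp_continuous_on: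
  assumes "Ck_on k f U"
  shows "continuous_on U f"
proof (cases k)
  case (Suc j)
  then have "f differentiable (at x)" if "x \<in> U" for x
    using assms that by simp
  then show ?thesis
    by (intro differentiable_imp_continuous_on) (simp add: differentiable_at_imp_differentiable_on)
qed (use assms in simp)

lemma Ck_on_SucD: "Ck_on (Suc k) f U \<Longrightarrow> Ck_on k f U"
proof (induction k arbitrary: f)
  case 0
  then show ?case using Ck_on_imp_continuous_on[of "Suc 0"] by simp
next
  case (Suc k)
  then show ?case by simp
qed

lemma partial_deriv_const [simp]: "partial_deriv b (\<lambda>x. c) = (\<lambda>x. 0)"
  by (rule ext) (rule partial_deriv_eq, auto)

lemma Ck_on_const [simp]: "Ck_on k (\<lambda>x. c) U"
  by (induction k arbitrary: c) auto

lemma partial_deriv_add: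
  assumes "f differentiable (at x)" "g differentiable (at x)"
  shows "partial_deriv b (\<lambda>x. f x + g x) x = partial_deriv b f x + partial_deriv b g x"
proof -
  have "((\<lambda>x. f x + g x) has_derivative
      (\<lambda>h. frechet_derivative f (at x) h + frechet_derivative g (at x) h)) (at x)"
    using assms by (intro derivative_intros) (simp_all add: frechet_derivative_works)
  then show ?thesis
    unfolding partial_deriv_def[of b f] partial_deriv_def[of b g] by (rule partial_deriv_eq)
qed

lemma partial_deriv_diff:
  assumes "f differentiable (at x)" "g differentiable (at x)"
  shows "partial_deriv b (\<lambda>x. f x - g x) x = partial_deriv b f x - partial_deriv b g x"
proof -
  have "((\<lambda>x. f x - g x) has_derivative
      (\<lambda>h. frechet_derivative f (at x) h - frechet_derivative g (at x) h)) (at x)"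
    using assms by (intro derivative_intros) (simp_all add: frechet_derivative_works)
  then show ?thesis
    unfolding partial_deriv_def[of b f] partial_deriv_def[of b g] by (rule partial_deriv_eq)
qed

lemma partial_deriv_mult:
  fixes f g :: "'a::euclidean_space \<Rightarrow> real"
  assumes "f differentiable (at x)" "g differentiable (at x)"
  shows "partial_deriv b (\<lambda>x. f x * g x) x = f x * partial_deriv b g x + partial_deriv b f x * g x"
proof -
  have "((\<lambda>x. f x * g x) has_derivative
      (\<lambda>h. f x * frechet_derivative g (at x) h + frechet_derivative f (at x) h * g x)) (at x)"
    using assms by (intro has_derivative_mult) (simp_all add: frechet_derivative_works)
  then show ?thesis
    unfolding partial_deriv_def[of b f] partial_deriv_def[of b g] by (rule partial_deriv_eq)
qed

lemma Ck_on_SucI: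
  assumes "open U" "\<And>x. x \<in> U \<Longrightarrow> f differentiable (at x)"
    and "\<And>b x. x \<in> U \<Longrightarrow> partial_deriv b f x = g b x"
    and "\<And>b. b \<in> Basis \<Longrightarrow> Ck_on k (g b) U"
  shows "Ck_on (Suc k) f U"
proof -
  have "Ck_on k (partial_deriv b f) U" if "b \<in> Basis" for b
    using assms(4)[OF that] Ck_on_cong[OF assms(1), of "partial_deriv b f" "g b" k] assms(3) by blast
  then show ?thesis using assms(2) by simp
qed

lemma Ck_on_add:
  assumes "open U"
  shows "Ck_on k f U \<Longrightarrow> Ck_on k g U \<Longrightarrow> Ck_on k (\<lambda>x. f x + g x) U"
proof (induction k arbitrary: f g)
  case 0
  then show ?case by (simp add: continuous_on_add)
next
  case (Suc k)
  show ?case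
    by (rule Ck_on_SucI[OF assms, where g = "\<lambda>b x. partial_deriv b f x + partial_deriv b g x"])
      (use Suc in \<open>simp_all add: partial_deriv_add differentiable_add\<close>)
qed

lemma Ck_on_mult:
  assumes "open U"
  shows "Ck_on k f U \<Longrightarrow> Ck_on k g U \<Longrightarrow> Ck_on k (\<lambda>x. f x * g x) U"
proof (induction k arbitrary: f g)
  case 0
  then show ?case by (simp add: continuous_on_mult)
next
  case (Suc k)
  have "Ck_on k (\<lambda>x. f x * partial_deriv b g x + partial_deriv b f x * g x) U" if "b \<in> Basis" for b
    using Suc.prems[THEN Ck_on_SucD] Suc.prems that by (intro Ck_on_add assms Suc.IH) simp_all
  then show ?case
    by (intro Ck_on_SucI[OF assms, where g =
          "\<lambda>b x. f x * partial_deriv b g x + partial_deriv b f x * g x"])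
      (use Suc.prems in \<open>simp_all add: partial_deriv_mult differentiable_mult\<close>)
qed

lemma Ck_on_cmult:
  assumes "open U" "Ck_on k f U"
  shows "Ck_on k (\<lambda>x. c * f x) U"
  by (rule Ck_on_mult[OF assms(1) Ck_on_const assms(2)])

lemma Ck_on_diff:
  assumes "open U" "Ck_on k f U" "Ck_on k g U"
  shows "Ck_on k (\<lambda>x. f x - g x) U"
  using Ck_on_add[OF assms(1,2) Ck_on_cmult[OF assms(1,3), of "-1"]] by simp

lemma Ck_on_sum:
  assumes "open U" "\<And>i. i \<in> I \<Longrightarrow> Ck_on k (f i) U"
  shows "Ck_on k (\<lambda>x. \<Sum>i\<in>I. f i x) U"
  using assms(2)
  by (induction I rule: infinite_finite_induct) (simp_all add: Ck_on_add assms(1))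

lemma has_derivative_compose_real:
  fixes f :: "'a::euclidean_space \<Rightarrow> real"
  assumes "f differentiable (at x)" "(\<psi> has_real_derivative d) (at (f x))"
  shows "((\<lambda>x. \<psi> (f x)) has_derivative (\<lambda>h. d * frechet_derivative f (at x) h)) (at x)"
proof -
  have "(f has_derivative frechet_derivative f (at x)) (at x)"
    using assms(1) by (simp add: frechet_derivative_works)
  from has_derivative_compose[OF this, of \<psi> "\<lambda>h. d * h"] assms(2) show ?thesis
    by (simp add: has_field_derivative_def)
qed

lemma partial_deriv_compose:
  fixes f :: "'a::euclidean_space \<Rightarrow> real"
  assumes "f differentiable (at x)" "(\<psi> has_real_derivative d) (at (f x))"
  shows "partial_deriv b (\<lambda>x. \<psi> (f x)) x = d * partial_deriv b f x"
  using partial_deriv_eq[OF has_derivative_compose_real[OF assms]]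
  by (simp add: partial_deriv_def)

lemma differentiable_compose_real:
  fixes f :: "'a::euclidean_space \<Rightarrow> real"
  assumes "f differentiable (at x)" "(\<psi> has_real_derivative d) (at (f x))"
  shows "(\<lambda>x. \<psi> (f x)) differentiable (at x)"
  using has_derivative_compose_real[OF assms] by (rule differentiableI)

text \<open>The sequence \<open>\<psi> i, \<psi> (Suc i), ...\<close> lists successive derivatives.
  The starting index is free because the chain rule replaces \<open>\<psi> i\<close> by
  \<open>\<psi> (Suc i)\<close> in the induction on \<open>k\<close>.\<close>

lemma Ck_on_compose:
  fixes \<psi> :: "nat \<Rightarrow> real \<Rightarrow> real"
  assumes "open U"
    and "\<And>j s. i \<le> j \<Longrightarrow> j < i + k \<Longrightarrow> s \<in> S \<Longrightarrow> (\<psi> j has_real_derivative \<psi> (Suc j) s) (at s)"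
    and "continuous_on S (\<psi> (i + k))"
    and "Ck_on k f U" "f ` U \<subseteq> S"
  shows "Ck_on k (\<lambda>x. \<psi> i (f x)) U"
  using assms(2-4)
proof (induction k arbitrary: i)
  case 0
  then show ?case
    using assms(5) by (auto intro: continuous_on_compose2)
next
  case (Suc k)
  have d: "(\<psi> i has_real_derivative \<psi> (Suc i) (f x)) (at (f x))" if "x \<in> U" for x
    using Suc.prems(1)[of i "f x"] that assms(5) by auto
  have diff: "f differentiable (at x)" if "x \<in> U" for x
    using that Suc.prems by auto
  have "Ck_on k (\<lambda>x. \<psi> (Suc i) (f x)) U"
    using Suc.prems(1,2) Ck_on_SucD[OF Suc.prems(3)] by (intro Suc.IH) auto
  then have "Ck_on k (\<lambda>x. \<psi> (Suc i) (f x) * partial_deriv b f x) U" if "b \<in> Basis" for b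
    using Suc.prems that by (intro Ck_on_mult assms(1)) simp_all
  then show ?case
    by (intro Ck_on_SucI[OF assms(1), where g = "\<lambda>b x. \<psi> (Suc i) (f x) * partial_deriv b f x"])
      (simp_all add: partial_deriv_compose[OF diff d] differentiable_compose_real[OF diff d])
qed

lemma
  fixes f :: "'a::euclidean_space \<Rightarrow> real"
  assumes "f differentiable (at (c *\<^sub>R x))"
  shows partial_deriv_scale: "partial_deriv b (\<lambda>x. f (c *\<^sub>R x)) x = c * partial_deriv b f (c *\<^sub>R x)"
    and differentiable_scale: "(\<lambda>x. f (c *\<^sub>R x)) differentiable (at x)"
proof -
  let ?D = "frechet_derivative f (at (c *\<^sub>R x))"
  have D: "(f has_derivative ?D) (at (c *\<^sub>R x))"
    using assms by (simp add: frechet_derivative_works)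
  have "((\<lambda>x. c *\<^sub>R x) has_derivative (\<lambda>h. c *\<^sub>R h)) (at x)"
    by (intro derivative_intros)
  from has_derivative_compose[OF this D]
  have *: "((\<lambda>x. f (c *\<^sub>R x)) has_derivative (\<lambda>h. ?D (c *\<^sub>R h))) (at x)" .
  then show "(\<lambda>x. f (c *\<^sub>R x)) differentiable (at x)" by (rule differentiableI)
  have "?D (c *\<^sub>R b) = c * ?D b"
    using has_derivative_linear[OF D] by (simp add: linear_cmul)
  then show "partial_deriv b (\<lambda>x. f (c *\<^sub>R x)) x = c * partial_deriv b f (c *\<^sub>R x)"
    using partial_deriv_eq[OF *] by (simp add: partial_deriv_def)
qed

lemma Ck_on_scale:
  "Ck_on k f UNIV \<Longrightarrow> Ck_on k (\<lambda>x. f (c *\<^sub>R x)) UNIV"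
proof (induction k arbitrary: f)
  case 0
  then show ?case
    by (auto intro!: continuous_on_compose2[of UNIV f UNIV "\<lambda>x. c *\<^sub>R x"] continuous_intros)
next
  case (Suc k)
  have "Ck_on k (\<lambda>x. c * partial_deriv b f (c *\<^sub>R x)) UNIV" if "b \<in> Basis" for b
    using Suc that by (intro Ck_on_cmult) simp_all
  then show ?case
    by (intro Ck_on_SucI[where g = "\<lambda>b x. c * partial_deriv b f (c *\<^sub>R x)"])
      (use Suc.prems in \<open>simp_all add: partial_deriv_scale differentiable_scale\<close>)
qed

section \<open>Functions with bounded support and convolution\<close>

text \<open>Compact support, stated through boundedness: in finite dimension this is equivalent, and
  it passes to smaller supports without taking closures.\<close>

definition csupp :: "('a::euclidean_space \<Rightarrow> real) \<Rightarrow> bool" where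
  "csupp f \<longleftrightarrow> continuous_on UNIV f \<and> bounded {x. f x \<noteq> 0}"

lemma csuppI:
  assumes "continuous_on UNIV f" "bounded A" "\<And>x. x \<notin> A \<Longrightarrow> f x = 0"
  shows "csupp f"
  unfolding csupp_def using assms(1) bounded_subset[OF assms(2), of "{x. f x \<noteq> 0}"] assms(3) by blast

lemma csupp_continuous: "csupp f \<Longrightarrow> continuous_on UNIV f"
  by (simp add: csupp_def)

lemma csupp_borel [measurable_dest]: "csupp f \<Longrightarrow> f \<in> borel_measurable borel"
  by (simp add: csupp_def borel_measurable_continuous_onI)

lemma csupp_radius:
  assumes "csupp f"
  obtains R where "R > 0" "\<And>x. f x \<noteq> 0 \<Longrightarrow> norm x < R"
proof -
  from assms obtain R where R: "\<And>x. f x \<noteq> 0 \<Longrightarrow> norm x \<le> R"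
    by (auto simp: csupp_def bounded_iff)
  show ?thesis
    by (rule that[of "\<bar>R\<bar> + 1"]) (use R in force)+
qed

lemma csupp_integrable:
  assumes "csupp f"
  shows "integrable lborel f"
proof -
  obtain R where R: "\<And>x. f x \<noteq> 0 \<Longrightarrow> norm x < R"
    using csupp_radius[OF assms] by metis
  have "integrable lborel (\<lambda>x. indicator (cball 0 R) x *\<^sub>R f x)"
    using assms by (intro borel_integrable_compact) (auto simp: csupp_def intro: continuous_on_subset)
  moreover have "(\<lambda>x. indicator (cball 0 R) x *\<^sub>R f x) = f"
    using R by (fastforce simp: indicator_def)
  ultimately show ?thesis by simp
qed

lemma csupp_subset:
  assumes "csupp g" "continuous_on UNIV f" "\<And>x. g x = 0 \<Longrightarrow> f x = 0"
  shows "csupp f"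
  using assms(1,3) by (intro csuppI[OF assms(2), of "{x. g x \<noteq> 0}"]) (simp_all add: csupp_def)

lemma csupp_mult:
  assumes "csupp f" "continuous_on UNIV g"
  shows "csupp (\<lambda>x. f x * g x)" "csupp (\<lambda>x. g x * f x)"
  by (rule csupp_subset[OF assms(1)];
      simp add: continuous_on_mult csupp_continuous assms)+

lemma csupp_add:
  assumes "csupp f" "csupp g"
  shows "csupp (\<lambda>x. f x + g x)"
  using assms by (intro csuppI[of _ "{x. f x \<noteq> 0} \<union> {x. g x \<noteq> 0}"])
    (auto simp: csupp_def intro!: continuous_on_add continuous_on_diff)

lemma csupp_cmult: "csupp f \<Longrightarrow> csupp (\<lambda>x. c * f x)"
  by (rule csupp_mult) auto

lemma csupp_zero [simp]: "csupp (\<lambda>x. 0)"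
  by (simp add: csupp_def)

lemma csupp_sum:
  "(\<And>i. i \<in> I \<Longrightarrow> csupp (f i)) \<Longrightarrow> csupp (\<lambda>x. \<Sum>i\<in>I. f i x)"
  by (induction I rule: infinite_finite_induct) (auto intro: csupp_add)

lemma csupp_reflect:
  assumes "csupp g"
  shows "csupp (\<lambda>x. g (z - x))"
proof (rule csuppI)
  show "continuous_on UNIV (\<lambda>x. g (z - x))"
    using csupp_continuous[OF assms] by (auto intro!: continuous_on_compose2[of UNIV g] continuous_intros)
  show "bounded ((\<lambda>x. z - x) ` {x. g x \<noteq> 0})"
    using assms bounded_translation[of "uminus ` {x. g x \<noteq> 0}" z] bounded_uminus[of "{x. g x \<noteq> 0}"]
    by (simp add: csupp_def image_image)
  show "g (z - x) = 0" if "x \<notin> (\<lambda>x. z - x) ` {x. g x \<noteq> 0}" for x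
  proof (rule ccontr)
    assume "g (z - x) \<noteq> 0"
    then have "z - (z - x) \<in> (\<lambda>x. z - x) ` {x. g x \<noteq> 0}" by blast
    then show False using that by simp
  qed
qed

lemma csupp_bounded:
  assumes "csupp f"
  obtains M where "\<And>x. \<bar>f x\<bar> \<le> M"
proof -
  obtain R where R: "\<And>x. f x \<noteq> 0 \<Longrightarrow> norm x < R" "R > 0"
    using csupp_radius[OF assms] by metis
  have "compact (f ` cball 0 R)"
    using assms by (intro compact_continuous_image) (auto simp: csupp_def intro: continuous_on_subset)
  then obtain M where "\<forall>y\<in>f ` cball 0 R. norm y \<le> M"
    by (meson bounded_iff compact_imp_bounded)
  then have "\<bar>f x\<bar> \<le> \<bar>M\<bar>" for x
  proof (cases "f x = 0")
    case False
    then have "x \<in> cball 0 R" using R(1)[of x] by simp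
    then have "norm (f x) \<le> M" using \<open>\<forall>y\<in>f ` cball 0 R. norm y \<le> M\<close> by blast
    then show ?thesis by simp
  qed simp
  then show ?thesis using that by blast
qed

lemma csupp_uniformly_continuous:
  assumes "csupp f" "e > 0"
  obtains d where "d > 0" "\<And>x y. norm (x - y) < d \<Longrightarrow> \<bar>f x - f y\<bar> < e"
proof -
  obtain R where R: "\<And>x. f x \<noteq> 0 \<Longrightarrow> norm x < R" "R > 0"
    using csupp_radius[OF assms(1)] by metis
  have "uniformly_continuous_on (cball 0 (R + 1)) f"
    using assms by (intro compact_uniformly_continuous) (auto simp: csupp_def intro: continuous_on_subset)
  then obtain d where d: "d > 0"
      "\<forall>x\<in>cball 0 (R + 1). \<forall>x'\<in>cball 0 (R + 1). dist x' x < d \<longrightarrow> dist (f x') (f x) < e"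
    using assms(2) unfolding uniformly_continuous_on_def by meson
  \<comment> \<open>At distance less than 1, if one of the points leaves the ball of radius
    \<open>R + 1\<close>, then both lie outside the ball of radius \<open>R\<close>, where
    \<open>f\<close> vanishes.\<close>
  have "\<bar>f x - f y\<bar> < e" if "norm (x - y) < min d 1" for x y
  proof (cases "norm x \<le> R + 1 \<and> norm y \<le> R + 1")
    case True
    then show ?thesis using d(2)[rule_format, of y x] that by (simp add: dist_norm)
  next
    case False
    then have "norm x > R" "norm y > R"
      using that norm_triangle_ineq2[of x y] norm_triangle_ineq2[of y x]
      by (auto simp: norm_minus_commute)
    then have "f x = 0" "f y = 0" using R(1)[of x] R(1)[of y] by force+
    then show ?thesis using assms(2) by simp
  qed
  then show ?thesis using that[of "min d 1"] d(1) by simp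
qed

lemma csupp_partial_deriv:
  assumes "Ck_on (Suc k) f UNIV" "csupp f" "b \<in> Basis"
  shows "csupp (partial_deriv b f)"
proof -
  have "continuous_on UNIV (partial_deriv b f)"
    using assms by (auto intro: Ck_on_imp_continuous_on)
  moreover obtain R where R: "\<And>x. f x \<noteq> 0 \<Longrightarrow> norm x < R"
    using csupp_radius[OF assms(2)] by metis
  have "partial_deriv b f x = 0" if "x \<notin> cball 0 R" for x
  proof -
    have "partial_deriv b f x = partial_deriv b (\<lambda>x. 0) x"
      by (rule partial_deriv_cong[of "- cball 0 R"]) (use that R in force)+
    then show ?thesis by simp
  qed
  ultimately show ?thesis by (intro csuppI[of _ "cball 0 R"]) auto
qed

section \<open>Convolution and differentiation under the integral\<close>

definition conv :: "('a::euclidean_space \<Rightarrow> real) \<Rightarrow> ('a \<Rightarrow> real) \<Rightarrow> 'a \<Rightarrow> real" where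
  "conv f g z = (LINT x|lborel. f x * g (z - x))"

lemma integral_reflect:
  fixes h :: "'a::euclidean_space \<Rightarrow> real"
  assumes [measurable]: "h \<in> borel_measurable borel"
  shows "(LINT x|lborel. h (z - x)) = (LINT x|lborel. h x)"
proof -
  have "(lborel :: 'a measure) = density (distr lborel borel (\<lambda>x. z + (-1) *\<^sub>R x)) (\<lambda>_. ennreal (\<bar>-1\<bar>^DIM('a)))"
    using lborel_affine[of "-1" z] by simp
  also have "\<dots> = distr lborel borel (\<lambda>x. z - x)"
    by (simp add: density_1)
  finally have "(LINT x|lborel. h x) = (LINT x|distr lborel borel (\<lambda>x. z - x). h x)"
    by simp
  also have "\<dots> = (LINT x|lborel. h (z - x))"
    by (subst integral_distr) auto
  finally show ?thesis by simp
qed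

lemma conv_commute:
  assumes [measurable]: "f \<in> borel_measurable borel" "g \<in> borel_measurable borel"
  shows "conv f g = conv g f"
proof
  fix z
  have "conv f g z = (LINT x|lborel. f (z - x) * g (z - (z - x)))"
    unfolding conv_def by (rule integral_reflect[symmetric]) simp
  then show "conv f g z = conv g f z" by (simp add: conv_def mult.commute)
qed

lemma csupp_conv_integrand:
  assumes "continuous_on UNIV f" "csupp g"
  shows "csupp (\<lambda>x. f x * g (z - x))"
  by (intro csupp_mult csupp_reflect assms)

lemma integrable_conv:
  assumes "continuous_on UNIV f" "csupp g"
  shows "integrable lborel (\<lambda>x. f x * g (z - x))"
  by (intro csupp_integrable csupp_conv_integrand assms)

lemma conv_nonneg: "(\<And>x. f x \<ge> 0) \<Longrightarrow> (\<And>x. g x \<ge> 0) \<Longrightarrow> conv f g z \<ge> 0"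
  unfolding conv_def by (intro Bochner_Integration.integral_nonneg) auto

lemma conv_support:
  assumes "conv f g z \<noteq> 0"
  obtains x where "f x \<noteq> 0" "g (z - x) \<noteq> 0"
proof -
  have "\<exists>x. f x * g (z - x) \<noteq> 0"
  proof (rule ccontr)
    assume "\<not> ?thesis"
    then have "(\<lambda>x. f x * g (z - x)) = (\<lambda>x. 0)" by blast
    then show False using assms unfolding conv_def by simp
  qed
  then show ?thesis using that by auto
qed

lemma integral_cbox_csupp:
  assumes "csupp h" "\<And>x. h x \<noteq> 0 \<Longrightarrow> x \<in> cbox a b"
  shows "integral (cbox a b) h = (LINT x|lborel. h x)"
proof -
  have "integral (cbox a b) h = integral UNIV (\<lambda>x. if x \<in> cbox a b then h x else 0)"
    by (rule Henstock_Kurzweil_Integration.integral_restrict_UNIV[symmetric])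
  also have "(\<lambda>x. if x \<in> cbox a b then h x else 0) = h"
    by (rule ext) (metis assms(2))
  finally show ?thesis using integral_lborel[OF csupp_integrable[OF assms(1)]] by simp
qed

text \<open>For all \<open>y\<close> in a unit ball around \<open>z\<close> the integrands live on
  one common box, where the Leibniz rule for compact intervals applies. Bounded support is asked of
  \<open>g\<close> alone, so that \<open>f\<close> may be the constant 1.\<close>

lemma
  fixes f g :: "'a::euclidean_space \<Rightarrow> real"
  assumes f: "continuous_on UNIV f" and g: "Ck_on 1 g UNIV" "csupp g"
  shows conv_differentiable: "conv f g differentiable (at z)"
    and partial_deriv_conv: "b \<in> Basis \<Longrightarrow> partial_deriv b (conv f g) z = conv f (partial_deriv b g) z"
proof -
  obtain R where R: "\<And>x. g x \<noteq> 0 \<Longrightarrow> norm x < R" "R > 0"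
    using csupp_radius[OF g(2)] by metis
  obtain a c where ac: "cball (0::'a) (norm z + 1 + R) \<subseteq> cbox a c"
    using bounded_subset_cbox_symmetric[OF bounded_cball[of "0::'a" "norm z + 1 + R"]] by blast
  have cg: "continuous_on UNIV (partial_deriv b g)" if "b \<in> Basis" for b
    using g(1) that by simp
  have gd: "g differentiable (at y)" for y
    using g(1) by simp
  have pd0: "partial_deriv b g x = 0" if "norm x > R" for x b
  proof -
    have "partial_deriv b g x = partial_deriv b (\<lambda>x. 0) x"
      by (rule partial_deriv_cong[of "- cball 0 R"]) (use that R in force)+
    then show ?thesis by simp
  qed
  define U where "U = ball z 1"
  have in_box: "x \<in> cbox a c" if "y \<in> U" "norm (y - x) \<le> R" for x y
  proof -
    have "norm x \<le> norm y + norm (y - x)"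
      using norm_triangle_ineq4[of y "y - x"] by simp
    moreover have "norm y \<le> norm z + 1"
      using that(1) norm_triangle_ineq4[of z "z - y"] by (auto simp: U_def dist_norm)
    ultimately show ?thesis using ac that(2) by auto
  qed
  have eq: "integral (cbox a c) (\<lambda>x. f x * h (y - x)) = conv f h y"
    if "csupp h" "\<And>x. h x \<noteq> 0 \<Longrightarrow> norm x \<le> R" "y \<in> U" for y h
    unfolding conv_def
    by (rule integral_cbox_csupp[OF csupp_conv_integrand[OF f that(1)]]) (use that in_box in auto)
  \<comment> \<open>The Leibniz rule takes the derivative as a bounded linear map that depends
    continuously on both variables; \<open>F y x\<close> is the differential of
    \<open>f x * g (y - x)\<close> in \<open>y\<close>.\<close>
  define F where "F y x = f x *\<^sub>R (\<Sum>b\<in>Basis. partial_deriv b g (y - x) *\<^sub>R blinfun_inner_left b)" for x y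
  have F_apply: "blinfun_apply (F y x) h = f x * (\<Sum>b\<in>Basis. (h \<bullet> b) * partial_deriv b g (y - x))" for y x h
    by (simp add: F_def blinfun.scaleR_left blinfun.sum_left mult.commute)
  have der: "((\<lambda>y. f x * g (y - x)) has_derivative blinfun_apply (F y x)) (at y within U)" for x y
  proof -
    have "((\<lambda>y. y - x) has_derivative (\<lambda>h. h)) (at y)"
      by (auto intro!: derivative_eq_intros)
    from has_derivative_compose[OF this has_derivative_partial_deriv[OF gd]]
    have "((\<lambda>y. f x * g (y - x)) has_derivative
        (\<lambda>h. f x * (\<Sum>b\<in>Basis. (h \<bullet> b) * partial_deriv b g (y - x)))) (at y)"
      by (rule has_derivative_mult_right)
    then show ?thesis
      unfolding F_apply[symmetric] by (rule has_derivative_at_withinI)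
  qed
  have contF: "continuous_on (U \<times> cbox a c) (\<lambda>(y, x). F y x)"
    unfolding F_def split_beta
    by (intro continuous_intros continuous_on_compose2[OF f] continuous_on_compose2[OF cg]) auto
  have int1: "(\<lambda>x. f x * g (y - x)) integrable_on cbox a c" for y
    using csupp_continuous[OF csupp_conv_integrand[OF f g(2)]]
    by (intro integrable_continuous) (rule continuous_on_subset, auto)
  have "((\<lambda>y. integral (cbox a c) (\<lambda>x. f x * g (y - x))) has_derivative integral (cbox a c) (F z)) (at z within U)"
  proof (rule leibniz_rule[where f = "\<lambda>y x. f x * g (y - x)" and fx = F])
    show "((\<lambda>y. f x * g (y - x)) has_derivative blinfun_apply (F y x)) (at y within U)" for x y
      by (rule der)
    show "(\<lambda>x. f x * g (y - x)) integrable_on cbox a c" for y by (rule int1)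
    show "continuous_on (U \<times> cbox a c) (\<lambda>(y, x). F y x)" by (rule contF)
    show "z \<in> U" "convex U" by (simp_all add: U_def)
  qed
  then have "((\<lambda>y. integral (cbox a c) (\<lambda>x. f x * g (y - x))) has_derivative integral (cbox a c) (F z)) (at z)"
    using at_within_open[of z U] by (simp only: U_def open_ball centre_in_ball zero_less_one)
  then have D: "(conv f g has_derivative integral (cbox a c) (F z)) (at z)"
    by (rule has_derivative_transform_within_open[of _ _ _ UNIV U])
      (simp_all add: U_def eq[unfolded U_def] g R less_imp_le)
  then show "conv f g differentiable (at z)" by (rule differentiableI)
  show "partial_deriv b (conv f g) z = conv f (partial_deriv b g) z" if b: "b \<in> Basis"
  proof -
    have "F z integrable_on cbox a c"
      by (intro integrable_continuous continuous_on_compose2[OF contF, of _ "\<lambda>x. (z, x)", simplified]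
          continuous_intros) (simp add: U_def image_subset_iff)
    then have "partial_deriv b (conv f g) z = integral (cbox a c) (\<lambda>x. F z x b)"
      using partial_deriv_eq[OF D] by (simp add: blinfun_apply_integral)
    also have "(\<lambda>x. blinfun_apply (F z x) b) = (\<lambda>x. f x * partial_deriv b g (z - x))"
      using b by (auto simp: F_apply inner_Basis if_distrib if_distribR sum.delta cong: if_cong)
    also have "integral (cbox a c) \<dots> = conv f (partial_deriv b g) z"
    proof (rule eq)
      show "csupp (partial_deriv b g)"
        using csupp_partial_deriv[of 0 g b] g b by simp
      show "norm x \<le> R" if "partial_deriv b g x \<noteq> 0" for x
        using pd0[of x b] that by (meson not_le)
      show "z \<in> U" by (simp add: U_def)
    qed
    finally show ?thesis .
  qed
qed

lemma continuous_on_conv: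
  assumes f: "csupp f" and g: "csupp g"
  shows "continuous_on UNIV (conv f g)"
  unfolding continuous_on_iff
proof (intro ballI allI impI)
  fix z and e :: real assume "e > 0"
  let ?I = "LINT x|lborel. \<bar>f x\<bar>"
  have I: "?I \<ge> 0" by (intro Bochner_Integration.integral_nonneg) auto
  \<comment> \<open>The summand 1 in the denominator guards against a vanishing integral of
    \<open>\<bar>f\<bar>\<close>.\<close>
  obtain d where d: "d > 0" "\<And>x y. norm (x - y) < d \<Longrightarrow> \<bar>g x - g y\<bar> < e / (?I + 1)"
    using csupp_uniformly_continuous[OF g, of "e / (?I + 1)"] \<open>e > 0\<close> I by auto
  have "dist (conv f g y) (conv f g z) < e" if "dist y z < d" for y
  proof -
    have ii: "integrable lborel (\<lambda>x. f x * g (w - x))" for w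
      using integrable_conv[OF csupp_continuous[OF f] g] .
    have "\<bar>conv f g y - conv f g z\<bar> = \<bar>LINT x|lborel. f x * g (y - x) - f x * g (z - x)\<bar>"
      unfolding conv_def using ii by (subst Bochner_Integration.integral_diff) auto
    also have "\<dots> \<le> (LINT x|lborel. \<bar>f x * g (y - x) - f x * g (z - x)\<bar>)"
      by (rule integral_abs_bound)
    also have "\<dots> \<le> (LINT x|lborel. \<bar>f x\<bar> * (e / (?I + 1)))"
    proof (rule integral_mono)
      show "integrable lborel (\<lambda>x. \<bar>f x * g (y - x) - f x * g (z - x)\<bar>)"
        using ii by auto
      show "integrable lborel (\<lambda>x. \<bar>f x\<bar> * (e / (?I + 1)))"
        using csupp_integrable[OF f] by auto
      fix x
      have "\<bar>g (y - x) - g (z - x)\<bar> < e / (?I + 1)"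
        using that by (intro d) (simp add: dist_norm)
      then show "\<bar>f x * g (y - x) - f x * g (z - x)\<bar> \<le> \<bar>f x\<bar> * (e / (?I + 1))"
        unfolding right_diff_distrib[symmetric] abs_mult by (intro mult_left_mono) simp_all
    qed
    also have "\<dots> = ?I * e / (?I + 1)"
      by simp
    also have "\<dots> < e"
    proof -
      have "?I + 1 > 0" using I by linarith
      then show ?thesis
        using \<open>e > 0\<close> by (subst pos_divide_less_eq) (simp_all add: algebra_simps)
    qed
    finally show ?thesis by (simp add: dist_real_def)
  qed
  then show "\<exists>d>0. \<forall>y\<in>UNIV. dist y z < d \<longrightarrow> dist (conv f g y) (conv f g z) < e"
    using d(1) by blast
qed

lemma Ck_on_conv:
  assumes "csupp f"
  shows "Ck_on k g UNIV \<Longrightarrow> csupp g \<Longrightarrow> Ck_on k (conv f g) UNIV"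
proof (induction k arbitrary: g)
  case 0
  then show ?case using continuous_on_conv[OF assms] by simp
next
  case (Suc k)
  have g1: "Ck_on 1 g UNIV"
    using Suc.prems(1) by (auto intro: Ck_on_imp_continuous_on)
  have f: "continuous_on UNIV f" by (rule csupp_continuous[OF assms])
  have "Ck_on k (partial_deriv b (conv f g)) UNIV" if "b \<in> Basis" for b
  proof -
    have "partial_deriv b (conv f g) = conv f (partial_deriv b g)"
      using partial_deriv_conv[OF f g1 Suc.prems(2) that] by blast
    then show ?thesis
      using Suc.IH[of "partial_deriv b g"] csupp_partial_deriv[OF Suc.prems that] Suc.prems that by simp
  qed
  then show ?case using conv_differentiable[OF f g1 Suc.prems(2)] by simp
qed

text \<open>The convolution of \<open>g\<close> with the constant 1 is constant, so its derivative
  vanishes; moved under the integral, that derivative is the integral of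
  \<open>partial_deriv b g\<close>. This stands in for Fubini and the fundamental theorem of
  calculus.\<close>

lemma integral_partial_deriv_eq_0:
  assumes "Ck_on 1 g UNIV" "csupp g" "b \<in> Basis"
  shows "(LINT x|lborel. partial_deriv b g x) = 0"
proof -
  have *: "conv (\<lambda>x. 1) h z = (LINT x|lborel. h x)" if "csupp h" for h :: "'a \<Rightarrow> real" and z
    unfolding conv_def using integral_reflect[of h z] csupp_borel[OF that] by simp
  have "conv (\<lambda>x. 1) g = (\<lambda>z. LINT x|lborel. g x)"
    using *[OF assms(2)] by auto
  then have "partial_deriv b (conv (\<lambda>x. 1) g) 0 = 0"
    by simp
  moreover have "csupp (partial_deriv b g)"
    using assms csupp_partial_deriv[of 0] by auto
  ultimately show ?thesis
    using partial_deriv_conv[of "\<lambda>x. 1" g b 0] assms * by simp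
qed

lemma integral_by_parts_csupp:
  assumes "Ck_on 1 f UNIV" "Ck_on 1 g UNIV" "csupp f" "b \<in> Basis"
  shows "(LINT x|lborel. f x * partial_deriv b g x) = - (LINT x|lborel. partial_deriv b f x * g x)"
proof -
  have c: "continuous_on UNIV g" "continuous_on UNIV (partial_deriv b g)"
    using assms Ck_on_imp_continuous_on[OF assms(2)] by auto
  have fg: "Ck_on 1 (\<lambda>x. f x * g x) UNIV" "csupp (\<lambda>x. f x * g x)"
    by (intro Ck_on_mult assms open_UNIV) (intro csupp_mult assms c)
  have i: "integrable lborel (\<lambda>x. f x * partial_deriv b g x)" "integrable lborel (\<lambda>x. partial_deriv b f x * g x)"
    using assms c csupp_partial_deriv[of 0 f b]
    by (simp_all add: csupp_integrable csupp_mult)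
  have "partial_deriv b (\<lambda>x. f x * g x) = (\<lambda>x. f x * partial_deriv b g x + partial_deriv b f x * g x)"
    using assms by (auto simp: partial_deriv_mult)
  then have "0 = (LINT x|lborel. f x * partial_deriv b g x + partial_deriv b f x * g x)"
    using integral_partial_deriv_eq_0[OF fg assms(4)] by simp
  also have "\<dots> = (LINT x|lborel. f x * partial_deriv b g x) + (LINT x|lborel. partial_deriv b f x * g x)"
    by (rule Bochner_Integration.integral_add[OF i])
  finally show ?thesis by simp
qed

section \<open>Mollification\<close>

text \<open>Besides positivity of integrals, this explicit form yields a lower bound for the
  integral of the squared trial function that is uniform in the regularisation parameters.\<close>

lemma csupp_integral_ge:
  assumes "csupp f" "\<And>x. 0 \<le> f x" "\<And>x. x \<in> ball a r \<Longrightarrow> c \<le> f x"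
  shows "c * measure lborel (ball a r) \<le> (LINT x|lborel. f x)"
proof -
  have "(LINT x|lborel. c * indicator (ball a r) x) \<le> (LINT x|lborel. f x)"
  proof (rule integral_mono)
    show "integrable lborel (\<lambda>x. c * indicator (ball a r) x)"
      using emeasure_lborel_ball_finite[of a r] by (intro integrable_mult_right integrable_real_indicator) auto
    show "integrable lborel f" by (rule csupp_integrable[OF assms(1)])
    show "c * indicator (ball a r) x \<le> f x" for x
      using assms(2,3)[of x] by (auto simp: indicator_def)
  qed
  then show ?thesis by simp
qed

lemma csupp_integral_pos:
  assumes "csupp f" "\<And>x. 0 \<le> f x" "0 < f a"
  shows "0 < (LINT x|lborel. f x)"
proof -
  obtain r where r: "r > 0" "\<And>x y. norm (x - y) < r \<Longrightarrow> \<bar>f x - f y\<bar> < f a / 2"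
    using csupp_uniformly_continuous[OF assms(1), of "f a / 2"] assms(3) by auto
  have "f a / 2 \<le> f x" if "x \<in> ball a r" for x
    using r(2)[of x a] that abs_ge_minus_self[of "f x - f a"] by (simp add: dist_norm norm_minus_commute)
  from csupp_integral_ge[OF assms(1,2) this]
  have "f a / 2 * measure lborel (ball a r) \<le> (LINT x|lborel. f x)" .
  moreover have "0 < f a / 2 * measure lborel (ball a r)"
    using content_ball_pos[OF r(1), of a] assms(3) by simp
  ultimately show ?thesis by linarith
qed

section \<open>A smooth bump function\<close>

definition flat_exp :: "real poly \<Rightarrow> real \<Rightarrow> real" where
  "flat_exp P s = (if s \<le> 0 then 0 else poly P (1 / s) * exp (- (1 / s)))"

lemma tendsto_poly_exp_at_top: "((\<lambda>x. poly P x * exp (- x)) \<longlongrightarrow> (0::real)) at_top"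
proof -
  have "((\<lambda>x. \<Sum>i\<le>degree P. coeff P i * (x ^ i / exp x)) \<longlongrightarrow> (\<Sum>i\<le>degree P. coeff P i * 0)) at_top"
    by (intro tendsto_intros tendsto_power_div_exp_0)
  then show ?thesis
    by (simp add: poly_altdef sum_distrib_right exp_minus divide_inverse mult.assoc)
qed

text \<open>The functions \<open>P(1/s) exp(-1/s)\<close>, extended by 0, are closed under
  differentiation: \<open>P\<close> becomes \<open>X^2 (P - P')\<close>. Smoothness of all orders
  thus reduces to one derivative formula.\<close>

lemma DERIV_flat_exp:
  "(flat_exp P has_real_derivative flat_exp (monom 1 2 * (P - pderiv P)) s) (at s)"
proof -
  consider "s < 0" | "s > 0" | "s = 0" by linarith
  then show ?thesis
  proof cases
    case 1
    have "((\<lambda>s. 0) has_real_derivative 0) (at s)" by simp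
    then have "(flat_exp P has_real_derivative 0) (at s)"
      by (rule has_field_derivative_transform_within_open[of _ _ _ "{..<0}"])
        (use 1 in \<open>auto simp: flat_exp_def\<close>)
    then show ?thesis using 1 by (simp add: flat_exp_def)
  next
    case 2
    have "((\<lambda>s. poly P (1 / s) * exp (- (1 / s))) has_real_derivative
        flat_exp (monom 1 2 * (P - pderiv P)) s) (at s)"
      using 2
      by (auto intro!: derivative_eq_intros DERIV_chain2[OF poly_DERIV]
          simp: flat_exp_def poly_monom field_simps power2_eq_square)
    then show ?thesis
      by (rule has_field_derivative_transform_within_open[of _ _ _ "{0<..}"])
        (use 2 in \<open>auto simp: flat_exp_def\<close>)
  next
    case 3
    \<comment> \<open>With \<open>X = 1/h\<close> the difference quotient at 0 from the right is
      \<open>X P(X) exp(-X)\<close>; the factor \<open>monom 1 1\<close> is the extra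
      \<open>X\<close>.\<close>
    have "((\<lambda>h. poly (monom 1 1 * P) (inverse h) * exp (- inverse h)) \<longlongrightarrow> (0::real)) (at_right 0)"
      using filterlim_compose[OF tendsto_poly_exp_at_top filterlim_inverse_at_top_right] .
    then have "((\<lambda>h. (flat_exp P (0 + h) - flat_exp P 0) / h) \<longlongrightarrow> 0) (at_right 0)"
    proof (rule Lim_transform_eventually)
      show "\<forall>\<^sub>F h in at_right 0. poly (monom 1 1 * P) (inverse h) * exp (- inverse h)
          = (flat_exp P (0 + h) - flat_exp P 0) / h"
        using eventually_at_right_less[of 0]
        by eventually_elim (simp add: flat_exp_def poly_monom field_simps)
    qed
    moreover have "((\<lambda>h. (flat_exp P (0 + h) - flat_exp P 0) / h) \<longlongrightarrow> 0) (at_left 0)"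
    proof (rule Lim_transform_eventually[OF tendsto_const])
      show "\<forall>\<^sub>F h in at_left 0. 0 = (flat_exp P (0 + h) - flat_exp P 0) / h"
        unfolding eventually_at_left_field by (intro exI[of _ "-1"]) (auto simp: flat_exp_def)
    qed
    ultimately have "((\<lambda>h. (flat_exp P (0 + h) - flat_exp P 0) / h) \<longlongrightarrow> 0) (at 0)"
      by (simp add: filterlim_at_split)
    then show ?thesis using 3 by (simp add: DERIV_def flat_exp_def)
  qed
qed

text \<open>\<open>flat_exp (flat_poly j)\<close> is the \<open>j\<close>-th derivative of
  \<open>exp(-1/s)\<close> extended by 0.\<close>

fun flat_poly :: "nat \<Rightarrow> real poly" where
  "flat_poly 0 = 1"
| "flat_poly (Suc j) = monom 1 2 * (flat_poly j - pderiv (flat_poly j))"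

lemma Ck_on_inner: "Ck_on k (\<lambda>x. x \<bullet> c) U"
proof (cases k)
  case 0
  then show ?thesis by (auto intro: continuous_intros)
next
  case (Suc j)
  have "partial_deriv b (\<lambda>x. x \<bullet> c) = (\<lambda>x. b \<bullet> c)" for b :: 'a
    by (rule ext, rule partial_deriv_eq) (auto intro!: derivative_eq_intros)
  moreover have "(\<lambda>x. x \<bullet> c) differentiable (at x)" for x
    by (rule differentiableI[of _ "\<lambda>h. h \<bullet> c"]) (auto intro!: derivative_eq_intros)
  ultimately show ?thesis using Suc by simp
qed

definition bump :: "'a::euclidean_space \<Rightarrow> real" where
  "bump x = flat_exp (flat_poly 0) (1 - x \<bullet> x)"

lemma Ck_on_bump: "Ck_on k bump UNIV"
proof -
  have "Ck_on k (\<lambda>x::'a. 1 - (\<Sum>b\<in>Basis. (x \<bullet> b) * (x \<bullet> b))) UNIV"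
    by (intro Ck_on_diff Ck_on_const Ck_on_sum Ck_on_mult Ck_on_inner open_UNIV)
  then have *: "Ck_on k (\<lambda>x::'a. 1 - x \<bullet> x) UNIV"
    by (simp add: euclidean_inner[symmetric])
  have "Ck_on k (\<lambda>x::'a. flat_exp (flat_poly 0) (1 - x \<bullet> x)) UNIV"
  proof (rule Ck_on_compose[where \<psi> = "\<lambda>j. flat_exp (flat_poly j)" and S = UNIV, OF open_UNIV _ _ *])
    show "(flat_exp (flat_poly j) has_real_derivative flat_exp (flat_poly (Suc j)) s) (at s)" for j s
      using DERIV_flat_exp by simp
    show "continuous_on UNIV (flat_exp (flat_poly (0 + k)))"
      by (meson DERIV_flat_exp DERIV_isCont continuous_at_imp_continuous_on)
  qed simp
  then show ?thesis by (simp add: bump_def[abs_def])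
qed

lemma bump_nonneg: "0 \<le> bump x"
  by (simp add: bump_def flat_exp_def)

lemma bump_pos_0: "0 < bump 0"
  by (simp add: bump_def flat_exp_def)

lemma bump_support: "bump x \<noteq> 0 \<Longrightarrow> norm x < 1"
  using power_le_one_iff[of "norm x" 2] power2_less_imp_less[of "norm x" 1]
  by (auto simp: bump_def flat_exp_def dot_square_norm split: if_splits)

lemma ex_mollifier:
  assumes "0 < r"
  obtains \<rho> :: "'a::euclidean_space \<Rightarrow> real" where "\<And>k. Ck_on k \<rho> UNIV" "csupp \<rho>"
    "\<And>x. 0 \<le> \<rho> x" "\<And>x. \<rho> x \<noteq> 0 \<Longrightarrow> norm x < r" "(LINT x|lborel. \<rho> x) = 1"
proof -
  define \<beta> where "\<beta> x = bump ((1 / r) *\<^sub>R x)" for x :: 'a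
  have Ck: "Ck_on k \<beta> UNIV" for k
    unfolding \<beta>_def by (rule Ck_on_scale[OF Ck_on_bump])
  have supp: "norm x < r" if "\<beta> x \<noteq> 0" for x
    using bump_support[of "(1 / r) *\<^sub>R x"] that assms by (simp add: \<beta>_def)
  have cs: "csupp \<beta>"
    by (rule csuppI[of _ "ball 0 r"]) (use Ck_on_imp_continuous_on[OF Ck[of 0]] supp in auto)
  have I: "0 < (LINT x|lborel. \<beta> x)"
    by (rule csupp_integral_pos[OF cs, of 0]) (auto simp: \<beta>_def bump_nonneg bump_pos_0)
  show ?thesis
  proof (rule that[of "\<lambda>x. inverse (LINT x|lborel. \<beta> x) * \<beta> x"])
    show "(LINT x|lborel. inverse (LINT x|lborel. \<beta> x) * \<beta> x) = 1"
      using I by simp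
    show "0 \<le> inverse (LINT x|lborel. \<beta> x) * \<beta> x" for x
      using I by (intro mult_nonneg_nonneg) (simp_all add: \<beta>_def bump_nonneg)
    show "Ck_on k (\<lambda>x. inverse (LINT x|lborel. \<beta> x) * \<beta> x) UNIV" for k
      by (intro Ck_on_cmult open_UNIV Ck)
    show "csupp (\<lambda>x. inverse (LINT x|lborel. \<beta> x) * \<beta> x)"
      by (rule csupp_cmult[OF cs])
  qed (use supp in auto)
qed

lemma mollify_close:
  assumes "csupp f" "csupp \<rho>" "\<And>x. 0 \<le> \<rho> x" "(LINT x|lborel. \<rho> x) = 1"
    and "\<And>x. \<rho> x \<noteq> 0 \<Longrightarrow> norm x < r"
    and "\<And>x y. norm (x - y) < r \<Longrightarrow> \<bar>f x - f y\<bar> \<le> e"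
  shows "\<bar>conv f \<rho> z - f z\<bar> \<le> e"
proof -
  have I: "integrable lborel (\<lambda>x. \<rho> (z - x))" "(LINT x|lborel. \<rho> (z - x)) = 1"
    using csupp_integrable[OF csupp_reflect[OF assms(2)]] integral_reflect[of \<rho> z] assms(2,4)
    by (simp_all add: csupp_borel)
  have i: "integrable lborel (\<lambda>x. f x * \<rho> (z - x))"
    using integrable_conv[OF csupp_continuous[OF assms(1)] assms(2)] .
  have d: "integrable lborel (\<lambda>x. (f x - f z) * \<rho> (z - x))"
    unfolding left_diff_distrib using i I by (intro Bochner_Integration.integrable_diff) auto
  have "conv f \<rho> z - f z = (LINT x|lborel. (f x - f z) * \<rho> (z - x))"
    unfolding conv_def left_diff_distrib using i I by (subst Bochner_Integration.integral_diff) auto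
  also have "\<bar>\<dots>\<bar> \<le> (LINT x|lborel. \<bar>(f x - f z) * \<rho> (z - x)\<bar>)"
    by (rule integral_abs_bound)
  also have "\<dots> \<le> (LINT x|lborel. e * \<rho> (z - x))"
  proof (rule integral_mono)
    show "integrable lborel (\<lambda>x. \<bar>(f x - f z) * \<rho> (z - x)\<bar>)" using d by (rule integrable_abs)
    show "integrable lborel (\<lambda>x. e * \<rho> (z - x))" using I by simp
    fix x
    show "\<bar>(f x - f z) * \<rho> (z - x)\<bar> \<le> e * \<rho> (z - x)"
    proof (cases "\<rho> (z - x) = 0")
      case False
      then have "\<bar>f x - f z\<bar> \<le> e"
        using assms(5)[of "z - x"] assms(6)[of x z] by (simp add: norm_minus_commute)
      then show ?thesis using assms(3)[of "z - x"] by (simp add: abs_mult mult_right_mono)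
    qed simp
  qed
  also have "\<dots> = e" using I by simp
  finally show ?thesis .
qed

section \<open>Compact support inside an open set and approximation by test functions\<close>

definition csupp_in :: "'a::euclidean_space set \<Rightarrow> ('a \<Rightarrow> real) \<Rightarrow> bool" where
  "csupp_in \<Omega> f \<longleftrightarrow> continuous_on UNIV f \<and> (\<exists>K. compact K \<and> K \<subseteq> \<Omega> \<and> (\<forall>x. x \<notin> K \<longrightarrow> f x = 0))"

lemma csupp_in_csupp: "csupp_in \<Omega> f \<Longrightarrow> csupp f"
  unfolding csupp_in_def by (metis csuppI compact_imp_bounded)

lemma csupp_in_subset:
  assumes "csupp_in \<Omega> g" "continuous_on UNIV f" "\<And>x. g x = 0 \<Longrightarrow> f x = 0"
  shows "csupp_in \<Omega> f"
  using assms unfolding csupp_in_def by meson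

lemma csupp_in_outside: "csupp_in \<Omega> f \<Longrightarrow> x \<notin> \<Omega> \<Longrightarrow> f x = 0"
  unfolding csupp_in_def by blast

lemma csupp_in_partial_deriv:
  assumes "Ck_on (Suc k) f UNIV" "csupp_in \<Omega> f" "b \<in> Basis"
  shows "csupp_in \<Omega> (partial_deriv b f)"
proof -
  obtain K where K: "compact K" "K \<subseteq> \<Omega>" "\<And>x. x \<notin> K \<Longrightarrow> f x = 0"
    using assms(2) unfolding csupp_in_def by blast
  have "partial_deriv b f x = 0" if "x \<notin> K" for x
  proof -
    have "open (- K)" using K(1) by (simp add: compact_imp_closed open_Compl)
    then have "partial_deriv b f x = partial_deriv b (\<lambda>x. 0) x"
      by (rule partial_deriv_cong) (simp_all add: that K(3))
    then show ?thesis by simp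
  qed
  moreover have "continuous_on UNIV (partial_deriv b f)"
    using assms(1,3) by (intro Ck_on_imp_continuous_on[of k]) simp
  ultimately show ?thesis
    using K(1,2) unfolding csupp_in_def by blast
qed

lemma test_functions_iff:
  "\<phi> \<in> test_functions \<Omega> \<longleftrightarrow> (\<forall>k. Ck_on k \<phi> UNIV) \<and> csupp_in \<Omega> \<phi>"
proof
  assume \<phi>: "\<phi> \<in> test_functions \<Omega>"
  then have "continuous_on UNIV \<phi>" "\<forall>k. Ck_on k \<phi> UNIV"
    using Ck_on_imp_continuous_on unfolding test_functions_def by blast+
  moreover have "x \<notin> closure {x. \<phi> x \<noteq> 0} \<Longrightarrow> \<phi> x = 0" for x
    using closure_subset[of "{x. \<phi> x \<noteq> 0}"] by blast
  ultimately show "(\<forall>k. Ck_on k \<phi> UNIV) \<and> csupp_in \<Omega> \<phi>"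
    using \<phi> unfolding test_functions_def csupp_in_def by blast
next
  assume \<phi>: "(\<forall>k. Ck_on k \<phi> UNIV) \<and> csupp_in \<Omega> \<phi>"
  then obtain K where K: "compact K" "K \<subseteq> \<Omega>" "\<And>x. x \<notin> K \<Longrightarrow> \<phi> x = 0"
    unfolding csupp_in_def by blast
  have "closure {x. \<phi> x \<noteq> 0} \<subseteq> K"
    using K(1,3) by (intro closure_minimal compact_imp_closed) blast+
  moreover have "compact (closure {x. \<phi> x \<noteq> 0})"
    using \<phi> csupp_in_csupp[of \<Omega> \<phi>] by (simp add: csupp_def compact_closure)
  ultimately show "\<phi> \<in> test_functions \<Omega>"
    using \<phi> K(2) unfolding test_functions_def by blast
qed

text \<open>Mollification with radii tending to 0. They stay below half the margin \<open>d\<close>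
  between \<open>K\<close> and the complement of \<open>\<Omega>\<close>, so the supports remain in
  the compact set of points within \<open>d / 2\<close> of \<open>K\<close>.\<close>

lemma csupp_in_approx:
  assumes "open \<Omega>" "csupp_in \<Omega> f"
  obtains \<Phi> where "\<forall>k. \<Phi> k \<in> test_functions \<Omega>"
    "\<forall>e>0. \<forall>\<^sub>F k in sequentially. \<forall>x. \<bar>\<Phi> k x - f x\<bar> \<le> e"
    "Ck_on 1 f UNIV \<longrightarrow> (\<forall>b\<in>Basis. \<forall>e>0. \<forall>\<^sub>F k in sequentially.
      \<forall>x. \<bar>partial_deriv b (\<Phi> k) x - partial_deriv b f x\<bar> \<le> e)"
proof -
  obtain K where K: "compact K" "K \<subseteq> \<Omega>" "\<And>x. x \<notin> K \<Longrightarrow> f x = 0"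
    using assms(2) unfolding csupp_in_def by blast
  obtain d where d: "d > 0" "(\<Union>x\<in>K. ball x d) \<subseteq> \<Omega>"
    using compact_subset_open_imp_ball_epsilon_subset[OF K(1) assms(1) K(2)] by blast
  define r where "r k = min (d / 2) (1 / real (Suc k))" for k
  have r: "0 < r k" "r k \<le> d / 2" for k
    using d(1) by (auto simp: r_def)
  have "\<exists>\<rho> :: 'a \<Rightarrow> real. (\<forall>j. Ck_on j \<rho> UNIV) \<and> csupp \<rho> \<and> (\<forall>x. 0 \<le> \<rho> x) \<and>
      (\<forall>x. \<rho> x \<noteq> 0 \<longrightarrow> norm x < r k) \<and> (LINT x|lborel. \<rho> x) = 1" for k
    by (rule ex_mollifier[OF r(1)[of k]]) blast
  then obtain \<rho> :: "nat \<Rightarrow> 'a \<Rightarrow> real" where \<rho>: "\<And>k j. Ck_on j (\<rho> k) UNIV" "\<And>k. csupp (\<rho> k)"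
      "\<And>k x. 0 \<le> \<rho> k x" "\<And>k x. \<rho> k x \<noteq> 0 \<Longrightarrow> norm x < r k" "\<And>k. (LINT x|lborel. \<rho> k x) = 1"
    by metis
  have f: "csupp f" by (rule csupp_in_csupp[OF assms(2)])
  have conv0: "\<forall>\<^sub>F k in sequentially. \<forall>x. \<bar>conv h (\<rho> k) x - h x\<bar> \<le> e" if h: "csupp h" and e: "0 < e" for h e
  proof -
    obtain s where s: "s > 0" "\<And>x y. norm (x - y) < s \<Longrightarrow> \<bar>h x - h y\<bar> < e"
      using csupp_uniformly_continuous[OF h e] by blast
    have "\<forall>\<^sub>F k in sequentially. 1 / real (Suc k) < s"
      using s(1) LIMSEQ_inverse_real_of_nat by (intro order_tendstoD(2)) (auto simp: inverse_eq_divide)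
    then show ?thesis
    proof eventually_elim
      case (elim k)
      have "\<bar>h x - h y\<bar> \<le> e" if "norm (x - y) < r k" for x y
        using s(2)[of x y] that elim by (simp add: r_def)
      then show ?case
        using mollify_close[OF h \<rho>(2,3,5,4)] by blast
    qed
  qed
  show ?thesis
  proof (rule that[of "\<lambda>k. conv f (\<rho> k)"]; intro allI impI ballI)
    show "conv f (\<rho> k) \<in> test_functions \<Omega>" for k
    proof -
      let ?K = "{x + y |x y. x \<in> K \<and> y \<in> cball 0 (d / 2)}"
      have "compact ?K" by (intro compact_sums K(1) compact_cball)
      moreover have "?K \<subseteq> \<Omega>"
      proof
        fix z assume "z \<in> ?K"
        then obtain x y where "z = x + y" "x \<in> K" "norm y \<le> d / 2" by auto
        then have "z \<in> ball x d" using d(1) by (simp add: dist_norm)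
        then show "z \<in> \<Omega>" using \<open>x \<in> K\<close> d(2) by blast
      qed
      moreover have "conv f (\<rho> k) z = 0" if "z \<notin> ?K" for z
      proof (rule ccontr)
        assume "conv f (\<rho> k) z \<noteq> 0"
        then obtain x where x: "f x \<noteq> 0" "\<rho> k (z - x) \<noteq> 0" by (rule conv_support)
        then have "x \<in> K" "norm (z - x) \<le> d / 2"
          using K(3) \<rho>(4)[OF x(2)] r(2)[of k] by force+
        moreover have "z = x + (z - x)" by simp
        ultimately have "z \<in> ?K" unfolding mem_Collect_eq mem_cball_0 by blast
        then show False using that by blast
      qed
      ultimately have "csupp_in \<Omega> (conv f (\<rho> k))"
        unfolding csupp_in_def using continuous_on_conv[OF f \<rho>(2)] by blast
      then show ?thesis
        using Ck_on_conv[OF f \<rho>(1,2)] by (simp add: test_functions_iff)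
    qed
    show "\<forall>\<^sub>F k in sequentially. \<forall>x. \<bar>conv f (\<rho> k) x - f x\<bar> \<le> e" if "e > 0" for e
      by (rule conv0[OF f that])
    show "\<forall>\<^sub>F k in sequentially. \<forall>x. \<bar>partial_deriv b (conv f (\<rho> k)) x - partial_deriv b f x\<bar> \<le> e"
      if "Ck_on 1 f UNIV" "b \<in> Basis" "e > 0" for e b
    proof -
      have pf: "csupp (partial_deriv b f)"
        using csupp_partial_deriv[of 0 f b] that f by simp
      \<comment> \<open>Commutativity lets the derivative fall on \<open>f\<close> instead of the
        mollifier, so uniform convergence for continuous functions applies to
        \<open>partial_deriv b f\<close>.\<close>
      have "partial_deriv b (conv f (\<rho> k)) = conv (partial_deriv b f) (\<rho> k)" for k
      proof -
        have "conv f (\<rho> k) = conv (\<rho> k) f"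
          by (rule conv_commute) (use f \<rho>(2) csupp_borel in auto)
        moreover have "partial_deriv b (conv (\<rho> k) f) = conv (\<rho> k) (partial_deriv b f)"
          using partial_deriv_conv[OF csupp_continuous[OF \<rho>(2)] that(1) f that(2)] by blast
        moreover have "conv (\<rho> k) (partial_deriv b f) = conv (partial_deriv b f) (\<rho> k)"
          by (rule conv_commute) (use pf \<rho>(2) csupp_borel in auto)
        ultimately show ?thesis by simp
      qed
      then show ?thesis using conv0[OF pf that(3)] by simp
    qed
  qed
qed

section \<open>Uniqueness of weak gradients\<close>

text \<open>The Sobolev definitions integrate over \<open>lebesgue_on \<Omega>\<close>, convolution
  and integration by parts over \<open>lborel\<close>; the two agree for functions that vanish off
  \<open>\<Omega>\<close>.\<close>

lemma
  assumes "open \<Omega>" "csupp_in \<Omega> f"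
  shows integral_lebesgue_on_csupp_in: "(LINT x|lebesgue_on \<Omega>. f x) = (LINT x|lborel. f x)"
    and integrable_lebesgue_on_csupp_in: "integrable (lebesgue_on \<Omega>) f"
proof -
  have eq: "(\<lambda>x. indicator \<Omega> x *\<^sub>R f x) = f"
  proof
    show "indicator \<Omega> x *\<^sub>R f x = f x" for x
      using csupp_in_outside[OF assms(2), of x] by (cases "x \<in> \<Omega>") simp_all
  qed
  have [measurable]: "\<Omega> \<in> sets lebesgue" using assms(1) by auto
  have bm: "f \<in> borel_measurable lborel"
    using csupp_borel[OF csupp_in_csupp[OF assms(2)]] by simp
  have "(LINT x|lebesgue_on \<Omega>. f x) = (LINT x|lebesgue. f x)"
    by (subst integral_restrict_space) (use eq in simp_all)
  then show "(LINT x|lebesgue_on \<Omega>. f x) = (LINT x|lborel. f x)"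
    using integral_completion[OF bm] by simp
  have "integrable lebesgue f"
    using csupp_integrable[OF csupp_in_csupp[OF assms(2)]] by (rule integrable_completion[OF bm, THEN iffD2])
  then show "integrable (lebesgue_on \<Omega>) f"
    by (subst integrable_restrict_space) (use eq in simp_all)
qed

lemma borel_measurable_lebesgue_on_continuous:
  fixes f :: "'a::euclidean_space \<Rightarrow> real"
  assumes "continuous_on UNIV f"
  shows "f \<in> borel_measurable (lebesgue_on \<Omega>)"
proof -
  have "f \<in> borel_measurable borel" using assms by (rule borel_measurable_continuous_onI)
  then have "f \<in> borel_measurable lebesgue" by (simp add: measurable_completion)
  then show ?thesis by (rule measurable_restrict_space1)
qed

text \<open>Continuous cutoffs \<open>\<eta> k\<close> decrease to the indicator of
  \<open>K\<close>, so by dominated convergence \<open>h\<close> has integral 0 over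
  \<open>K\<close>. As \<open>h\<close> is positive there, \<open>K\<close> must be null.\<close>

lemma compact_null_of_integral_0:
  fixes h :: "'a::euclidean_space \<Rightarrow> real"
  assumes "open \<Omega>" "integrable (lebesgue_on \<Omega>) h"
    and "\<And>f. csupp_in \<Omega> f \<Longrightarrow> (LINT x|lebesgue_on \<Omega>. h x * f x) = 0"
    and K: "compact K" "K \<subseteq> \<Omega>" "\<And>x. x \<in> K \<Longrightarrow> 0 < h x"
  shows "K \<in> null_sets lebesgue"
proof (cases "K = {}")
  \<comment> \<open>For the empty set \<open>infdist\<close> would be 0 by convention, and the
    cutoffs below would not vanish anywhere.\<close>
  case False
  obtain d where d: "d > 0" "(\<Union>x\<in>K. cball x d) \<subseteq> \<Omega>"
    using compact_subset_open_imp_cball_epsilon_subset[OF K(1) assms(1) K(2)] by blast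
  \<comment> \<open>The slope is at least \<open>1 / d\<close>, so already \<open>\<eta> 0\<close>
    vanishes at distance \<open>d\<close> from \<open>K\<close>, inside the margin that
    \<open>\<Omega>\<close> leaves.\<close>
  define \<eta> where "\<eta> k x = max 0 (1 - real (Suc k) / d * infdist x K)" for k x
  have \<eta>: "csupp_in \<Omega> (\<eta> k)" for k
  proof -
    let ?L = "{x + y |x y. x \<in> K \<and> y \<in> cball 0 d}"
    have "continuous_on UNIV (\<eta> k)"
      unfolding \<eta>_def by (intro continuous_intros)
    moreover have "compact ?L" by (intro compact_sums K(1) compact_cball)
    moreover have "?L \<subseteq> \<Omega>"
    proof
      fix z assume "z \<in> ?L"
      then obtain x y where "z = x + y" "x \<in> K" "norm y \<le> d" by auto
      then have "z \<in> cball x d" by (simp add: dist_norm)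
      then show "z \<in> \<Omega>" using \<open>x \<in> K\<close> d(2) by blast
    qed
    moreover have "\<eta> k z = 0" if "z \<notin> ?L" for z
    proof -
      obtain x where x: "x \<in> K" "infdist z K = dist z x"
        using infdist_attains_inf[OF compact_imp_closed[OF K(1)] False] by blast
      have "z = x + (z - x)" by simp
      then have "norm (z - x) > d"
        using that x(1) unfolding mem_Collect_eq mem_cball_0 by (metis not_le)
      then have "infdist z K \<ge> d" using x(2) by (simp add: dist_norm)
      then have "1 \<le> real (Suc k) * (infdist z K / d)"
        using d(1) mult_mono[of 1 "real (Suc k)" 1 "infdist z K / d"] by simp
      then show ?thesis by (simp add: \<eta>_def)
    qed
    ultimately show ?thesis unfolding csupp_in_def by blast
  qed
  have lim: "(\<lambda>k. \<eta> k x) \<longlonglongrightarrow> indicator K x" for x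
  proof (cases "x \<in> K")
    case True
    then show ?thesis by (simp add: \<eta>_def)
  next
    case nx: False
    then have pos: "infdist x K > 0"
      using False K(1) by (simp add: compact_imp_closed infdist_pos_not_in_closed)
    have "\<forall>\<^sub>F k in sequentially. d / infdist x K < real (Suc k)"
      using filterlim_real_sequentially filterlim_sequentially_Suc[of real at_top]
      by (simp add: filterlim_at_top_dense)
    then have "\<forall>\<^sub>F k in sequentially. indicator K x = \<eta> k x"
    proof eventually_elim
      case (elim k)
      then have "1 < real (Suc k) / d * infdist x K"
        using d(1) pos by (simp add: field_simps)
      then show ?case using nx by (simp add: \<eta>_def)
    qed
    then show ?thesis by (rule tendsto_eventually[OF eventually_mono]) simp
  qed
  have hm: "h \<in> borel_measurable (lebesgue_on \<Omega>)" using assms(2) by simp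
  have Km: "K \<in> sets (lebesgue_on \<Omega>)" "K \<in> sets lebesgue"
    using K(1,2) assms(1) by (auto simp: sets_restrict_space_iff compact_imp_closed)
  have ind: "(indicator K :: 'a \<Rightarrow> real) \<in> borel_measurable (lebesgue_on \<Omega>)"
    using Km(1) by simp
  have "(\<lambda>k. LINT x|lebesgue_on \<Omega>. h x * \<eta> k x) \<longlonglongrightarrow> (LINT x|lebesgue_on \<Omega>. h x * indicator K x)"
  proof (rule integral_dominated_convergence[where w = "\<lambda>x. \<bar>h x\<bar>"])
    show "(\<lambda>x. h x * indicator K x) \<in> borel_measurable (lebesgue_on \<Omega>)"
      using hm ind by measurable
    show "(\<lambda>x. h x * \<eta> k x) \<in> borel_measurable (lebesgue_on \<Omega>)" for k
      using hm borel_measurable_lebesgue_on_continuous[of "\<eta> k"] \<eta>[of k]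
      by (auto simp: csupp_in_def intro: borel_measurable_times)
    show "integrable (lebesgue_on \<Omega>) (\<lambda>x. \<bar>h x\<bar>)" using assms(2) by simp
    show "AE x in lebesgue_on \<Omega>. (\<lambda>k. h x * \<eta> k x) \<longlonglongrightarrow> h x * indicator K x"
      by (intro AE_I2 tendsto_mult_left lim)
    show "AE x in lebesgue_on \<Omega>. norm (h x * \<eta> k x) \<le> \<bar>h x\<bar>" for k
    proof (intro AE_I2)
      fix x
      have "\<bar>\<eta> k x\<bar> \<le> 1" using infdist_nonneg[of x K] d(1) by (simp add: \<eta>_def)
      then show "norm (h x * \<eta> k x) \<le> \<bar>h x\<bar>"
        by (simp add: abs_mult mult_left_le)
    qed
  qed
  then have I0: "(LINT x|lebesgue_on \<Omega>. h x * indicator K x) = 0"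
    using assms(3)[OF \<eta>] by (simp add: LIMSEQ_const_iff)
  have "integrable (lebesgue_on \<Omega>) (\<lambda>x. h x * indicator K x)"
    using integrable_real_mult_indicator[OF Km(1) assms(2)] by simp
  then have "AE x in lebesgue_on \<Omega>. h x * indicator K x = 0"
    using I0 K(3) by (subst (asm) integral_nonneg_eq_0_iff_AE) (auto simp: indicator_def less_imp_le)
  then have "AE x in lebesgue_on \<Omega>. x \<notin> K"
  proof eventually_elim
    case (elim x)
    then show ?case using K(3)[of x] by (auto simp: indicator_def)
  qed
  then have "AE x in lebesgue. x \<notin> K"
    using assms(1) K(2) by (auto simp: AE_restrict_space_iff)
  then show ?thesis using Km(2) by (simp add: AE_iff_null)
qed auto

text \<open>Inner regularity: up to arbitrarily small measure the set where \<open>h\<close> is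
  positive is a closed set, compact since \<open>\<Omega>\<close> is bounded, and such sets are null
  by the previous lemma.\<close>

lemma nonpos_of_integral_0:
  fixes h :: "'a::euclidean_space \<Rightarrow> real"
  assumes "open \<Omega>" "bounded \<Omega>" "integrable (lebesgue_on \<Omega>) h"
    and "\<And>f. csupp_in \<Omega> f \<Longrightarrow> (LINT x|lebesgue_on \<Omega>. h x * f x) = 0"
  shows "AE x in lebesgue_on \<Omega>. h x \<le> 0"
proof -
  define A where "A = {x\<in>\<Omega>. 0 < h x}"
  have \<Omega>: "\<Omega> \<in> sets lebesgue" using assms(1) by auto
  have "{x \<in> space (lebesgue_on \<Omega>). 0 < h x} \<in> sets (lebesgue_on \<Omega>)"
    using assms(3) by measurable
  then have A: "A \<in> sets lebesgue"
    using \<Omega> by (simp add: A_def sets_restrict_space_iff space_restrict_space)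
  have le: "emeasure lebesgue A \<le> ennreal e" if e: "0 < e" for e
  proof -
    obtain T where T: "closed T" "T \<subseteq> A" "A - T \<in> lmeasurable" "emeasure lebesgue (A - T) < ennreal e"
      using sets_lebesgue_inner_closed[OF A e] .
    have "compact T"
      using T(1,2) assms(2) bounded_subset[of \<Omega> T] by (auto simp: A_def compact_eq_bounded_closed)
    then have "T \<in> null_sets lebesgue"
      using T(2) by (intro compact_null_of_integral_0[OF assms(1,3,4)]) (auto simp: A_def)
    then have "emeasure lebesgue (A - T) = emeasure lebesgue A"
      by (rule emeasure_Diff_null_set) (rule A)
    then show ?thesis using T(4) by (simp only: less_imp_le)
  qed
  have "emeasure lebesgue A \<le> 0"
    by (rule ennreal_le_epsilon) (simp only: add_0 le)
  then have "A \<in> null_sets lebesgue" using A by (intro null_setsI) (simp_all only: le_zero_eq)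
  then have "AE x in lebesgue. x \<notin> A" by (rule AE_not_in)
  then have "AE x in lebesgue. x \<in> \<Omega> \<longrightarrow> h x \<le> 0"
    by eventually_elim (simp add: A_def not_less)
  moreover have "\<Omega> \<inter> space lebesgue \<in> sets lebesgue" using \<Omega> by simp
  ultimately show ?thesis by (simp only: AE_restrict_space_iff)
qed

lemma integrable_mult_csupp_in:
  assumes "integrable (lebesgue_on \<Omega>) h" "csupp_in \<Omega>' g"
  shows "integrable (lebesgue_on \<Omega>) (\<lambda>x. h x * g x :: real)"
proof -
  obtain M where M: "\<And>x. \<bar>g x\<bar> \<le> M"
    using csupp_bounded[OF csupp_in_csupp[OF assms(2)]] by blast
  show ?thesis
  proof (rule Bochner_Integration.integrable_bound[of _ "\<lambda>x. h x * M"])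
    show "integrable (lebesgue_on \<Omega>) (\<lambda>x. h x * M)" using assms(1) by simp
    show "(\<lambda>x. h x * g x) \<in> borel_measurable (lebesgue_on \<Omega>)"
      using borel_measurable_integrable[OF assms(1)] borel_measurable_lebesgue_on_continuous[of g] assms(2)
      by (auto simp: csupp_in_def intro: borel_measurable_times)
    show "AE x in lebesgue_on \<Omega>. norm (h x * g x) \<le> norm (h x * M)"
    proof (intro AE_I2)
      fix x
      have "\<bar>g x\<bar> \<le> \<bar>M\<bar>" using M[of x] by simp
      then show "norm (h x * g x) \<le> norm (h x * M)"
        by (simp add: abs_mult mult_left_mono)
    qed
  qed
qed

text \<open>Uniform approximation extends the vanishing of the integrals from test functions to all
  continuous functions with compact support in \<open>\<Omega>\<close>; the sign result then applies
  to both \<open>h\<close> and \<open>- h\<close>.\<close>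

lemma fundamental_lemma_calculus_of_variations:
  fixes h :: "'a::euclidean_space \<Rightarrow> real"
  assumes "open \<Omega>" "bounded \<Omega>" "integrable (lebesgue_on \<Omega>) h"
    and "\<And>\<phi>. \<phi> \<in> test_functions \<Omega> \<Longrightarrow> (LINT x|lebesgue_on \<Omega>. h x * \<phi> x) = 0"
  shows "AE x in lebesgue_on \<Omega>. h x = 0"
proof -
  have *: "(LINT x|lebesgue_on \<Omega>. h x * f x) = 0" if f: "csupp_in \<Omega> f" for f
  proof -
    obtain \<Phi> where \<Phi>: "\<forall>k. \<Phi> k \<in> test_functions \<Omega>"
      "\<forall>e>0. \<forall>\<^sub>F k in sequentially. \<forall>x. \<bar>\<Phi> k x - f x\<bar> \<le> e"
      by (rule csupp_in_approx[OF assms(1) f])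
    have int: "integrable (lebesgue_on \<Omega>) (\<lambda>x. h x * g x)" if "csupp_in \<Omega> g" for g
      by (rule integrable_mult_csupp_in[OF assms(3) that])
    have \<Phi>s: "csupp_in \<Omega> (\<Phi> k)" for k using \<Phi>(1) by (simp add: test_functions_iff)
    let ?I = "LINT x|lebesgue_on \<Omega>. \<bar>h x\<bar>"
    have *: "\<bar>LINT x|lebesgue_on \<Omega>. h x * f x\<bar> \<le> e * ?I" if "0 < e" for e
    proof -
      have "\<forall>\<^sub>F k in sequentially. \<forall>x. \<bar>\<Phi> k x - f x\<bar> \<le> e"
        using \<Phi>(2) that by simp
      then obtain k where k: "\<And>x. \<bar>\<Phi> k x - f x\<bar> \<le> e"
        unfolding eventually_sequentially by blast
      have "(LINT x|lebesgue_on \<Omega>. h x * f x) =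
          (LINT x|lebesgue_on \<Omega>. h x * f x) - (LINT x|lebesgue_on \<Omega>. h x * \<Phi> k x)"
        using assms(4)[OF \<Phi>(1)[rule_format]] by simp
      also have "\<dots> = (LINT x|lebesgue_on \<Omega>. h x * f x - h x * \<Phi> k x)"
        by (rule Bochner_Integration.integral_diff[symmetric]) (intro int f \<Phi>s)+
      also have "\<bar>\<dots>\<bar> \<le> (LINT x|lebesgue_on \<Omega>. \<bar>h x * f x - h x * \<Phi> k x\<bar>)"
        by (rule integral_abs_bound)
      also have "\<dots> \<le> (LINT x|lebesgue_on \<Omega>. e * \<bar>h x\<bar>)"
      proof (rule integral_mono)
        show "integrable (lebesgue_on \<Omega>) (\<lambda>x. \<bar>h x * f x - h x * \<Phi> k x\<bar>)"
          by (intro integrable_abs Bochner_Integration.integrable_diff int f \<Phi>s)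
        show "integrable (lebesgue_on \<Omega>) (\<lambda>x. e * \<bar>h x\<bar>)" using assms(3) by simp
        show "\<bar>h x * f x - h x * \<Phi> k x\<bar> \<le> e * \<bar>h x\<bar>" for x
          using mult_right_mono[OF k[of x], of "\<bar>h x\<bar>"]
          unfolding right_diff_distrib[symmetric] abs_mult
          by (simp add: abs_minus_commute mult.commute)
      qed
      finally show ?thesis by simp
    qed
    then have "\<bar>LINT x|lebesgue_on \<Omega>. h x * f x\<bar> \<le> 0 + e" if "0 < e" for e
    proof -
      have I: "0 \<le> ?I" by (intro Bochner_Integration.integral_nonneg) simp
      then have I1: "0 < ?I + 1" by linarith
      have "\<bar>LINT x|lebesgue_on \<Omega>. h x * f x\<bar> \<le> e / (?I + 1) * ?I"
        by (intro * divide_pos_pos \<open>0 < e\<close> I1)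
      also have "\<dots> \<le> e"
        using I1 \<open>0 < e\<close> by (simp add: pos_divide_le_eq)
      finally show ?thesis by simp
    qed
    then have "\<bar>LINT x|lebesgue_on \<Omega>. h x * f x\<bar> \<le> 0" by (rule field_le_epsilon)
    then show ?thesis by simp
  qed
  have "AE x in lebesgue_on \<Omega>. h x \<le> 0"
    by (rule nonpos_of_integral_0[OF assms(1-3) *])
  moreover have "AE x in lebesgue_on \<Omega>. - h x \<le> 0"
    by (rule nonpos_of_integral_0[OF assms(1,2)]) (use assms(3) * in auto)
  ultimately show ?thesis by eventually_elim simp
qed

section \<open>Classical gradients as weak gradients\<close>

definition grad :: "('a::euclidean_space \<Rightarrow> real) \<Rightarrow> 'a \<Rightarrow> 'a" where
  "grad f x = (\<Sum>b\<in>Basis. partial_deriv b f x *\<^sub>R b)"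

lemma grad_inner: "b \<in> Basis \<Longrightarrow> grad f x \<bullet> b = partial_deriv b f x"
  by (simp add: grad_def inner_sum_left inner_Basis if_distrib sum.delta cong: if_cong)

lemma norm_grad: "(norm (grad f x))\<^sup>2 = (\<Sum>b\<in>Basis. (partial_deriv b f x)\<^sup>2)"
  unfolding power2_norm_eq_inner by (subst euclidean_inner) (simp add: grad_inner power2_eq_square)

lemma finite_measure_lebesgue_on:
  assumes "open \<Omega>" "bounded (\<Omega> :: 'a::euclidean_space set)"
  shows "finite_measure (lebesgue_on \<Omega>)"
proof (rule finite_measureI)
  have "\<Omega> \<in> lmeasurable" using assms by (simp add: lmeasurable_open)
  then show "emeasure (lebesgue_on \<Omega>) (space (lebesgue_on \<Omega>)) \<noteq> \<infinity>"
    using fmeasurableD2[of \<Omega> lebesgue]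
    by (subst emeasure_restrict_space) (auto simp: space_restrict_space fmeasurable_def simp del: emeasure_completion)
qed

text \<open>On a set of finite measure \<open>L2\<close> is contained in \<open>L1\<close>; here by
  \<open>norm (g x) \<le> 1 + (norm (g x))^2\<close>.\<close>

lemma L2_on_integrable_inner:
  assumes "open \<Omega>" "bounded \<Omega>" "L2_on \<Omega> (g :: 'a::euclidean_space \<Rightarrow> 'a)"
  shows "integrable (lebesgue_on \<Omega>) (\<lambda>x. g x \<bullet> b)"
proof (rule Bochner_Integration.integrable_bound[of _ "\<lambda>x. norm b * (1 + (norm (g x))\<^sup>2)"])
  interpret finite_measure "lebesgue_on \<Omega>" by (rule finite_measure_lebesgue_on[OF assms(1,2)])
  have g: "g \<in> borel_measurable (lebesgue_on \<Omega>)" "integrable (lebesgue_on \<Omega>) (\<lambda>x. (norm (g x))\<^sup>2)"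
    using assms(3) by (auto simp: L2_on_def)
  show "integrable (lebesgue_on \<Omega>) (\<lambda>x. norm b * (1 + (norm (g x))\<^sup>2))"
    by (intro integrable_mult_right Bochner_Integration.integrable_add integrable_const g(2))
  show "(\<lambda>x. g x \<bullet> b) \<in> borel_measurable (lebesgue_on \<Omega>)" using g(1) by measurable
  show "AE x in lebesgue_on \<Omega>. norm (g x \<bullet> b) \<le> norm (norm b * (1 + (norm (g x))\<^sup>2))"
  proof (intro AE_I2)
    fix x
    have "norm (g x) \<le> 1 + (norm (g x))\<^sup>2"
      using sum_squares_bound[of "norm (g x)" 1] norm_ge_zero[of "g x"] by (simp del: norm_ge_zero)
    then have "norm (g x) * norm b \<le> (1 + (norm (g x))\<^sup>2) * norm b"
      by (rule mult_right_mono) simp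
    then show "norm (g x \<bullet> b) \<le> norm (norm b * (1 + (norm (g x))\<^sup>2))"
      using Cauchy_Schwarz_ineq2[of "g x" b] by (simp add: abs_mult mult.commute)
  qed
qed

text \<open>What makes \<open>weak_gradient\<close>, an arbitrary choice, computable: any gradient
  found by classical means agrees with it almost everywhere.\<close>

lemma is_weak_gradient_unique:
  fixes \<Omega> :: "'a::euclidean_space set"
  assumes "open \<Omega>" "bounded \<Omega>" "is_weak_gradient \<Omega> u g" "is_weak_gradient \<Omega> u g'"
  shows "AE x in lebesgue_on \<Omega>. g x = g' x"
proof -
  have "AE x in lebesgue_on \<Omega>. g x \<bullet> b - g' x \<bullet> b = 0" if b: "b \<in> Basis" for b
  proof (rule fundamental_lemma_calculus_of_variations[OF assms(1,2)])
    have int: "integrable (lebesgue_on \<Omega>) (\<lambda>x. g x \<bullet> b)" "integrable (lebesgue_on \<Omega>) (\<lambda>x. g' x \<bullet> b)"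
      using assms by (auto intro!: L2_on_integrable_inner simp: is_weak_gradient_def)
    then show "integrable (lebesgue_on \<Omega>) (\<lambda>x. g x \<bullet> b - g' x \<bullet> b)" by simp
    fix \<phi> assume \<phi>: "\<phi> \<in> test_functions \<Omega>"
    then have cs: "csupp_in \<Omega> \<phi>" by (simp add: test_functions_iff)
    note int\<phi> = integrable_mult_csupp_in[OF _ cs]
    have "(LINT x|lebesgue_on \<Omega>. (g x \<bullet> b) * \<phi> x) = (LINT x|lebesgue_on \<Omega>. (g' x \<bullet> b) * \<phi> x)"
      using assms(3)[unfolded is_weak_gradient_def, THEN conjunct2, rule_format, OF \<phi> b]
        assms(4)[unfolded is_weak_gradient_def, THEN conjunct2, rule_format, OF \<phi> b] by linarith
    moreover have "(LINT x|lebesgue_on \<Omega>. (g x \<bullet> b) * \<phi> x - (g' x \<bullet> b) * \<phi> x) =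
        (LINT x|lebesgue_on \<Omega>. (g x \<bullet> b) * \<phi> x) - (LINT x|lebesgue_on \<Omega>. (g' x \<bullet> b) * \<phi> x)"
      by (rule Bochner_Integration.integral_diff[OF int\<phi>[OF int(1)] int\<phi>[OF int(2)]])
    ultimately show "(LINT x|lebesgue_on \<Omega>. (g x \<bullet> b - g' x \<bullet> b) * \<phi> x) = 0"
      unfolding left_diff_distrib by simp
  qed
  then have "AE x in lebesgue_on \<Omega>. \<forall>b\<in>Basis. g x \<bullet> b - g' x \<bullet> b = 0"
    by (intro AE_finite_allI) auto
  then show ?thesis
    by eventually_elim (auto intro: euclidean_eqI)
qed

lemma csupp_in_power2: "csupp_in \<Omega> f \<Longrightarrow> csupp_in \<Omega> (\<lambda>x. (f x)\<^sup>2)"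
  by (rule csupp_in_subset[of \<Omega> f]) (auto simp: csupp_in_def intro: continuous_intros)

lemma csupp_in_add:
  assumes "csupp_in \<Omega> f" "csupp_in \<Omega> g"
  shows "csupp_in \<Omega> (\<lambda>x. f x + g x)"
proof -
  obtain K where K: "compact K" "K \<subseteq> \<Omega>" "\<forall>x. x \<notin> K \<longrightarrow> f x = 0"
    using assms(1) unfolding csupp_in_def by blast
  obtain L where L: "compact L" "L \<subseteq> \<Omega>" "\<forall>x. x \<notin> L \<longrightarrow> g x = 0"
    using assms(2) unfolding csupp_in_def by blast
  have "compact (K \<union> L)" "K \<union> L \<subseteq> \<Omega>" "\<forall>x. x \<notin> K \<union> L \<longrightarrow> f x + g x = 0"
    using K L by (simp_all add: compact_Un)
  moreover have "continuous_on UNIV (\<lambda>x. f x + g x)"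
    using assms by (intro continuous_on_add) (simp_all add: csupp_in_def)
  ultimately show ?thesis unfolding csupp_in_def by blast
qed

lemma csupp_in_sum:
  "(\<And>i. i \<in> I \<Longrightarrow> csupp_in \<Omega> (f i)) \<Longrightarrow> csupp_in \<Omega> (\<lambda>x. \<Sum>i\<in>I. f i x)"
  by (induction I rule: infinite_finite_induct) (auto simp: csupp_in_add, auto simp: csupp_in_def)

lemma csupp_in_norm_grad:
  assumes "csupp_in \<Omega> f" "Ck_on 1 f UNIV"
  shows "csupp_in \<Omega> (\<lambda>x. (norm (grad f x))\<^sup>2)"
  unfolding norm_grad using assms csupp_in_partial_deriv[of 0 f \<Omega>]
  by (intro csupp_in_sum csupp_in_power2) auto

lemma L2_on_csupp_in:
  assumes "open \<Omega>" "csupp_in \<Omega> f"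
  shows "L2_on \<Omega> f"
  using integrable_lebesgue_on_csupp_in[OF assms(1) csupp_in_power2[OF assms(2)]]
    borel_measurable_lebesgue_on_continuous[of f \<Omega>] assms(2)
  by (simp add: L2_on_def csupp_in_def)

lemma is_weak_gradient_grad:
  assumes "open \<Omega>" "csupp_in \<Omega> f" "Ck_on 1 f UNIV"
  shows "is_weak_gradient \<Omega> f (grad f)"
  unfolding is_weak_gradient_def
proof (intro conjI ballI)
  have "continuous_on UNIV (partial_deriv b f)" if "b \<in> Basis" for b
    using assms(3) that by simp
  then have "grad f \<in> borel_measurable (lebesgue_on \<Omega>)"
    unfolding grad_def by (intro borel_measurable_sum borel_measurable_scaleR
        borel_measurable_lebesgue_on_continuous borel_measurable_const)
  then show "L2_on \<Omega> (grad f)"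
    using integrable_lebesgue_on_csupp_in[OF assms(1) csupp_in_norm_grad[OF assms(2,3)]]
    by (simp add: L2_on_def)
  fix \<phi> b assume \<phi>: "\<phi> \<in> test_functions \<Omega>" and b: "(b :: 'a) \<in> Basis"
  have \<phi>1: "Ck_on 1 \<phi> UNIV" "csupp_in \<Omega> \<phi>" using \<phi> by (auto simp: test_functions_iff)
  have c: "continuous_on UNIV (partial_deriv b \<phi>)" "continuous_on UNIV (partial_deriv b f)"
    "continuous_on UNIV f" "continuous_on UNIV \<phi>"
    using \<phi>1 assms(2,3) b by (auto simp: csupp_in_def)
  have "(LINT x|lebesgue_on \<Omega>. f x * partial_deriv b \<phi> x) = (LINT x|lborel. f x * partial_deriv b \<phi> x)"
    by (intro integral_lebesgue_on_csupp_in assms csupp_in_subset[OF assms(2)] continuous_intros c) simp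
  also have "\<dots> = - (LINT x|lborel. partial_deriv b f x * \<phi> x)"
    by (rule integral_by_parts_csupp[OF assms(3) \<phi>1(1) csupp_in_csupp[OF assms(2)] b])
  also have "(LINT x|lborel. partial_deriv b f x * \<phi> x) = (LINT x|lebesgue_on \<Omega>. partial_deriv b f x * \<phi> x)"
    by (intro integral_lebesgue_on_csupp_in[symmetric] assms csupp_in_subset[OF \<phi>1(2)] continuous_intros c) simp
  finally show "(LINT x|lebesgue_on \<Omega>. f x * partial_deriv b \<phi> x) =
      - (LINT x|lebesgue_on \<Omega>. (grad f x \<bullet> b) * \<phi> x)"
    by (simp add: grad_inner[OF b])
qed

lemma
  assumes "open \<Omega>" "bounded \<Omega>" "csupp_in \<Omega> f" "Ck_on 1 f UNIV"
  shows csupp_in_W12: "f \<in> W12 \<Omega>"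
    and weak_gradient_eq_grad: "AE x in lebesgue_on \<Omega>. weak_gradient \<Omega> f x = grad f x"
proof -
  have w: "is_weak_gradient \<Omega> f (grad f)"
    by (rule is_weak_gradient_grad[OF assms(1,3,4)])
  then show "f \<in> W12 \<Omega>"
    using L2_on_csupp_in[OF assms(1,3)] by (auto simp: W12_def)
  have "is_weak_gradient \<Omega> f (weak_gradient \<Omega> f)"
    unfolding weak_gradient_def by (rule someI[of "is_weak_gradient \<Omega> f" "grad f"]) (rule w)
  then show "AE x in lebesgue_on \<Omega>. weak_gradient \<Omega> f x = grad f x"
    using is_weak_gradient_unique[OF assms(1,2)] w by blast
qed

section \<open>Test functions for the eigenvalue\<close>

lemma csupp_in_diff:
  assumes "csupp_in \<Omega> f" "csupp_in \<Omega> g"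
  shows "csupp_in \<Omega> (\<lambda>x. f x - g x)"
proof -
  have "csupp_in \<Omega> (\<lambda>x. - g x)"
    using assms(2) by (intro csupp_in_subset[OF assms(2)] continuous_on_minus) (simp_all add: csupp_in_def)
  from csupp_in_add[OF assms(1) this] show ?thesis by simp
qed

text \<open>\<open>V\<close> is arbitrary outside \<open>\<Omega>\<close> and may blow up at the
  boundary. The product is nevertheless continuous everywhere, since it vanishes on the open
  complement of a compact subset of \<open>\<Omega>\<close>.\<close>

lemma csupp_in_mult_continuous_on:
  assumes "open \<Omega>" "continuous_on \<Omega> V" "csupp_in \<Omega> f"
  shows "csupp_in \<Omega> (\<lambda>x. V x * f x)"
proof -
  obtain K where K: "compact K" "K \<subseteq> \<Omega>" "\<forall>x. x \<notin> K \<longrightarrow> f x = 0"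
    using assms(3) unfolding csupp_in_def by blast
  have f: "continuous_on UNIV f" using assms(3) by (simp add: csupp_in_def)
  have "continuous_on \<Omega> (\<lambda>x. V x * f x)"
    by (intro continuous_on_mult assms(2) continuous_on_subset[OF f]) simp
  moreover have "continuous_on (- K) (\<lambda>x. V x * f x)"
    by (rule continuous_on_eq[of _ "\<lambda>x. 0"]) (use K(3) in simp_all)
  ultimately have "continuous_on (\<Omega> \<union> - K) (\<lambda>x. V x * f x)"
    using K(1) by (intro continuous_on_open_Un assms(1)) (simp_all add: compact_imp_closed open_Compl)
  moreover have "\<Omega> \<union> - K = UNIV" using K(2) by blast
  ultimately have "continuous_on UNIV (\<lambda>x. V x * f x)" by simp
  moreover have "\<forall>x. x \<notin> K \<longrightarrow> V x * f x = 0" using K(3) by simp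
  ultimately show ?thesis
    using K(1,2) unfolding csupp_in_def by blast
qed

text \<open>Because \<open>\<Omega>\<close> has finite measure, uniform approximation of a function
  and its partial derivatives is approximation in the Sobolev norm. This is how \<open>W12_0\<close>
  is reached.\<close>

lemma W12_norm_le:
  assumes "open \<Omega>" "bounded \<Omega>" "csupp_in \<Omega> (f :: 'a::euclidean_space \<Rightarrow> real)" "Ck_on 1 f UNIV"
    and "0 \<le> e" "\<And>x. \<bar>f x\<bar> \<le> e" "\<And>b x. b \<in> Basis \<Longrightarrow> \<bar>partial_deriv b f x\<bar> \<le> e"
  shows "W12_norm \<Omega> f \<le> sqrt (measure (lebesgue_on \<Omega>) (space (lebesgue_on \<Omega>)) * (1 + DIM('a))) * e"
proof -
  interpret finite_measure "lebesgue_on \<Omega>" by (rule finite_measure_lebesgue_on[OF assms(1,2)])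
  let ?h = "\<lambda>x. (f x)\<^sup>2 + (norm (grad f x))\<^sup>2"
  have h: "csupp_in \<Omega> ?h"
    by (intro csupp_in_add csupp_in_power2 csupp_in_norm_grad assms)
  have sq: "y\<^sup>2 \<le> e\<^sup>2" if "\<bar>y\<bar> \<le> e" for y
    using power_mono[OF that, of 2] by simp
  have "(norm (grad f x))\<^sup>2 \<le> (\<Sum>b\<in>(Basis :: 'a set). e\<^sup>2)" for x
    unfolding norm_grad by (intro sum_mono sq assms(7))
  then have bound: "?h x \<le> (1 + DIM('a)) * e\<^sup>2" for x
    using sq[OF assms(6)[of x]] by (simp add: distrib_right add_mono)
  have "AE x in lebesgue_on \<Omega>. (f x)\<^sup>2 + (norm (weak_gradient \<Omega> f x))\<^sup>2 \<le> (1 + DIM('a)) * e\<^sup>2"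
    using weak_gradient_eq_grad[OF assms(1-4)] by eventually_elim (use bound in simp)
  moreover have "integrable (lebesgue_on \<Omega>) (\<lambda>x. (f x)\<^sup>2 + (norm (weak_gradient \<Omega> f x))\<^sup>2)"
  proof -
    have "is_weak_gradient \<Omega> f (weak_gradient \<Omega> f)"
      unfolding weak_gradient_def
      by (rule someI[of "is_weak_gradient \<Omega> f" "grad f"]) (rule is_weak_gradient_grad[OF assms(1,3,4)])
    then have "integrable (lebesgue_on \<Omega>) (\<lambda>x. (norm (weak_gradient \<Omega> f x))\<^sup>2)"
      by (simp add: is_weak_gradient_def L2_on_def)
    then show ?thesis
      using integrable_lebesgue_on_csupp_in[OF assms(1) csupp_in_power2[OF assms(3)]]
      by (intro Bochner_Integration.integrable_add)
  qed
  ultimately have "(LINT x|lebesgue_on \<Omega>. (f x)\<^sup>2 + (norm (weak_gradient \<Omega> f x))\<^sup>2) \<le>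
      (LINT x|lebesgue_on \<Omega>. (1 + DIM('a)) * e\<^sup>2)"
    by (intro integral_mono_AE integrable_const)
  also have "\<dots> = measure (lebesgue_on \<Omega>) (space (lebesgue_on \<Omega>)) * (1 + DIM('a)) * e\<^sup>2"
    by simp
  finally have "W12_norm \<Omega> f \<le> sqrt (measure (lebesgue_on \<Omega>) (space (lebesgue_on \<Omega>)) * (1 + DIM('a)) * e\<^sup>2)"
    unfolding W12_norm_def by (rule real_sqrt_le_mono)
  then show ?thesis using assms(5) by (simp add: real_sqrt_mult)
qed

lemma W12_norm_nonneg: "0 \<le> W12_norm \<Omega> f"
  unfolding W12_norm_def by (intro real_sqrt_ge_zero Bochner_Integration.integral_nonneg) simp

lemma csupp_in_W12_0:
  fixes f :: "'a::euclidean_space \<Rightarrow> real"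
  assumes "open \<Omega>" "bounded \<Omega>" "csupp_in \<Omega> f" "Ck_on 1 f UNIV"
  shows "f \<in> W12_0 \<Omega>"
proof -
  obtain \<Phi> where \<Phi>: "\<forall>k. \<Phi> k \<in> test_functions \<Omega>"
    "\<forall>e>0. \<forall>\<^sub>F k in sequentially. \<forall>x. \<bar>\<Phi> k x - f x\<bar> \<le> e"
    "Ck_on 1 f UNIV \<longrightarrow> (\<forall>b\<in>Basis. \<forall>e>0. \<forall>\<^sub>F k in sequentially.
      \<forall>x. \<bar>partial_deriv b (\<Phi> k) x - partial_deriv b f x\<bar> \<le> e)"
    by (rule csupp_in_approx[OF assms(1,3)])
  define C where "C = sqrt (measure (lebesgue_on \<Omega>) (space (lebesgue_on \<Omega>)) * (1 + DIM('a)))"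
  have C: "0 \<le> C" by (simp add: C_def)
  have "(\<lambda>k. W12_norm \<Omega> (\<lambda>x. \<Phi> k x - f x)) \<longlonglongrightarrow> 0"
    unfolding tendsto_iff
  proof (intro allI impI)
    fix r :: real assume r: "0 < r"
    define e where "e = r / (C + 1)"
    have e: "0 < e" using r C by (simp add: e_def)
    have "\<forall>\<^sub>F k in sequentially. \<forall>x. \<bar>\<Phi> k x - f x\<bar> \<le> e"
      using \<Phi>(2) e by simp
    moreover have "\<forall>\<^sub>F k in sequentially. \<forall>b\<in>Basis. \<forall>x. \<bar>partial_deriv b (\<Phi> k) x - partial_deriv b f x\<bar> \<le> e"
      using \<Phi>(3) assms(4) e by (intro eventually_ball_finite) simp_all
    ultimately show "\<forall>\<^sub>F k in sequentially. dist (W12_norm \<Omega> (\<lambda>x. \<Phi> k x - f x)) 0 < r"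
    proof eventually_elim
      case (elim k)
      have \<Phi>k: "Ck_on 1 (\<Phi> k) UNIV" "csupp_in \<Omega> (\<Phi> k)"
        using \<Phi>(1) by (simp_all only: test_functions_iff)
      have "partial_deriv b (\<lambda>x. \<Phi> k x - f x) x = partial_deriv b (\<Phi> k) x - partial_deriv b f x" for b x
        using \<Phi>k(1) assms(4) by (intro partial_deriv_diff) simp_all
      then have "W12_norm \<Omega> (\<lambda>x. \<Phi> k x - f x) \<le> C * e"
        unfolding C_def using elim e
        by (intro W12_norm_le assms(1,2) csupp_in_diff \<Phi>k assms(3) Ck_on_diff open_UNIV assms(4)) simp_all
      also have "C * e < r"
        using r C by (simp add: e_def field_simps)
      finally show ?case using W12_norm_nonneg[of \<Omega> "\<lambda>x. \<Phi> k x - f x"] by (simp add: dist_real_def)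
    qed
  qed
  then show ?thesis
    using \<Phi>(1) csupp_in_W12[OF assms] unfolding W12_0_def by blast
qed

text \<open>An infimum of reals lies below the members of its set only if the set is bounded below,
  and this provides the bound. The minimum with 0 covers a vanishing denominator, where the quotient
  is 0 by convention.\<close>

lemma rayleigh_quotient_ge:
  assumes "open \<Omega>" "u \<in> W12 \<Omega>" "integrable (lebesgue_on \<Omega>) (\<lambda>x. V x * (u x)\<^sup>2)"
    and "\<And>x. x \<in> \<Omega> \<Longrightarrow> c \<le> V x"
  shows "min c 0 \<le> rayleigh_quotient V \<Omega> u"
proof -
  let ?N = "LINT x|lebesgue_on \<Omega>. (norm (weak_gradient \<Omega> u x))\<^sup>2 + V x * (u x)\<^sup>2"
  let ?D = "LINT x|lebesgue_on \<Omega>. (u x)\<^sup>2"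
  have u: "integrable (lebesgue_on \<Omega>) (\<lambda>x. (u x)\<^sup>2)"
    using assms(2) by (simp add: W12_def L2_on_def)
  have "\<exists>g. is_weak_gradient \<Omega> u g" using assms(2) by (simp add: W12_def)
  then have "is_weak_gradient \<Omega> u (weak_gradient \<Omega> u)"
    unfolding weak_gradient_def by (rule someI_ex)
  then have w: "integrable (lebesgue_on \<Omega>) (\<lambda>x. (norm (weak_gradient \<Omega> u x))\<^sup>2)"
    by (simp add: is_weak_gradient_def L2_on_def)
  have "(LINT x|lebesgue_on \<Omega>. c * (u x)\<^sup>2) \<le> ?N"
  proof (rule integral_mono)
    show "integrable (lebesgue_on \<Omega>) (\<lambda>x. c * (u x)\<^sup>2)" using u by simp
    show "integrable (lebesgue_on \<Omega>) (\<lambda>x. (norm (weak_gradient \<Omega> u x))\<^sup>2 + V x * (u x)\<^sup>2)"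
      by (intro Bochner_Integration.integrable_add w assms(3))
    fix x assume "x \<in> space (lebesgue_on \<Omega>)"
    then have "c * (u x)\<^sup>2 \<le> V x * (u x)\<^sup>2"
      using assms(4) by (intro mult_right_mono) (auto simp: space_restrict_space)
    then show "c * (u x)\<^sup>2 \<le> (norm (weak_gradient \<Omega> u x))\<^sup>2 + V x * (u x)\<^sup>2"
      using zero_le_power2[of "norm (weak_gradient \<Omega> u x)"] by linarith
  qed
  then have N: "c * ?D \<le> ?N" by simp
  have D: "0 \<le> ?D" by (intro Bochner_Integration.integral_nonneg) simp
  show ?thesis
  proof (cases "?D = 0")
    case True
    then show ?thesis by (simp add: rayleigh_quotient_def)
  next
    case False
    then have "0 < ?D" using D by linarith
    then have "c \<le> rayleigh_quotient V \<Omega> u"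
      using N unfolding rayleigh_quotient_def by (subst pos_le_divide_eq)
    then show ?thesis by simp
  qed
qed

text \<open>The only bridge from the Sobolev definition of the eigenvalue to classical calculus:
  weak gradients are replaced by partial derivatives and \<open>lebesgue_on\<close> by
  \<open>lborel\<close>.\<close>

lemma dirichlet_eigenvalue_le:
  fixes f :: "'a::euclidean_space \<Rightarrow> real"
  assumes "open \<Omega>" "bounded \<Omega>" "csupp_in \<Omega> f" "Ck_on 1 f UNIV"
    and "continuous_on \<Omega> V" "\<And>x. x \<in> \<Omega> \<Longrightarrow> c \<le> V x"
    and pos: "0 < (LINT x|lborel. (f x)\<^sup>2)"
  shows "dirichlet_eigenvalue V \<Omega> * (LINT x|lborel. (f x)\<^sup>2)
    \<le> (LINT x|lborel. (\<Sum>b\<in>Basis. (partial_deriv b f x)\<^sup>2) + V x * (f x)\<^sup>2)"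
proof -
  have f2: "(LINT x|lebesgue_on \<Omega>. (f x)\<^sup>2) = (LINT x|lborel. (f x)\<^sup>2)"
    by (intro integral_lebesgue_on_csupp_in assms csupp_in_power2)
  have Vf: "csupp_in \<Omega> (\<lambda>x. V x * (f x)\<^sup>2)"
    by (intro csupp_in_mult_continuous_on assms csupp_in_power2)
  have "(LINT x|lebesgue_on \<Omega>. (norm (weak_gradient \<Omega> f x))\<^sup>2 + V x * (f x)\<^sup>2) =
      (LINT x|lebesgue_on \<Omega>. (norm (grad f x))\<^sup>2 + V x * (f x)\<^sup>2)"
  proof (rule integral_cong_AE)
    show "AE x in lebesgue_on \<Omega>. (norm (weak_gradient \<Omega> f x))\<^sup>2 + V x * (f x)\<^sup>2 =
        (norm (grad f x))\<^sup>2 + V x * (f x)\<^sup>2"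
      using weak_gradient_eq_grad[OF assms(1-4)] by eventually_elim simp
    have "is_weak_gradient \<Omega> f (weak_gradient \<Omega> f)"
      unfolding weak_gradient_def
      by (rule someI[of "is_weak_gradient \<Omega> f" "grad f"]) (rule is_weak_gradient_grad[OF assms(1,3,4)])
    then show "(\<lambda>x. (norm (weak_gradient \<Omega> f x))\<^sup>2 + V x * (f x)\<^sup>2) \<in> borel_measurable (lebesgue_on \<Omega>)"
      using borel_measurable_integrable[OF integrable_lebesgue_on_csupp_in[OF assms(1) Vf]]
      by (intro borel_measurable_add) (simp_all add: is_weak_gradient_def L2_on_def borel_measurable_integrable)
    show "(\<lambda>x. (norm (grad f x))\<^sup>2 + V x * (f x)\<^sup>2) \<in> borel_measurable (lebesgue_on \<Omega>)"
      by (intro borel_measurable_integrable integrable_lebesgue_on_csupp_in assms csupp_in_add Vf csupp_in_norm_grad)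
  qed
  also have "\<dots> = (LINT x|lborel. (norm (grad f x))\<^sup>2 + V x * (f x)\<^sup>2)"
    by (intro integral_lebesgue_on_csupp_in assms csupp_in_add Vf csupp_in_norm_grad)
  finally have R: "rayleigh_quotient V \<Omega> f =
      (LINT x|lborel. (norm (grad f x))\<^sup>2 + V x * (f x)\<^sup>2) / (LINT x|lborel. (f x)\<^sup>2)"
    by (simp add: rayleigh_quotient_def f2)
  have "\<not> (AE x in lebesgue_on \<Omega>. f x = 0)"
  proof
    assume "AE x in lebesgue_on \<Omega>. f x = 0"
    then have "AE x in lebesgue_on \<Omega>. (f x)\<^sup>2 = 0" by eventually_elim simp
    then have "(LINT x|lebesgue_on \<Omega>. (f x)\<^sup>2) = 0" by (rule integral_eq_zero_AE)
    then show False using pos f2 by simp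
  qed
  then have mem: "rayleigh_quotient V \<Omega> f \<in> {rayleigh_quotient V \<Omega> u | u.
     u \<in> W12_0 \<Omega> \<and> \<not> (AE x in lebesgue_on \<Omega>. u x = 0) \<and>
     integrable (lebesgue_on \<Omega>) (\<lambda>x. V x * (u x)\<^sup>2)}" (is "_ \<in> ?S")
    using csupp_in_W12_0[OF assms(1-4)] integrable_lebesgue_on_csupp_in[OF assms(1) Vf] by blast
  have "bdd_below ?S"
  proof (rule bdd_belowI[of _ "min c 0"])
    fix r assume "r \<in> ?S"
    then obtain u where "r = rayleigh_quotient V \<Omega> u" "u \<in> W12_0 \<Omega>"
      "integrable (lebesgue_on \<Omega>) (\<lambda>x. V x * (u x)\<^sup>2)" by blast
    moreover from this have "u \<in> W12 \<Omega>" by (simp add: W12_0_def)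
    ultimately show "min c 0 \<le> r" using rayleigh_quotient_ge[OF assms(1)] assms(6) by blast
  qed
  then have "dirichlet_eigenvalue V \<Omega> \<le> rayleigh_quotient V \<Omega> f"
    unfolding dirichlet_eigenvalue_def by (rule cInf_lower[OF mem])
  then show ?thesis
    using pos by (simp add: R pos_le_divide_eq norm_grad)
qed

section \<open>Truncated eigenfunctions\<close>

lemma DERIV_max_powr:
  assumes "1 < q"
  shows "((\<lambda>s. max 0 (s - \<epsilon>) powr q) has_real_derivative q * max 0 (s - \<epsilon>) powr (q - 1)) (at s)"
proof -
  consider "s < \<epsilon>" | "\<epsilon> < s" | "s = \<epsilon>" by linarith
  then show ?thesis
  proof cases
    case 1
    have "((\<lambda>s. 0) has_real_derivative 0) (at s)" by simp
    then have "((\<lambda>s. max 0 (s - \<epsilon>) powr q) has_real_derivative 0) (at s)"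
      by (rule has_field_derivative_transform_within_open[of _ _ _ "{..<\<epsilon>}"]) (use 1 in auto)
    then show ?thesis using 1 by simp
  next
    case 2
    have "((\<lambda>s. (s - \<epsilon>) powr q) has_real_derivative q * (s - \<epsilon>) powr (q - 1)) (at s)"
      using 2 by (auto intro!: derivative_eq_intros)
    then have "((\<lambda>s. max 0 (s - \<epsilon>) powr q) has_real_derivative q * (s - \<epsilon>) powr (q - 1)) (at s)"
      by (rule has_field_derivative_transform_within_open[of _ _ _ "{\<epsilon><..}"]) (use 2 in auto)
    then show ?thesis using 2 by simp
  next
    case 3
    \<comment> \<open>At the kink the difference quotient is at most
      \<open>\<bar>h\<bar> powr (q - 1)\<close> in absolute value, which tends to 0 as
      \<open>q\<close> exceeds 1.\<close>
    have "((\<lambda>h. \<bar>h\<bar> powr (q - 1)) \<longlongrightarrow> \<bar>0\<bar> powr (q - 1)) (at (0::real))"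
      using assms by (intro tendsto_powr' tendsto_intros) auto
    then have lim: "((\<lambda>h. \<bar>h\<bar> powr (q - 1)) \<longlongrightarrow> 0) (at (0::real))" by simp
    have "((\<lambda>h. (max 0 (\<epsilon> + h - \<epsilon>) powr q - max 0 (\<epsilon> - \<epsilon>) powr q) / h) \<longlongrightarrow> 0) (at 0)"
    proof (rule Lim_null_comparison[OF _ lim])
      have "norm ((max 0 (\<epsilon> + h - \<epsilon>) powr q - max 0 (\<epsilon> - \<epsilon>) powr q) / h) \<le> \<bar>h\<bar> powr (q - 1)" for h
      proof (cases "h > 0")
        case True
        then show ?thesis by (simp add: powr_diff)
      qed simp
      then show "\<forall>\<^sub>F h in at 0. norm ((max 0 (\<epsilon> + h - \<epsilon>) powr q - max 0 (\<epsilon> - \<epsilon>) powr q) / h)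
          \<le> \<bar>h\<bar> powr (q - 1)" by simp
    qed
    then show ?thesis using 3 by (simp add: DERIV_def)
  qed
qed

text \<open>The function \<open>(u - \<epsilon>)\<close> cut off at 0. Outside
  \<open>\<Omega>\<close> it is set to 0 explicitly, since an eigenfunction is not prescribed
  there.\<close>

definition trunc :: "'a set \<Rightarrow> ('a \<Rightarrow> real) \<Rightarrow> real \<Rightarrow> 'a \<Rightarrow> real" where
  "trunc \<Omega> u \<epsilon> x = (if x \<in> \<Omega> then max 0 (u x - \<epsilon>) else 0)"

lemma trunc_nonneg: "0 \<le> trunc \<Omega> u \<epsilon> x"
  by (simp add: trunc_def)

text \<open>The place where the Dirichlet condition enters: the points of the closure with
  \<open>u \<ge> \<epsilon>\<close> form a compact set, and it avoids the frontier because
  \<open>u\<close> is 0 there.\<close>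

lemma trunc_support:
  fixes \<Omega> :: "'a::euclidean_space set"
  assumes "open \<Omega>" "bounded \<Omega>" "continuous_on (closure \<Omega>) u" "\<And>x. x \<in> frontier \<Omega> \<Longrightarrow> u x = 0" "0 < \<epsilon>"
  obtains K where "compact K" "K \<subseteq> \<Omega>" "\<forall>x. x \<notin> K \<longrightarrow> trunc \<Omega> u \<epsilon> x = 0"
proof (rule that[of "{x \<in> closure \<Omega>. \<epsilon> \<le> u x}"])
  have "closed {x \<in> closure \<Omega>. \<epsilon> \<le> u x}"
    by (rule continuous_on_closed_Collect_le[OF continuous_on_const assms(3) closed_closure])
  moreover have "bounded {x \<in> closure \<Omega>. \<epsilon> \<le> u x}"
    by (rule bounded_subset[OF bounded_closure[OF assms(2)]]) blast
  ultimately show "compact {x \<in> closure \<Omega>. \<epsilon> \<le> u x}" by (simp add: compact_eq_bounded_closed)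
  show "{x \<in> closure \<Omega>. \<epsilon> \<le> u x} \<subseteq> \<Omega>"
    using assms(1,4,5) by (force simp: frontier_def interior_open)
  show "\<forall>x. x \<notin> {x \<in> closure \<Omega>. \<epsilon> \<le> u x} \<longrightarrow> trunc \<Omega> u \<epsilon> x = 0"
    using closure_subset[of \<Omega>] by (auto simp: trunc_def)
qed

text \<open>An exponent above 2 makes the power twice continuously differentiable across the level
  \<open>u = \<epsilon>\<close>. The derivative formulas hold on the whole space: off
  \<open>\<Omega>\<close> the arbitrary derivatives of \<open>u\<close> are multiplied by
  \<open>0 powr\<close> something, which is 0.\<close>

lemma
  fixes \<Omega> :: "'a::euclidean_space set"
  assumes \<Omega>: "open \<Omega>" "bounded \<Omega>" "continuous_on (closure \<Omega>) u" "\<And>x. x \<in> frontier \<Omega> \<Longrightarrow> u x = 0"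
    and "0 < \<epsilon>" "Ck_on 2 u \<Omega>" "2 < q"
  shows csupp_in_trunc: "csupp_in \<Omega> (trunc \<Omega> u \<epsilon>)"
    and Ck_on_trunc_powr: "Ck_on 2 (\<lambda>x. trunc \<Omega> u \<epsilon> x powr q) UNIV"
    and partial_deriv_trunc_powr: "b \<in> Basis \<Longrightarrow> partial_deriv b (\<lambda>x. trunc \<Omega> u \<epsilon> x powr q) x =
      q * trunc \<Omega> u \<epsilon> x powr (q - 1) * partial_deriv b u x"
    and partial_deriv2_trunc_powr: "b \<in> Basis \<Longrightarrow>
      partial_deriv b (partial_deriv b (\<lambda>x. trunc \<Omega> u \<epsilon> x powr q)) x =
      q * (q - 1) * trunc \<Omega> u \<epsilon> x powr (q - 2) * (partial_deriv b u x)\<^sup>2 +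
      q * trunc \<Omega> u \<epsilon> x powr (q - 1) * partial_deriv b (partial_deriv b u) x"
proof -
  let ?U = "trunc \<Omega> u \<epsilon>"
  obtain K where K: "compact K" "K \<subseteq> \<Omega>" "\<forall>x. x \<notin> K \<longrightarrow> ?U x = 0"
    by (rule trunc_support[OF \<Omega> assms(5)])
  have opK: "open (- K)" using K(1) by (simp add: compact_imp_closed open_Compl)
  have un: "\<Omega> \<union> - K = UNIV" using K(2) by blast
  have u: "continuous_on \<Omega> u" by (rule continuous_on_subset[OF assms(3) closure_subset])
  have "continuous_on \<Omega> (\<lambda>x. max 0 (u x - \<epsilon>))" by (intro continuous_intros u)
  then have "continuous_on \<Omega> ?U"
    by (rule continuous_on_eq) (simp add: trunc_def)
  moreover have "continuous_on (- K) ?U"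
    by (rule continuous_on_eq[of _ "\<lambda>x. 0"]) (simp_all add: K(3))
  ultimately have "continuous_on (\<Omega> \<union> - K) ?U"
    by (intro continuous_on_open_Un \<Omega>(1) opK)
  then have "continuous_on UNIV ?U" by (simp only: un)
  then show "csupp_in \<Omega> ?U" using K unfolding csupp_in_def by blast
  define \<psi> where "\<psi> j s = (if j = 0 then max 0 (s - \<epsilon>) powr q
    else if j = 1 then q * max 0 (s - \<epsilon>) powr (q - 1)
    else q * ((q - 1) * max 0 (s - \<epsilon>) powr (q - 2)))" for j :: nat and s
  have \<psi>1: "(\<psi> 0 has_real_derivative \<psi> 1 s) (at s)" for s
    using DERIV_max_powr[of q \<epsilon> s] assms(7) by (simp add: \<psi>_def[abs_def])
  have \<psi>2: "(\<psi> 1 has_real_derivative \<psi> 2 s) (at s)" for s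
    using DERIV_cmult[OF DERIV_max_powr[of "q - 1" \<epsilon> s], of q] assms(7) by (simp add: \<psi>_def[abs_def])
  let ?f = "\<lambda>x. ?U x powr q"
  have f\<Omega>: "?f x = \<psi> 0 (u x)" if "x \<in> \<Omega>" for x
    using that by (simp add: \<psi>_def trunc_def)
  have f0: "?f x = 0" if "x \<in> - K" for x
    using that by (simp add: K(3))
  have "continuous_on UNIV (\<psi> 2)"
    unfolding \<psi>_def using assms(7) by (auto intro!: continuous_intros continuous_on_powr')
  moreover have "(\<psi> j has_real_derivative \<psi> (Suc j) s) (at s)" if "j < 2" for j s
  proof -
    have "j = 0 \<or> j = 1" using that by linarith
    then show ?thesis using \<psi>1[of s] \<psi>2[of s] by (auto simp: numeral_2_eq_2)
  qed
  ultimately have "Ck_on 2 (\<lambda>x. \<psi> 0 (u x)) \<Omega>"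
    by (intro Ck_on_compose[where S = UNIV, OF \<Omega>(1) _ _ assms(6)]) (simp_all add: numeral_2_eq_2)
  then have "Ck_on 2 ?f \<Omega>"
    using Ck_on_cong[OF \<Omega>(1), of ?f "\<lambda>x. \<psi> 0 (u x)" 2] f\<Omega> by blast
  moreover have "Ck_on 2 ?f (- K)"
    using Ck_on_cong[OF opK, of ?f "\<lambda>x. 0" 2] f0 Ck_on_const by blast
  ultimately have "Ck_on 2 ?f (\<Omega> \<union> - K)" by (intro Ck_on_Un \<Omega>(1) opK)
  then show "Ck_on 2 ?f UNIV" by (simp only: un)
  have ud: "u differentiable (at x)" if "x \<in> \<Omega>" for x
    using assms(6) that by (simp add: numeral_2_eq_2)
  have ud2: "partial_deriv b u differentiable (at x)" if "x \<in> \<Omega>" "b \<in> Basis" for x b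
    using assms(6) that by (simp add: numeral_2_eq_2)
  have p\<Omega>: "partial_deriv b ?f x = \<psi> 1 (u x) * partial_deriv b u x" if "x \<in> \<Omega>" for x b
    using partial_deriv_cong[OF \<Omega>(1) that, of ?f "\<lambda>x. \<psi> 0 (u x)" b] f\<Omega>
      partial_deriv_compose[OF ud[OF that] \<psi>1] by simp
  have p0: "partial_deriv b ?f x = 0" if "x \<in> - K" for x b
    using partial_deriv_cong[OF opK that, of ?f "\<lambda>x. 0" b] f0 by simp
  show "partial_deriv b ?f x = q * ?U x powr (q - 1) * partial_deriv b u x" if "b \<in> Basis" for b
  proof (cases "x \<in> \<Omega>")
    case True
    then have "\<psi> 1 (u x) = q * ?U x powr (q - 1)" by (simp add: \<psi>_def trunc_def)
    then show ?thesis by (simp only: p\<Omega>[OF True])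
  next
    case False
    then have "x \<in> - K" using K(2) by blast
    then show ?thesis using K(3) by (simp add: p0)
  qed
  show "partial_deriv b (partial_deriv b ?f) x =
      q * (q - 1) * ?U x powr (q - 2) * (partial_deriv b u x)\<^sup>2 +
      q * ?U x powr (q - 1) * partial_deriv b (partial_deriv b u) x" if b: "b \<in> Basis" for b
  proof (cases "x \<in> \<Omega>")
    case True
    have "partial_deriv b (partial_deriv b ?f) x =
        partial_deriv b (\<lambda>x. \<psi> 1 (u x) * partial_deriv b u x) x"
      by (rule partial_deriv_cong[OF \<Omega>(1) True]) (rule p\<Omega>)
    also have "\<dots> = \<psi> 1 (u x) * partial_deriv b (partial_deriv b u) x +
        partial_deriv b (\<lambda>x. \<psi> 1 (u x)) x * partial_deriv b u x"
      by (intro partial_deriv_mult differentiable_compose_real[OF ud[OF True] \<psi>2] ud2 True b)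
    also have "partial_deriv b (\<lambda>x. \<psi> 1 (u x)) x = \<psi> 2 (u x) * partial_deriv b u x"
      by (rule partial_deriv_compose[OF ud[OF True] \<psi>2])
    finally show ?thesis
      using True by (simp add: \<psi>_def trunc_def power2_eq_square)
  next
    case False
    then have x: "x \<in> - K" using K(2) by blast
    have "partial_deriv b (partial_deriv b ?f) x = partial_deriv b (\<lambda>x. 0) x"
      by (rule partial_deriv_cong[OF opK x]) (rule p0)
    then show ?thesis using K(3) x by simp
  qed
qed

text \<open>The quotients \<open>partial_deriv b u x / trunc \<Omega> u \<epsilon> x\<close> have the junk value \<open>0\<close> where the truncation
  vanishes; there, and outside \<open>\<Omega>\<close>, both sides below are \<open>0\<close>.\<close>

lemma
  fixes \<Omega> :: "'a::euclidean_space set"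
  assumes \<Omega>: "open \<Omega>" "bounded \<Omega>" "continuous_on (closure \<Omega>) u" "\<And>x. x \<in> frontier \<Omega> \<Longrightarrow> u x = 0"
    and "0 < \<epsilon>" "Ck_on 2 u \<Omega>" "2 < q"
  shows partial_deriv_trunc_powr': "b \<in> Basis \<Longrightarrow> partial_deriv b (\<lambda>x. trunc \<Omega> u \<epsilon> x powr q) x =
      q * (trunc \<Omega> u \<epsilon> x powr q * (partial_deriv b u x / trunc \<Omega> u \<epsilon> x))"
    and laplacian_trunc_powr_ge: "(\<And>x. x \<in> \<Omega> \<Longrightarrow> laplacian u x = v x * u x) \<Longrightarrow>
      (\<And>x. x \<in> \<Omega> \<Longrightarrow> - c \<le> v x) \<Longrightarrow>
      laplacian (\<lambda>x. trunc \<Omega> u \<epsilon> x powr q) x \<ge> q * (trunc \<Omega> u \<epsilon> x powr q *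
        ((q - 1) * (\<Sum>b\<in>Basis. (partial_deriv b u x / trunc \<Omega> u \<epsilon> x)\<^sup>2) + v x)
        - c * \<epsilon> * trunc \<Omega> u \<epsilon> x powr (q - 1))"
proof -
  let ?U = "trunc \<Omega> u \<epsilon>"
  have U1: "?U x powr (q - 1) = ?U x powr q / ?U x" and U2: "?U x powr (q - 2) = ?U x powr q / (?U x)\<^sup>2" for x
  proof -
    show "?U x powr (q - 1) = ?U x powr q / ?U x"
      using trunc_nonneg[of \<Omega> u \<epsilon> x] by (cases "?U x = 0") (auto simp: powr_diff)
    show "?U x powr (q - 2) = ?U x powr q / (?U x)\<^sup>2"
      using trunc_nonneg[of \<Omega> u \<epsilon> x] by (cases "?U x = 0") (auto simp: powr_diff powr_numeral)
  qed
  show "partial_deriv b (\<lambda>x. ?U x powr q) x = q * (?U x powr q * (partial_deriv b u x / ?U x))"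
    if "b \<in> Basis"
    by (simp add: partial_deriv_trunc_powr[OF assms that] U1)
  assume pde: "\<And>x. x \<in> \<Omega> \<Longrightarrow> laplacian u x = v x * u x" and v: "\<And>x. x \<in> \<Omega> \<Longrightarrow> - c \<le> v x"
  have "laplacian (\<lambda>x. ?U x powr q) x = (\<Sum>b\<in>Basis. q * (q - 1) * ?U x powr (q - 2) * (partial_deriv b u x)\<^sup>2 +
      q * ?U x powr (q - 1) * partial_deriv b (partial_deriv b u) x)"
    unfolding laplacian_def by (intro sum.cong refl partial_deriv2_trunc_powr[OF assms])
  also have "\<dots> = q * (?U x powr q * ((q - 1) * (\<Sum>b\<in>Basis. (partial_deriv b u x / ?U x)\<^sup>2))
      + ?U x powr (q - 1) * laplacian u x)"
    by (simp add: laplacian_def sum.distrib sum_distrib_left sum_distrib_right U2 power_divide algebra_simps)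
  finally have L: "laplacian (\<lambda>x. ?U x powr q) x =
      q * (?U x powr q * ((q - 1) * (\<Sum>b\<in>Basis. (partial_deriv b u x / ?U x)\<^sup>2))
      + ?U x powr (q - 1) * laplacian u x)" .
  \<comment> \<open>Where the truncation is positive, \<open>u\<close> equals
    \<open>?U + \<epsilon>\<close>, so the equation produces \<open>v * ?U powr q\<close> and an
    error \<open>\<epsilon> * v * ?U powr (q - 1)\<close>. A one-sided bound on \<open>v\<close>
    suffices for the error; an upper bound may fail near the boundary.\<close>
  have "?U x powr (q - 1) * laplacian u x \<ge> ?U x powr q * v x - c * \<epsilon> * ?U x powr (q - 1)"
  proof (cases "?U x = 0")
    case False
    then have x: "x \<in> \<Omega>" and pos: "?U x > 0" and ux: "u x = ?U x + \<epsilon>"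
      by (auto simp: trunc_def max_def split: if_splits)
    have "?U x powr (q - 1) * laplacian u x = ?U x powr q * v x + \<epsilon> * v x * ?U x powr (q - 1)"
      using pos by (simp add: pde[OF x] ux U1 field_simps)
    moreover have "- c * \<epsilon> * ?U x powr (q - 1) \<le> \<epsilon> * v x * ?U x powr (q - 1)"
      using mult_right_mono[OF v[OF x], of \<epsilon>] assms(5) by (intro mult_right_mono) (simp_all add: mult.commute)
    ultimately show ?thesis by simp
  qed simp
  then have "q * (?U x powr q * ((q - 1) * (\<Sum>b\<in>Basis. (partial_deriv b u x / ?U x)\<^sup>2))
      + (?U x powr q * v x - c * \<epsilon> * ?U x powr (q - 1))) \<le> laplacian (\<lambda>x. ?U x powr q) x"
    unfolding L using assms(7) by (intro mult_left_mono add_left_mono) auto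
  then show "laplacian (\<lambda>x. ?U x powr q) x \<ge> q * (?U x powr q *
        ((q - 1) * (\<Sum>b\<in>Basis. (partial_deriv b u x / ?U x)\<^sup>2) + v x)
        - c * \<epsilon> * ?U x powr (q - 1))"
    by (simp add: algebra_simps)
qed

section \<open>The Laplacian of a convolution\<close>

lemma partial_deriv_conv_left:
  assumes "csupp f" "Ck_on 1 g UNIV" "csupp g" "b \<in> Basis"
  shows "partial_deriv b (conv g f) = conv (partial_deriv b g) f"
proof -
  have g': "csupp (partial_deriv b g)"
    using csupp_partial_deriv[of 0 g b] assms by simp
  have "conv g f = conv f g"
    by (intro conv_commute csupp_borel assms)
  moreover have "partial_deriv b (conv f g) = conv f (partial_deriv b g)"
    by (rule ext, rule partial_deriv_conv[OF csupp_continuous[OF assms(1)] assms(2-4)])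
  moreover have "conv f (partial_deriv b g) = conv (partial_deriv b g) f"
    by (intro conv_commute csupp_borel assms g')
  ultimately show ?thesis by simp
qed

lemma partial_deriv_conv_right:
  assumes "csupp f" "Ck_on 1 g UNIV" "csupp g" "b \<in> Basis"
  shows "partial_deriv b (conv f g) = conv f (partial_deriv b g)"
  by (rule ext, rule partial_deriv_conv[OF csupp_continuous[OF assms(1)] assms(2-4)])

text \<open>\<open>has_bochner_integral\<close> carries integrability and value together, so that
  long linear combinations of convolution integrands can be integrated by introduction
  rules.\<close>

lemma has_bochner_integral_conv:
  assumes "csupp f" "csupp g"
  shows "has_bochner_integral lborel (\<lambda>x. f x * g (z - x)) (conv f g z)"
  using integrable_conv[OF csupp_continuous[OF assms(1)] assms(2)]
  by (simp add: has_bochner_integral_iff conv_def)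

lemma has_bochner_integral_mono:
  fixes f g :: "'a \<Rightarrow> real"
  assumes "has_bochner_integral M f x" "has_bochner_integral M g y" "\<And>x. f x \<le> g x"
  shows "x \<le> y"
  using assms integral_mono[of M f g] by (simp add: has_bochner_integral_iff)

lemma Ck_on_2D:
  assumes "Ck_on 2 f UNIV"
  shows "Ck_on 1 f UNIV" "b \<in> Basis \<Longrightarrow> Ck_on 1 (partial_deriv b f) UNIV"
    "b \<in> Basis \<Longrightarrow> b' \<in> Basis \<Longrightarrow> continuous_on UNIV (partial_deriv b' (partial_deriv b f))"
proof -
  have f: "Ck_on (Suc 1) f UNIV" using assms by (simp only: Suc_1)
  show "Ck_on 1 f UNIV" by (rule Ck_on_SucD[OF f])
  show "b \<in> Basis \<Longrightarrow> Ck_on 1 (partial_deriv b f) UNIV" using f by simp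
  show "b \<in> Basis \<Longrightarrow> b' \<in> Basis \<Longrightarrow> continuous_on UNIV (partial_deriv b' (partial_deriv b f))"
    using f by simp
qed

lemma csupp_partial_deriv_C2:
  assumes "Ck_on 2 f UNIV" "csupp f" "b \<in> Basis"
  shows "csupp (partial_deriv b f)" "csupp (partial_deriv b (partial_deriv b f))"
    "csupp (laplacian f)"
proof -
  have *: "csupp (partial_deriv b f)" "csupp (partial_deriv b (partial_deriv b f))" if "b \<in> Basis" for b
  proof -
    show 1: "csupp (partial_deriv b f)"
      by (rule csupp_partial_deriv[of 0]) (use Ck_on_2D(1)[OF assms(1)] assms(2) that in simp_all)
    show "csupp (partial_deriv b (partial_deriv b f))"
      by (rule csupp_partial_deriv[of 0]) (use Ck_on_2D(2)[OF assms(1) that] 1 that in simp_all)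
  qed
  show "csupp (partial_deriv b f)" "csupp (partial_deriv b (partial_deriv b f))"
    using *[OF assms(3)] by simp_all
  show "csupp (laplacian f)"
    unfolding laplacian_def[abs_def] by (intro csupp_sum *(2))
qed

lemma conv_sum_left:
  assumes "\<And>i. i \<in> I \<Longrightarrow> csupp (f i)" "csupp g"
  shows "conv (\<lambda>x. \<Sum>i\<in>I. f i x) g z = (\<Sum>i\<in>I. conv (f i) g z)"
  unfolding conv_def sum_distrib_right
  using integrable_conv[OF csupp_continuous[OF assms(1)] assms(2)]
  by (subst Bochner_Integration.integral_sum) auto

lemma conv_sum_right:
  assumes "csupp f" "\<And>i. i \<in> I \<Longrightarrow> csupp (g i)"
  shows "conv f (\<lambda>x. \<Sum>i\<in>I. g i x) z = (\<Sum>i\<in>I. conv f (g i) z)"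
  unfolding conv_def sum_distrib_left
  using integrable_conv[OF csupp_continuous[OF assms(1)] assms(2)]
  by (subst Bochner_Integration.integral_sum) auto

lemma
  fixes f g :: "'a::euclidean_space \<Rightarrow> real"
  assumes f: "Ck_on 2 f UNIV" "csupp f" and g: "Ck_on 2 g UNIV" "csupp g"
  shows laplacian_conv_left: "laplacian (conv f g) z = conv (laplacian f) g z"
    and laplacian_conv_right: "laplacian (conv f g) z = conv f (laplacian g) z"
    and laplacian_conv_mixed: "laplacian (conv f g) z =
      (\<Sum>b\<in>Basis. conv (partial_deriv b f) (partial_deriv b g) z)"
proof -
  note fs = csupp_partial_deriv_C2[OF f] and gs = csupp_partial_deriv_C2[OF g]
  have "partial_deriv b (partial_deriv b (conv f g)) = conv (partial_deriv b (partial_deriv b f)) g"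
    if "b \<in> Basis" for b
    using that by (simp add: partial_deriv_conv_left Ck_on_2D[OF f(1)] f g fs del: One_nat_def Ck_on.simps)
  then show "laplacian (conv f g) z = conv (laplacian f) g z"
    unfolding laplacian_def[abs_def] by (subst conv_sum_left) (auto simp: fs g)
  have "partial_deriv b (partial_deriv b (conv f g)) = conv f (partial_deriv b (partial_deriv b g))"
    if "b \<in> Basis" for b
    using that by (simp add: partial_deriv_conv_right Ck_on_2D[OF g(1)] f g gs del: One_nat_def Ck_on.simps)
  then show "laplacian (conv f g) z = conv f (laplacian g) z"
    unfolding laplacian_def[abs_def] by (subst conv_sum_right) (auto simp: gs f)
  have "partial_deriv b (partial_deriv b (conv f g)) = conv (partial_deriv b f) (partial_deriv b g)"
    if "b \<in> Basis" for b
  proof -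
    have "partial_deriv b (conv f g) = conv (partial_deriv b f) g"
      by (rule partial_deriv_conv_left[OF g(2) Ck_on_2D(1)[OF f(1)] f(2) that])
    moreover have "partial_deriv b (conv (partial_deriv b f) g) = conv (partial_deriv b f) (partial_deriv b g)"
      by (rule partial_deriv_conv_right[OF fs(1)[OF that] Ck_on_2D(1)[OF g(1)] g(2) that])
    ultimately show ?thesis by simp
  qed
  then show "laplacian (conv f g) z = (\<Sum>b\<in>Basis. conv (partial_deriv b f) (partial_deriv b g) z)"
    unfolding laplacian_def by simp
qed

section \<open>The quadratic form in the logarithmic gradients\<close>

lemma quadratic_form_nonneg:
  fixes A B C x y :: real
  assumes "0 < A" "B\<^sup>2 \<le> A * C"
  shows "0 \<le> A * x\<^sup>2 + 2 * B * x * y + C * y\<^sup>2"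
proof -
  have "0 \<le> (A * x + B * y)\<^sup>2 + (A * C - B\<^sup>2) * y\<^sup>2"
    using assms(2) by (intro add_nonneg_nonneg mult_nonneg_nonneg) simp_all
  also have "\<dots> = A * (A * x\<^sup>2 + 2 * B * x * y + C * y\<^sup>2)"
    by (simp add: power2_eq_square algebra_simps)
  finally show ?thesis using assms(1) by (simp add: zero_le_mult_iff)
qed

text \<open>Here \<open>A = a * x + t * y\<close> is the averaged logarithmic gradient and \<open>D = x - y\<close>; the difference
  of the two sides is the quadratic form
  \<open>(p^2 - p - 2) (A - \<xi>)^2 + 2 p (1 - 2 t) (A - \<xi>) D + (p - 2) a t D^2\<close>.\<close>

lemma interpolation_inequality:
  fixes a t p x y \<xi> :: real
  assumes "0 < t" "t < 1" and a: "a = 1 - t" and p: "2 + 2 / (a * t) \<le> p"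
  shows "(p\<^sup>2 - p - 2) * (2 * \<xi> * (a * x + t * y) - \<xi>\<^sup>2) + 2 * p * (1 - 2 * t) * \<xi> * (x - y)
    \<le> a * (p + 2) * (a * p - 1) * x\<^sup>2 + t * (p + 2) * (t * p - 1) * y\<^sup>2
      + (p\<^sup>2 - p * (p + 2) * (a\<^sup>2 + t\<^sup>2)) * (x * y)"
proof -
  have at: "0 < a * t" using assms by simp
  \<comment> \<open>This makes \<open>p\<close> at least 10, so that \<open>p + 2\<close> is at most
    half of \<open>p^2\<close>.\<close>
  have "a * t \<le> 1 / 4"
    using zero_le_power2[of "2 * t - 1"] by (simp add: a power2_eq_square algebra_simps)
  then have "8 \<le> 2 / (a * t)" using at by (simp add: field_simps)
  then have p10: "10 \<le> p" using p by linarith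
  have A: "p\<^sup>2 / 2 \<le> p\<^sup>2 - p - 2"
  proof -
    have "10 * p \<le> p\<^sup>2" using p10 by (simp add: power2_eq_square)
    then show ?thesis using p10 by simp
  qed
  \<comment> \<open>A restatement of the hypothesis on \<open>p\<close>, and the origin of its
    constant: with a first coefficient of at least \<open>p^2 / 2\<close>, the product of the outer
    coefficients is at least \<open>p^2\<close>, which dominates
    \<open>(p * (1 - 2 * t))^2\<close>.\<close>
  have B: "2 \<le> (p - 2) * (a * t)"
    using p unfolding pos_divide_le_eq[OF at, symmetric] by linarith
  have "\<bar>1 - 2 * t\<bar> \<le> 1" using assms(1,2) by linarith
  then have "(1 - 2 * t)\<^sup>2 \<le> 1" by (simp add: abs_square_le_1)
  then have "(p * (1 - 2 * t))\<^sup>2 \<le> p\<^sup>2 * 1"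
    unfolding power_mult_distrib by (rule mult_left_mono) simp
  also have "\<dots> = (p\<^sup>2 / 2) * 2" by simp
  also have "\<dots> \<le> (p\<^sup>2 - p - 2) * ((p - 2) * (a * t))"
    using A B p10 by (intro mult_mono) auto
  finally have "0 \<le> (p\<^sup>2 - p - 2) * (a * x + t * y - \<xi>)\<^sup>2
      + 2 * (p * (1 - 2 * t)) * (a * x + t * y - \<xi>) * (x - y) + (p - 2) * (a * t) * (x - y)\<^sup>2"
    using A p10 by (intro quadratic_form_nonneg) (auto intro: less_le_trans[of _ "p\<^sup>2 / 2"])
  also have "\<dots> = a * (p + 2) * (a * p - 1) * x\<^sup>2 + t * (p + 2) * (t * p - 1) * y\<^sup>2
      + (p\<^sup>2 - p * (p + 2) * (a\<^sup>2 + t\<^sup>2)) * (x * y)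
      - ((p\<^sup>2 - p - 2) * (2 * \<xi> * (a * x + t * y) - \<xi>\<^sup>2) + 2 * p * (1 - 2 * t) * \<xi> * (x - y))"
    unfolding a by (simp add: power2_eq_square algebra_simps)
  finally show ?thesis by simp
qed

text \<open>In the application \<open>g0\<close>, \<open>g1\<close> are the rescaled logarithmic
  gradients, \<open>w0\<close>, \<open>w1\<close> the potentials minus the eigenvalues, and
  \<open>\<kappa> * e0\<close>, \<open>\<kappa> * e1\<close> the truncation errors. The vector
  \<open>\<xi>\<close> is arbitrary but constant under the integral; maximising over it turns the
  middle term into a multiple of \<open>|\<nabla>W|^2 / W\<close>, with
  \<open>W = conv h0 h1\<close>.\<close>

lemma laplacian_conv_ge:
  fixes h0 h1 e0 e1 w0 w1 :: "'a::euclidean_space \<Rightarrow> real"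
  assumes t: "0 < t" "t < 1" and a: "a = 1 - t" and p: "2 + 2 / (a * t) \<le> p"
    and h0: "Ck_on 2 h0 UNIV" "csupp h0" "\<And>x. 0 \<le> h0 x" and h1: "Ck_on 2 h1 UNIV" "csupp h1" "\<And>x. 0 \<le> h1 x"
    and e0: "csupp e0" and e1: "csupp e1"
    and d0: "\<And>b x. b \<in> Basis \<Longrightarrow> partial_deriv b h0 x = p * (h0 x * g0 b x)"
    and d1: "\<And>b x. b \<in> Basis \<Longrightarrow> partial_deriv b h1 x = p * (h1 x * g1 b x)"
    and l0: "\<And>x. p / a * (h0 x * ((a * p - 1) * (\<Sum>b\<in>Basis. (g0 b x)\<^sup>2) + w0 x) - \<kappa> * e0 x) \<le> laplacian h0 x"
    and l1: "\<And>x. p / t * (h1 x * ((t * p - 1) * (\<Sum>b\<in>Basis. (g1 b x)\<^sup>2) + w1 x) - \<kappa> * e1 x) \<le> laplacian h1 x"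
    and w: "\<And>x. h0 x \<noteq> 0 \<Longrightarrow> h1 (z - x) \<noteq> 0 \<Longrightarrow> \<omega> \<le> a * w0 x + t * w1 (z - x)"
  shows "(p + 2) * \<omega> * conv h0 h1 z
      + (p\<^sup>2 - p - 2) * (\<Sum>b\<in>Basis. 2 / p * \<xi> b * partial_deriv b (conv h0 h1) z - (\<xi> b)\<^sup>2 * conv h0 h1 z)
      - (p + 2) * \<kappa> * (a * conv e0 h1 z + t * conv h0 e1 z)
    \<le> laplacian (conv h0 h1) z"
proof -
  have a0: "0 < a" "a < 1" using t a by auto
  have p2: "2 < p"
  proof -
    have "0 < 2 / (a * t)" using a0 t by simp
    then show ?thesis using p by linarith
  qed
  \<comment> \<open>Weights of the three expressions for the Laplacian, with sum 1. Against the
    factors \<open>p / a\<close> and \<open>p / t\<close> in \<open>l0\<close> and \<open>l1\<close>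
    they leave \<open>a * (p + 2)\<close> and \<open>t * (p + 2)\<close>, so the potentials appear
    in the combination that \<open>w\<close> bounds.\<close>
  define c1 where "c1 = a\<^sup>2 * (1 + 2 / p)"
  define c2 where "c2 = t\<^sup>2 * (1 + 2 / p)"
  define c3 where "c3 = 1 - c1 - c2"
  have c1p: "c1 * (p / a) = a * (p + 2)" and c2p: "c2 * (p / t) = t * (p + 2)"
    using a0 t p2 by (simp_all add: c1_def c2_def field_simps power2_eq_square)
  have c3p: "c3 * p\<^sup>2 = p\<^sup>2 - p * (p + 2) * (a\<^sup>2 + t\<^sup>2)"
    using p2 by (simp add: c3_def c1_def c2_def field_simps power2_eq_square)
  have c: "0 \<le> c1" "0 \<le> c2" using p2 by (simp_all add: c1_def c2_def)
  note s0 = csupp_partial_deriv_C2[OF h0(1,2)] and s1 = csupp_partial_deriv_C2[OF h1(1,2)]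
  let ?D0 = "\<lambda>b. partial_deriv b h0" and ?D1 = "\<lambda>b. partial_deriv b h1"
  define L where "L x = c1 * (laplacian h0 x * h1 (z - x)) + c2 * (h0 x * laplacian h1 (z - x))
    + c3 * (\<Sum>b\<in>Basis. ?D0 b x * ?D1 b (z - x))" for x
  \<comment> \<open>The second line of \<open>T\<close> integrates to 0, because
    \<open>conv (?D0 b) h1\<close> and \<open>conv h0 (?D1 b)\<close> are both the derivative of
    \<open>conv h0 h1\<close>. It supplies the part of the cross term linear in \<open>\<xi>\<close>
    that completes the square.\<close>
  define T where "T b x = (p\<^sup>2 - p - 2) * (2 / p * \<xi> b * (a * (?D0 b x * h1 (z - x)) + t * (h0 x * ?D1 b (z - x)))
      - (\<xi> b)\<^sup>2 * (h0 x * h1 (z - x)))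
    + 2 * (1 - 2 * t) * \<xi> b * (?D0 b x * h1 (z - x) - h0 x * ?D1 b (z - x))" for b x
  define R where "R x = (p + 2) * \<omega> * (h0 x * h1 (z - x)) + (\<Sum>b\<in>Basis. T b x)
    - (p + 2) * \<kappa> * (a * (e0 x * h1 (z - x)) + t * (h0 x * e1 (z - x)))" for x
  have RL: "R x \<le> L x" for x
  proof -
    define y where "y = z - x"
    define F where "F = h0 x * h1 y"
    have F: "0 \<le> F" using h0(3) h1(3) by (simp add: F_def)
    define S0 where "S0 = (\<Sum>b\<in>Basis. (g0 b x)\<^sup>2)"
    define S1 where "S1 = (\<Sum>b\<in>Basis. (g1 b y)\<^sup>2)"
    have "T b x \<le> F * (a * (p + 2) * (a * p - 1) * (g0 b x)\<^sup>2 + t * (p + 2) * (t * p - 1) * (g1 b y)\<^sup>2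
        + c3 * p\<^sup>2 * (g0 b x * g1 b y))" if b: "b \<in> Basis" for b
    proof -
      have "T b x = F * ((p\<^sup>2 - p - 2) * (2 * \<xi> b * (a * g0 b x + t * g1 b y) - (\<xi> b)\<^sup>2)
          + 2 * p * (1 - 2 * t) * \<xi> b * (g0 b x - g1 b y))"
        using p2 by (simp add: T_def y_def[symmetric] d0[OF b] d1[OF b] F_def algebra_simps)
      also have "\<dots> \<le> F * (a * (p + 2) * (a * p - 1) * (g0 b x)\<^sup>2 + t * (p + 2) * (t * p - 1) * (g1 b y)\<^sup>2
          + c3 * p\<^sup>2 * (g0 b x * g1 b y))"
        unfolding c3p by (intro mult_left_mono interpolation_inequality t a p F)
      finally show ?thesis .
    qed
    then have "(\<Sum>b\<in>Basis. T b x) \<le> (\<Sum>b\<in>Basis. F * (a * (p + 2) * (a * p - 1) * (g0 b x)\<^sup>2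
        + t * (p + 2) * (t * p - 1) * (g1 b y)\<^sup>2 + c3 * p\<^sup>2 * (g0 b x * g1 b y)))"
      by (rule sum_mono)
    also have "\<dots> = F * (a * (p + 2) * (a * p - 1) * S0 + t * (p + 2) * (t * p - 1) * S1)
        + c3 * (\<Sum>b\<in>Basis. p\<^sup>2 * F * (g0 b x * g1 b y))"
      by (simp add: S0_def S1_def sum.distrib sum_subtractf sum_distrib_left algebra_simps)
    also have "(\<Sum>b\<in>Basis. p\<^sup>2 * F * (g0 b x * g1 b y)) = (\<Sum>b\<in>Basis. ?D0 b x * ?D1 b y)"
      by (intro sum.cong refl) (simp add: d0 d1 F_def power2_eq_square)
    finally have T: "(\<Sum>b\<in>Basis. T b x) \<le> F * (a * (p + 2) * (a * p - 1) * S0 + t * (p + 2) * (t * p - 1) * S1)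
        + c3 * (\<Sum>b\<in>Basis. ?D0 b x * ?D1 b y)" .
    have "c1 * (p / a * (h0 x * ((a * p - 1) * S0 + w0 x) - \<kappa> * e0 x) * h1 y) \<le> c1 * (laplacian h0 x * h1 y)"
      using l0[of x] c(1) h1(3)[of y] by (intro mult_left_mono mult_right_mono) (simp_all add: S0_def)
    moreover have "c1 * (p / a * (h0 x * ((a * p - 1) * S0 + w0 x) - \<kappa> * e0 x) * h1 y) =
        c1 * (p / a) * ((h0 x * ((a * p - 1) * S0 + w0 x) - \<kappa> * e0 x) * h1 y)" by simp
    ultimately have B0: "a * (p + 2) * (F * ((a * p - 1) * S0 + w0 x) - \<kappa> * (e0 x * h1 y)) \<le> c1 * (laplacian h0 x * h1 y)"
      unfolding c1p by (simp add: F_def algebra_simps)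
    have "c2 * (h0 x * (p / t * (h1 y * ((t * p - 1) * S1 + w1 y) - \<kappa> * e1 y))) \<le> c2 * (h0 x * laplacian h1 y)"
      using l1[of y] c(2) h0(3)[of x] by (intro mult_left_mono) (simp_all add: S1_def)
    moreover have "c2 * (h0 x * (p / t * (h1 y * ((t * p - 1) * S1 + w1 y) - \<kappa> * e1 y))) =
        c2 * (p / t) * (h0 x * (h1 y * ((t * p - 1) * S1 + w1 y) - \<kappa> * e1 y))" by simp
    ultimately have B1: "t * (p + 2) * (F * ((t * p - 1) * S1 + w1 y) - \<kappa> * (h0 x * e1 y)) \<le> c2 * (h0 x * laplacian h1 y)"
      unfolding c2p by (simp add: F_def algebra_simps)
    \<comment> \<open>The hypothesis \<open>w\<close> speaks only of points where both factors are
      non-zero; elsewhere both sides vanish.\<close>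
    have "F * \<omega> \<le> F * (a * w0 x + t * w1 y)"
    proof (cases "F = 0")
      case False
      then show ?thesis using w[of x] F by (intro mult_left_mono) (auto simp: F_def y_def)
    qed simp
    then have C: "(p + 2) * \<omega> * F \<le> (p + 2) * (F * (a * w0 x + t * w1 y))"
      using p2 by (simp add: mult.assoc mult.commute[of \<omega>])
    have "R x = (p + 2) * \<omega> * F + (\<Sum>b\<in>Basis. T b x) - (p + 2) * \<kappa> * (a * (e0 x * h1 y) + t * (h0 x * e1 y))"
      by (simp add: R_def F_def y_def)
    also have "\<dots> \<le> (p + 2) * (F * (a * w0 x + t * w1 y)) + (F * (a * (p + 2) * (a * p - 1) * S0 + t * (p + 2) * (t * p - 1) * S1)
        + c3 * (\<Sum>b\<in>Basis. ?D0 b x * ?D1 b y)) - (p + 2) * \<kappa> * (a * (e0 x * h1 y) + t * (h0 x * e1 y))"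
      using T C by linarith
    also have "\<dots> = a * (p + 2) * (F * ((a * p - 1) * S0 + w0 x) - \<kappa> * (e0 x * h1 y))
        + t * (p + 2) * (F * ((t * p - 1) * S1 + w1 y) - \<kappa> * (h0 x * e1 y)) + c3 * (\<Sum>b\<in>Basis. ?D0 b x * ?D1 b y)"
      by (simp add: algebra_simps)
    also have "\<dots> \<le> c1 * (laplacian h0 x * h1 y) + c2 * (h0 x * laplacian h1 y) + c3 * (\<Sum>b\<in>Basis. ?D0 b x * ?D1 b y)"
      using B0 B1 by linarith
    also have "\<dots> = L x" by (simp add: L_def y_def)
    finally show ?thesis .
  qed
  have LI: "has_bochner_integral lborel L (laplacian (conv h0 h1) z)"
  proof -
    have "has_bochner_integral lborel L (c1 * conv (laplacian h0) h1 z + c2 * conv h0 (laplacian h1) z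
        + c3 * (\<Sum>b\<in>Basis. conv (?D0 b) (?D1 b) z))"
      unfolding L_def
      by (intro has_bochner_integral_add has_bochner_integral_mult_right has_bochner_integral_sum
          has_bochner_integral_conv s0 s1 h0 h1 nonempty_Basis)
        (use SOME_Basis in auto)
    also have "\<dots> = (c1 + c2 + c3) * laplacian (conv h0 h1) z"
      unfolding laplacian_conv_left[OF h0(1,2) h1(1,2), symmetric]
        laplacian_conv_right[OF h0(1,2) h1(1,2), symmetric]
        laplacian_conv_mixed[OF h0(1,2) h1(1,2), symmetric]
      by (simp add: distrib_right)
    finally show ?thesis by (simp add: c3_def)
  qed
  have RI: "has_bochner_integral lborel R ((p + 2) * \<omega> * conv h0 h1 z
      + (p\<^sup>2 - p - 2) * (\<Sum>b\<in>Basis. 2 / p * \<xi> b * partial_deriv b (conv h0 h1) z - (\<xi> b)\<^sup>2 * conv h0 h1 z)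
      - (p + 2) * \<kappa> * (a * conv e0 h1 z + t * conv h0 e1 z))"
  proof -
    have D0: "conv (?D0 b) h1 z = partial_deriv b (conv h0 h1) z"
      and D1: "conv h0 (?D1 b) z = partial_deriv b (conv h0 h1) z" if "b \<in> Basis" for b
      using partial_deriv_conv_left[OF h1(2) Ck_on_2D(1)[OF h0(1)] h0(2) that]
        partial_deriv_conv_right[OF h0(2) Ck_on_2D(1)[OF h1(1)] h1(2) that] by simp_all
    have TI: "has_bochner_integral lborel (T b)
        ((p\<^sup>2 - p - 2) * (2 / p * \<xi> b * partial_deriv b (conv h0 h1) z - (\<xi> b)\<^sup>2 * conv h0 h1 z))"
      if b: "b \<in> Basis" for b
    proof -
      have "has_bochner_integral lborel (T b) ((p\<^sup>2 - p - 2) * (2 / p * \<xi> b * (a * conv (?D0 b) h1 z + t * conv h0 (?D1 b) z)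
            - (\<xi> b)\<^sup>2 * conv h0 h1 z) + 2 * (1 - 2 * t) * \<xi> b * (conv (?D0 b) h1 z - conv h0 (?D1 b) z))"
        unfolding T_def
        by (intro has_bochner_integral_add has_bochner_integral_diff has_bochner_integral_mult_right
            has_bochner_integral_conv s0(1)[OF b] s1(1)[OF b] h0 h1)
      also have "a * conv (?D0 b) h1 z + t * conv h0 (?D1 b) z = partial_deriv b (conv h0 h1) z"
        by (simp add: D0[OF b] D1[OF b] a algebra_simps)
      finally show ?thesis by (simp add: D0[OF b] D1[OF b])
    qed
    show ?thesis
      unfolding R_def sum_distrib_left
      by (intro has_bochner_integral_add has_bochner_integral_diff has_bochner_integral_mult_right
          has_bochner_integral_sum has_bochner_integral_conv TI h0 h1 e0 e1)
  qed
  show ?thesis by (rule has_bochner_integral_mono[OF RI LI RL])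
qed

section \<open>The trial function\<close>

text \<open>Here \<open>V\<close> stands for the potential minus \<open>l\<close>, \<open>S\<close>
  for \<open>|\<nabla>W|^2\<close>, \<open>L\<close> for the Laplacian of \<open>W\<close> and
  \<open>E\<close> for the truncation error. The bracket on the left is then the Laplacian of
  \<open>v\<close>, and the last summand on the right is \<open>2 / p\<close> times
  \<open>|\<nabla>v|^2\<close>.\<close>

lemma trial_pointwise:
  fixes S p W \<delta> v V E c L :: real
  assumes p: "2 < p" and W: "0 \<le> W" and \<delta>: "0 < \<delta>" and c: "0 \<le> c" "- c \<le> V" and E: "0 \<le> E"
    and L: "(p + 2) * V * W + (p\<^sup>2 - p - 2) * (S * (2 / (p\<^sup>2 * (W + \<delta>)) - W / (p\<^sup>2 * (W + \<delta>)\<^sup>2))) - (p + 2) * E \<le> L"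
    and S: "0 \<le> S"
    and v: "v = (W + \<delta>) powr (1 / p) - \<delta> powr (1 / p)"
  shows "- v * (1 / p * (1 / p - 1) * (W + \<delta>) powr (1 / p - 2) * S + 1 / p * (W + \<delta>) powr (1 / p - 1) * L)
    \<le> - (1 - 2 / p) * V * v\<^sup>2 + 4 * c / p * v\<^sup>2
      + (2 * c * \<delta> powr (1 / p) + 2 * E * \<delta> powr (1 / p - 1)) * v
      + 2 / p * ((1 / p * (W + \<delta>) powr (1 / p - 1))\<^sup>2 * S)"
proof -
  define Z where "Z = W + \<delta>"
  define r where "r = Z powr (1 / p - 1)"
  define \<kappa> where "\<kappa> = \<delta> powr (1 / p)"
  have Z: "0 < Z" "W \<le> Z" "\<delta> \<le> Z" using W \<delta> by (simp_all add: Z_def)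
  have r0: "0 < r" using Z by (simp add: r_def)
  have y: "Z powr (1 / p) = r * Z" using Z by (simp add: r_def powr_diff)
  have r2: "Z powr (1 / p - 2) = r / Z"
    using Z by (simp add: r_def powr_diff powr_numeral power2_eq_square)
  have \<kappa>0: "0 < \<kappa>" using \<delta> by (simp add: \<kappa>_def)
  have r\<delta>: "r \<le> \<delta> powr (1 / p - 1)"
    unfolding r_def using Z \<delta> p by (intro powr_mono2') auto
  have \<delta>r: "\<delta> * r \<le> \<kappa>"
  proof -
    have "\<delta> * r \<le> \<delta> * \<delta> powr (1 / p - 1)" using r\<delta> \<delta> by (intro mult_left_mono) auto
    also have "\<dots> = \<kappa>" using \<delta> by (simp add: \<kappa>_def powr_diff)
    finally show ?thesis .
  qed
  have v': "v = r * Z - \<kappa>" unfolding v Z_def[symmetric] y by (simp add: \<kappa>_def)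
  have v0: "0 \<le> v"
    unfolding v using W \<delta> p by (auto intro!: powr_mono2)
  have vy: "v \<le> r * Z" using v' \<kappa>0 by simp
  have q: "0 \<le> p\<^sup>2 - p - 2"
  proof -
    have "p * 2 \<le> p * p" using p by (intro mult_left_mono) auto
    then show ?thesis using p unfolding power2_eq_square by linarith
  qed
  \<comment> \<open>Replacing \<open>W\<close> by \<open>W + \<delta>\<close> in the optimal
    \<open>\<xi>\<close> is harmless: because \<open>W \<le> Z\<close>, the value
    \<open>1 / (p^2 * Z)\<close> is still reached.\<close>
  have "S / (p\<^sup>2 * Z) \<le> S * (2 / (p\<^sup>2 * Z) - W / (p\<^sup>2 * Z\<^sup>2))"
  proof -
    have "W / (p\<^sup>2 * Z\<^sup>2) \<le> Z / (p\<^sup>2 * Z\<^sup>2)"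
      using Z p by (intro divide_right_mono) auto
    also have "\<dots> = 1 / (p\<^sup>2 * Z)" using Z by (simp add: power2_eq_square)
    finally have "1 / (p\<^sup>2 * Z) \<le> 2 / (p\<^sup>2 * Z) - W / (p\<^sup>2 * Z\<^sup>2)" by (simp add: field_simps)
    from mult_left_mono[OF this S] show ?thesis by simp
  qed
  then have "(p\<^sup>2 - p - 2) * (S / (p\<^sup>2 * Z)) \<le> (p\<^sup>2 - p - 2) * (S * (2 / (p\<^sup>2 * Z) - W / (p\<^sup>2 * Z\<^sup>2)))"
    using q by (rule mult_left_mono)
  then have L': "(p + 2) * V * W + (p\<^sup>2 - p - 2) * (S / (p\<^sup>2 * Z)) - (p + 2) * E \<le> L"
    using L unfolding Z_def[symmetric] by linarith
  have "v * (r * S / (p\<^sup>2 * Z)) \<le> r * Z * (r * S / (p\<^sup>2 * Z))"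
    using vy r0 S Z by (intro mult_right_mono) auto
  also have "r * Z * (r * S / (p\<^sup>2 * Z)) = (1 / p * r)\<^sup>2 * S"
    using Z by (simp add: power2_eq_square)
  finally have m: "2 / p * (v * (r * S / (p\<^sup>2 * Z))) \<le> 2 / p * ((1 / p * r)\<^sup>2 * S)"
    using p by (intro mult_left_mono) auto
  have "v * (r / p) * ((p + 2) * V * W + (p\<^sup>2 - p - 2) * (S / (p\<^sup>2 * Z)) - (p + 2) * E) \<le> v * (r / p) * L"
    using L' v0 r0 p by (intro mult_left_mono) auto
  then have "- v * (1 / p * (1 / p - 1) * (r / Z) * S + 1 / p * r * L) \<le>
      - v * (1 / p * (1 / p - 1) * (r / Z) * S) - v * (r / p) * ((p + 2) * V * W + (p\<^sup>2 - p - 2) * (S / (p\<^sup>2 * Z)) - (p + 2) * E)"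
    by (simp add: algebra_simps)
  \<comment> \<open>The chain rule contributes \<open>1 - 1 / p\<close> to the coefficient of the
    gradient term and the convolution \<open>(p^2 - p - 2) / p^2\<close>; these differ by
    \<open>2 / p^2\<close>, which leaves the gradient term with a factor
    \<open>2 / p\<close>.\<close>
  also have "\<dots> = - ((1 + 2 / p) * V * v * (r * W)) + (1 + 2 / p) * E * r * v + 2 / p * (v * (r * S / (p\<^sup>2 * Z)))"
    using p Z by (simp add: field_simps power2_eq_square)
  finally have 1: "- v * (1 / p * (1 / p - 1) * (r / Z) * S + 1 / p * r * L) \<le>
      - ((1 + 2 / p) * V * v * (r * W)) + (1 + 2 / p) * E * r * v + 2 / p * ((1 / p * r)\<^sup>2 * S)"
    using m by linarith
  have p1: "1 + 2 / p \<le> 2" "0 < 1 + 2 / p" using p by (simp_all add: field_simps)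
  have "(1 + 2 / p) * (E * r * v) \<le> 2 * (E * \<delta> powr (1 / p - 1) * v)"
    using p1 E r\<delta> v0 r0 by (intro mult_mono mult_right_mono mult_left_mono) auto
  then have 2: "(1 + 2 / p) * E * r * v \<le> 2 * E * \<delta> powr (1 / p - 1) * v" by simp
  \<comment> \<open>The shift by \<open>\<delta>\<close> makes \<open>r * W\<close> differ from
    \<open>v\<close> by an amount between 0 and \<open>\<kappa>\<close>; hence the error
    \<open>2 * c * \<delta> powr (1 / p) * v\<close>.\<close>
  have rW: "r * W = v + (\<kappa> - \<delta> * r)" unfolding v' Z_def by (simp add: algebra_simps)
  have "- V * (v * (\<kappa> - \<delta> * r)) \<le> c * (v * (\<kappa> - \<delta> * r))"
    using c(2) v0 \<delta>r by (intro mult_right_mono) auto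
  also have "\<dots> \<le> c * (v * \<kappa>)"
    using c(1) v0 r0 \<delta> by (intro mult_left_mono) auto
  finally have "- (V * v * (r * W)) \<le> - (V * v\<^sup>2) + c * (v * \<kappa>)"
    unfolding rW by (simp add: algebra_simps power2_eq_square)
  then have "(1 + 2 / p) * - (V * v * (r * W)) \<le> (1 + 2 / p) * (- (V * v\<^sup>2) + c * (v * \<kappa>))"
    using p1 by (intro mult_left_mono) auto
  \<comment> \<open>The coefficient \<open>1 - 2 / p\<close> is what remains of the gradient
    integral once the last summand is absorbed, so the potential must carry it too. The surplus
    \<open>4 / p\<close> is paid for by the lower bound on \<open>V\<close>.\<close>
  also have "\<dots> = - (1 - 2 / p) * V * v\<^sup>2 + 4 / p * (- V * v\<^sup>2) + (1 + 2 / p) * (c * (v * \<kappa>))"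
    by (simp add: algebra_simps)
  also have "\<dots> \<le> - (1 - 2 / p) * V * v\<^sup>2 + 4 / p * (c * v\<^sup>2) + 2 * (c * (v * \<kappa>))"
    using c p p1 v0 \<kappa>0 by (intro add_mono order_refl mult_left_mono mult_right_mono) auto
  finally have 3: "- ((1 + 2 / p) * V * v * (r * W)) \<le> - (1 - 2 / p) * V * v\<^sup>2 + 4 * c / p * v\<^sup>2 + 2 * c * \<kappa> * v"
    by (simp add: algebra_simps)
  show ?thesis
    unfolding Z_def[symmetric] r_def[symmetric] r2 \<kappa>_def[symmetric]
    using 1 2 3 by (simp add: distrib_right)
qed

text \<open>Integrating the pointwise inequality turns \<open>- v * laplacian v\<close> into the
  Dirichlet integral. Absorbing \<open>2 / p\<close> of it on the left leaves
  \<open>1 - 2 / p\<close> times the numerator of the Rayleigh quotient, minus \<open>l\<close>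
  times its denominator.\<close>

lemma trial_function:
  fixes \<Omega> :: "'a::euclidean_space set" and W V :: "'a \<Rightarrow> real"
  assumes "open \<Omega>" "bounded \<Omega>" "continuous_on \<Omega> V" "\<And>z. z \<in> \<Omega> \<Longrightarrow> - c \<le> V z - l" "0 \<le> c"
    and W: "Ck_on 2 W UNIV" "csupp_in \<Omega> W" "\<And>z. 0 \<le> W z"
    and p: "2 < p" and \<delta>: "0 < \<delta>" and E: "0 \<le> E"
    and ineq: "\<And>z \<xi>. z \<in> \<Omega> \<Longrightarrow> (p + 2) * (V z - l) * W z
      + (p\<^sup>2 - p - 2) * (\<Sum>b\<in>Basis. 2 / p * \<xi> b * partial_deriv b W z - (\<xi> b)\<^sup>2 * W z) - (p + 2) * E
      \<le> laplacian W z"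
    and v_def: "v = (\<lambda>z. (W z + \<delta>) powr (1 / p) - \<delta> powr (1 / p))"
    and pos: "0 < (LINT x|lborel. (v x)\<^sup>2)"
  shows "(1 - 2 / p) * (dirichlet_eigenvalue V \<Omega> - l) * (LINT x|lborel. (v x)\<^sup>2)
    \<le> 4 * c / p * (LINT x|lborel. (v x)\<^sup>2)
      + (2 * c * \<delta> powr (1 / p) + 2 * E * \<delta> powr (1 / p - 1)) * (LINT x|lborel. v x)"
    and "csupp_in \<Omega> v"
proof -
  define \<psi> where "\<psi> j s = (if j = 0 then (s + \<delta>) powr (1 / p)
    else if j = 1 then 1 / p * (s + \<delta>) powr (1 / p - 1)
    else 1 / p * ((1 / p - 1) * (s + \<delta>) powr (1 / p - 2)))" for j :: nat and s
  let ?S = "{- \<delta><..}"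
  have \<psi>1: "(\<psi> 0 has_real_derivative \<psi> 1 s) (at s)" if "s \<in> ?S" for s
    using that p unfolding \<psi>_def by (auto intro!: derivative_eq_intros)
  have \<psi>2: "(\<psi> 1 has_real_derivative \<psi> 2 s) (at s)" if "s \<in> ?S" for s
    using that p unfolding \<psi>_def by (auto intro!: derivative_eq_intros)
  have \<psi>3: "continuous_on ?S (\<psi> 2)"
    using p unfolding \<psi>_def by (auto intro!: continuous_intros)
  have WS: "W z \<in> ?S" for z using W(3)[of z] \<delta> by simp
  have \<psi>12: "(\<psi> j has_real_derivative \<psi> (Suc j) s) (at s)" if "j < 2" "s \<in> ?S" for j s
  proof -
    have "j = 0 \<or> j = 1" using that(1) by linarith
    then show ?thesis using \<psi>1[OF that(2)] \<psi>2[OF that(2)] by (auto simp: numeral_2_eq_2)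
  qed
  have "Ck_on 2 (\<lambda>z. \<psi> 0 (W z)) UNIV"
  proof (rule Ck_on_compose[OF open_UNIV _ _ W(1)])
    show "(\<psi> j has_real_derivative \<psi> (Suc j) s) (at s)" if "j < 0 + 2" "s \<in> ?S" for j s
      using \<psi>12[of j s] that by simp
    show "continuous_on ?S (\<psi> (0 + 2))" using \<psi>3 by (simp only: add_0)
    show "W ` UNIV \<subseteq> ?S" using WS by blast
  qed
  then have v2: "Ck_on 2 v UNIV"
    unfolding v_def using Ck_on_diff[OF open_UNIV _ Ck_on_const] by (simp add: \<psi>_def)
  show vs: "csupp_in \<Omega> v"
    by (rule csupp_in_subset[OF W(2) Ck_on_imp_continuous_on[OF v2]]) (simp add: v_def)
  have vcs: "csupp v" by (rule csupp_in_csupp[OF vs])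
  have Wd: "W differentiable (at z)" for z using Ck_on_2D(1)[OF W(1)] by simp
  have Wd2: "partial_deriv b W differentiable (at z)" if "b \<in> Basis" for z b
    using Ck_on_2D(2)[OF W(1) that] by simp
  have p1: "partial_deriv b v z = \<psi> 1 (W z) * partial_deriv b W z" for b z
  proof -
    have "partial_deriv b v z = partial_deriv b (\<lambda>z. \<psi> 0 (W z)) z - partial_deriv b (\<lambda>z. \<delta> powr (1 / p)) z"
      unfolding v_def
      using partial_deriv_diff[OF differentiable_compose_real[OF Wd \<psi>1[OF WS]] differentiable_const]
      by (simp add: \<psi>_def)
    then show ?thesis using partial_deriv_compose[OF Wd \<psi>1[OF WS]] by simp
  qed
  have p2: "partial_deriv b (partial_deriv b v) z =
      \<psi> 2 (W z) * (partial_deriv b W z)\<^sup>2 + \<psi> 1 (W z) * partial_deriv b (partial_deriv b W) z"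
    if b: "b \<in> Basis" for b z
  proof -
    have "partial_deriv b v = (\<lambda>z. \<psi> 1 (W z) * partial_deriv b W z)" using p1 by blast
    then have "partial_deriv b (partial_deriv b v) z = \<psi> 1 (W z) * partial_deriv b (partial_deriv b W) z
        + partial_deriv b (\<lambda>z. \<psi> 1 (W z)) z * partial_deriv b W z"
      using partial_deriv_mult[OF differentiable_compose_real[OF Wd \<psi>2[OF WS]] Wd2[OF b]] by simp
    then show ?thesis
      using partial_deriv_compose[OF Wd \<psi>2[OF WS]] by (simp add: power2_eq_square)
  qed
  define S where "S z = (\<Sum>b\<in>Basis. (partial_deriv b W z)\<^sup>2)" for z
  have lap: "laplacian v z = \<psi> 2 (W z) * S z + \<psi> 1 (W z) * laplacian W z" for z
    unfolding laplacian_def S_def by (simp add: p2 sum.distrib sum_distrib_left)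
  have gr: "(\<Sum>b\<in>Basis. (partial_deriv b v z)\<^sup>2) = (\<psi> 1 (W z))\<^sup>2 * S z" for z
    by (simp add: p1 S_def sum_distrib_left power_mult_distrib)
  define B where "B = 2 * c * \<delta> powr (1 / p) + 2 * E * \<delta> powr (1 / p - 1)"
  let ?G = "\<lambda>z. \<Sum>b\<in>Basis. (partial_deriv b v z)\<^sup>2"
  have pw: "- v z * laplacian v z \<le>
      - (1 - 2 / p) * (V z - l) * (v z)\<^sup>2 + 4 * c / p * (v z)\<^sup>2 + B * v z + 2 / p * ?G z" for z
  proof (cases "z \<in> \<Omega>")
    case True
    let ?Z = "W z + \<delta>"
    have Z: "0 < ?Z" using WS[of z] by simp
    \<comment> \<open>The best choice of \<open>\<xi>\<close> would be
      \<open>\<nabla>W / (p * W)\<close>; with \<open>W + \<delta>\<close> in the denominator it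
      also makes sense where \<open>W\<close> vanishes.\<close>
    have "(\<Sum>b\<in>Basis. 2 / p * (partial_deriv b W z / (p * ?Z)) * partial_deriv b W z
        - (partial_deriv b W z / (p * ?Z))\<^sup>2 * W z) = S z * (2 / (p\<^sup>2 * ?Z) - W z / (p\<^sup>2 * ?Z\<^sup>2))"
      unfolding S_def sum_distrib_right
      by (intro sum.cong refl) (simp add: power2_eq_square algebra_simps)
    then have "(p + 2) * (V z - l) * W z + (p\<^sup>2 - p - 2) * (S z * (2 / (p\<^sup>2 * ?Z) - W z / (p\<^sup>2 * ?Z\<^sup>2)))
        - (p + 2) * E \<le> laplacian W z"
      using ineq[OF True, of "\<lambda>b. partial_deriv b W z / (p * ?Z)"] by simp
    from trial_pointwise[OF p W(3) \<delta> assms(5) assms(4)[OF True] E this _ fun_cong[OF v_def]]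
    have "- v z * (1 / p * (1 / p - 1) * ?Z powr (1 / p - 2) * S z + 1 / p * ?Z powr (1 / p - 1) * laplacian W z)
    \<le> - (1 - 2 / p) * (V z - l) * (v z)\<^sup>2 + 4 * c / p * (v z)\<^sup>2 + B * v z
      + 2 / p * ((1 / p * ?Z powr (1 / p - 1))\<^sup>2 * S z)"
      unfolding B_def by (simp add: S_def sum_nonneg)
    then show ?thesis unfolding lap gr by (simp add: \<psi>_def)
  next
    \<comment> \<open>Outside \<open>\<Omega>\<close> nothing is assumed about the Laplacian of
      \<open>W\<close>; there \<open>v\<close> is 0 and only the nonnegative gradient term
      survives.\<close>
    case False
    then have "v z = 0" by (rule csupp_in_outside[OF vs])
    then show ?thesis using p by (simp add: sum_nonneg)
  qed
  have v1: "Ck_on 1 v UNIV" by (rule Ck_on_2D(1)[OF v2])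
  have vc: "continuous_on UNIV v" by (rule csupp_continuous[OF vcs])
  note vp = csupp_partial_deriv_C2[OF v2 vcs]
  have iG: "integrable lborel ?G"
    using vp(1) by (intro csupp_integrable csupp_sum) (simp add: power2_eq_square csupp_mult(1) csupp_continuous)
  have ivv: "integrable lborel (\<lambda>z. (v z)\<^sup>2)" and iv: "integrable lborel v"
    using csupp_in_csupp[OF csupp_in_power2[OF vs]] vcs by (auto intro: csupp_integrable)
  have iV: "integrable lborel (\<lambda>z. V z * (v z)\<^sup>2)"
    by (intro csupp_integrable csupp_in_csupp[of \<Omega>] csupp_in_mult_continuous_on assms csupp_in_power2 vs)
  define N where "N = (LINT z|lborel. ?G z)"
  have ibp: "(LINT z|lborel. v z * laplacian v z) = - N"
  proof -
    have i1: "integrable lborel (\<lambda>z. v z * partial_deriv b (partial_deriv b v) z)" if "b \<in> Basis" for b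
      using vp(2)[OF that] by (intro csupp_integrable csupp_mult vcs csupp_continuous)
    have i2: "integrable lborel (\<lambda>z. (partial_deriv b v z)\<^sup>2)" if "b \<in> Basis" for b
      using vp(1)[OF that] unfolding power2_eq_square by (intro csupp_integrable csupp_mult csupp_continuous)
    have "(LINT z|lborel. v z * laplacian v z) =
        (\<Sum>b\<in>Basis. LINT z|lborel. v z * partial_deriv b (partial_deriv b v) z)"
      unfolding laplacian_def sum_distrib_left by (rule Bochner_Integration.integral_sum) (rule i1)
    also have "\<dots> = (\<Sum>b\<in>Basis. - (LINT z|lborel. (partial_deriv b v z)\<^sup>2))"
      by (intro sum.cong refl)
        (simp only: integral_by_parts_csupp[OF v1 Ck_on_2D(2)[OF v2] vcs] power2_eq_square)
    also have "\<dots> = - N"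
      unfolding N_def sum_negf by (subst Bochner_Integration.integral_sum) (simp_all add: i2)
    finally show ?thesis .
  qed
  have il: "integrable lborel (\<lambda>z. v z * laplacian v z)"
    by (intro csupp_integrable csupp_mult vcs csupp_continuous vp(3)[OF SOME_Basis])
  let ?D = "LINT z|lborel. (v z)\<^sup>2" and ?VD = "LINT z|lborel. V z * (v z)\<^sup>2"
  have lhs: "has_bochner_integral lborel (\<lambda>z. - v z * laplacian v z) N"
    using has_bochner_integral_minus[OF has_bochner_integral_integrable[OF il]] ibp by simp
  have rhs: "has_bochner_integral lborel
      (\<lambda>z. - (1 - 2 / p) * (V z * (v z)\<^sup>2) + (1 - 2 / p) * l * (v z)\<^sup>2 + 4 * c / p * (v z)\<^sup>2 + B * v z + 2 / p * ?G z)
      (- (1 - 2 / p) * ?VD + (1 - 2 / p) * l * ?D + 4 * c / p * ?D + B * (LINT z|lborel. v z) + 2 / p * N)"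
    unfolding N_def
    by (intro has_bochner_integral_add has_bochner_integral_mult_right has_bochner_integral_integrable iV ivv iv iG)
  have "N \<le> - (1 - 2 / p) * ?VD + (1 - 2 / p) * l * ?D + 4 * c / p * ?D + B * (LINT z|lborel. v z) + 2 / p * N"
  proof (rule has_bochner_integral_mono[OF lhs rhs])
    fix z
    have "- k * (V z * (v z)\<^sup>2) + k * l * (v z)\<^sup>2 = - k * (V z - l) * (v z)\<^sup>2" for k
      by (simp add: algebra_simps)
    then show "- v z * laplacian v z \<le> - (1 - 2 / p) * (V z * (v z)\<^sup>2) + (1 - 2 / p) * l * (v z)\<^sup>2
        + 4 * c / p * (v z)\<^sup>2 + B * v z + 2 / p * ?G z"
      using pw[of z] by presburger
  qed
  then have *: "(1 - 2 / p) * (N + ?VD - l * ?D) \<le> 4 * c / p * ?D + B * (LINT z|lborel. v z)"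
    by (simp add: algebra_simps)
  have "dirichlet_eigenvalue V \<Omega> * ?D \<le> (LINT z|lborel. ?G z + V z * (v z)\<^sup>2)"
  proof (rule dirichlet_eigenvalue_le[OF assms(1,2) vs v1 assms(3) _ pos])
    show "l - c \<le> V x" if "x \<in> \<Omega>" for x using assms(4)[OF that] by simp
  qed
  also have "\<dots> = N + ?VD"
    unfolding N_def by (rule Bochner_Integration.integral_add[OF iG iV])
  finally have "(1 - 2 / p) * ((dirichlet_eigenvalue V \<Omega> - l) * ?D) \<le> (1 - 2 / p) * (N + ?VD - l * ?D)"
    using p by (intro mult_left_mono) (simp_all add: algebra_simps)
  then show "(1 - 2 / p) * (dirichlet_eigenvalue V \<Omega> - l) * ?D \<le> 4 * c / p * ?D
      + (2 * c * \<delta> powr (1 / p) + 2 * E * \<delta> powr (1 / p - 1)) * (LINT x|lborel. v x)"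
    using * unfolding B_def by simp
qed

section \<open>Scaled profiles\<close>

lemma csupp_scale:
  assumes "csupp f" "c \<noteq> 0"
  shows "csupp (\<lambda>x. f (c *\<^sub>R x))"
proof -
  obtain R where R: "R > 0" "\<And>x. f x \<noteq> 0 \<Longrightarrow> norm x < R"
    using csupp_radius[OF assms(1)] by metis
  show ?thesis
  proof (rule csuppI[of _ "ball 0 (R / \<bar>c\<bar>)"])
    show "continuous_on UNIV (\<lambda>x. f (c *\<^sub>R x))"
      by (rule continuous_on_compose2[OF csupp_continuous[OF assms(1)], of UNIV "\<lambda>x. c *\<^sub>R x"])
        (auto intro!: continuous_intros)
    show "bounded (ball 0 (R / \<bar>c\<bar>))" by simp
    show "f (c *\<^sub>R x) = 0" if "x \<notin> ball 0 (R / \<bar>c\<bar>)" for x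
      using R(2)[of "c *\<^sub>R x"] that assms(2) by (auto simp: pos_less_divide_eq mult.commute)
  qed
qed

lemma laplacian_scale:
  assumes "Ck_on 2 f UNIV"
  shows "laplacian (\<lambda>x. f (c *\<^sub>R x)) x = c\<^sup>2 * laplacian f (c *\<^sub>R x)"
proof -
  have "partial_deriv b (partial_deriv b (\<lambda>x. f (c *\<^sub>R x))) x = c\<^sup>2 * partial_deriv b (partial_deriv b f) (c *\<^sub>R x)"
    if b: "b \<in> Basis" for b
  proof -
    have f1: "f differentiable (at y)" and f2: "partial_deriv b f differentiable (at y)" for y
      using Ck_on_2D(1)[OF assms] Ck_on_2D(2)[OF assms b] by simp_all
    have "partial_deriv b (\<lambda>x. f (c *\<^sub>R x)) = (\<lambda>x. c * partial_deriv b f (c *\<^sub>R x))"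
      by (rule ext) (rule partial_deriv_scale[OF f1])
    then have "partial_deriv b (partial_deriv b (\<lambda>x. f (c *\<^sub>R x))) x =
        c * partial_deriv b (\<lambda>x. partial_deriv b f (c *\<^sub>R x)) x"
      using partial_deriv_mult[OF differentiable_const differentiable_scale[OF f2]] by simp
    then show ?thesis by (simp add: partial_deriv_scale[OF f2] power2_eq_square)
  qed
  then show ?thesis unfolding laplacian_def by (simp add: sum_distrib_left)
qed

text \<open>Truncating at a lower level increases both factors; this makes the convolution monotone
  in \<open>\<epsilon>\<close>.\<close>

lemma conv_mono:
  assumes "csupp f" "csupp g" "csupp f'" "csupp g'"
    and "\<And>x. 0 \<le> f x" "\<And>x. f x \<le> f' x" "\<And>x. 0 \<le> g x" "\<And>x. g x \<le> g' x"
  shows "conv f g z \<le> conv f' g' z"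
proof (rule has_bochner_integral_mono[OF has_bochner_integral_conv[OF assms(1,2)] has_bochner_integral_conv[OF assms(3,4)]])
  show "f x * g (z - x) \<le> f' x * g' (z - x)" for x
    using assms(5-8) by (meson mult_mono order_trans)
qed

lemma conv_le:
  fixes f g :: "'a::euclidean_space \<Rightarrow> real"
  assumes "csupp f" "csupp g" "\<And>x. f x \<le> A" "\<And>x. 0 \<le> g x" "\<And>x. g x \<le> B" "0 \<le> A"
    and "\<And>x. x \<notin> ball 0 R \<Longrightarrow> f x = 0"
  shows "conv f g z \<le> A * B * measure lborel (ball (0::'a) R)"
proof -
  have "has_bochner_integral lborel (indicator (ball (0::'a) R)) (measure lborel (ball (0::'a) R))"
    using integrable_real_indicator[of "ball (0::'a) R" lborel] emeasure_lborel_ball_finite[of "0::'a" R]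
    by (simp add: has_bochner_integral_iff)
  then have I: "has_bochner_integral lborel (\<lambda>x. A * B * indicator (ball (0::'a) R) x) (A * B * measure lborel (ball (0::'a) R))"
    by (rule has_bochner_integral_mult_right)
  show ?thesis
  proof (rule has_bochner_integral_mono[OF has_bochner_integral_conv[OF assms(1,2)] I])
    show "f x * g (z - x) \<le> A * B * indicator (ball 0 R) x" for x
      using mult_mono[OF assms(3,5) assms(6,4), of x "z - x"] assms(7)[of x]
      by (cases "x \<in> ball 0 R") simp_all
  qed
qed

text \<open>Every point \<open>x\<close> is opposite, as seen from \<open>x0\<close>, to a point
  \<open>y\<close> of a fixed ball on which \<open>f\<close> is at most \<open>M\<close>. Convexity
  along the segment from \<open>y\<close> to \<open>x\<close> through \<open>x0\<close> then bounds
  \<open>f x\<close> from below.\<close>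

lemma convex_on_bounded_below:
  fixes f :: "'a::euclidean_space \<Rightarrow> real"
  assumes "open S" "bounded S" "convex_on S f"
  obtains m where "\<And>x. x \<in> S \<Longrightarrow> m \<le> f x"
proof (cases "S = {}")
  case False
  then obtain x0 where x0: "x0 \<in> S" by blast
  obtain r where r: "r > 0" "cball x0 r \<subseteq> S"
    using assms(1) x0 open_contains_cball by blast
  obtain D where D: "\<And>x. x \<in> S \<Longrightarrow> norm (x - x0) \<le> D"
    using bounded_translation[OF assms(2), of "- x0"] unfolding bounded_iff by (auto simp: image_iff)
  have "continuous_on (cball x0 r) f"
    by (rule continuous_on_subset[OF convex_on_continuous[OF assms(1,3)] r(2)])
  then have "compact (f ` cball x0 r)" by (intro compact_continuous_image compact_cball)
  then have "bounded (f ` cball x0 r)" by (rule compact_imp_bounded)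
  then obtain M where "\<forall>y\<in>f ` cball x0 r. norm y \<le> M" unfolding bounded_iff by blast
  then have M: "f y \<le> M" if "y \<in> cball x0 r" for y
  proof -
    have "norm (f y) \<le> M" using that \<open>\<forall>y\<in>f ` cball x0 r. norm y \<le> M\<close> by blast
    then show ?thesis by simp
  qed
  \<comment> \<open>Shrinking by \<open>s\<close> brings the reflection of every point of
    \<open>S\<close> into the ball of radius \<open>r\<close>; \<open>\<bar>D\<bar> + 1\<close>
    keeps the denominator positive.\<close>
  define s where "s = r / (\<bar>D\<bar> + 1)"
  have s: "0 < s" using r(1) by (simp add: s_def)
  have "((1 + s) * f x0 - M) / s \<le> f x" if x: "x \<in> S" for x
  proof -
    define y where "y = x0 - s *\<^sub>R (x - x0)"
    have "s * norm (x - x0) \<le> s * (\<bar>D\<bar> + 1)"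
      using D[OF x] s by (intro mult_left_mono) auto
    also have "\<dots> = r" by (simp add: s_def)
    finally have y: "y \<in> cball x0 r" using s by (simp add: y_def dist_norm)
    have "x0 = (1 - s / (1 + s)) *\<^sub>R y + (s / (1 + s)) *\<^sub>R x"
    proof -
      have "(1 + s) *\<^sub>R x0 = y + s *\<^sub>R x" by (simp add: y_def algebra_simps)
      then have "(1 / (1 + s)) *\<^sub>R ((1 + s) *\<^sub>R x0) = (1 / (1 + s)) *\<^sub>R (y + s *\<^sub>R x)" by simp
      moreover have "1 - s / (1 + s) = 1 / (1 + s)" using s by (simp add: field_simps)
      ultimately show ?thesis using s by (simp add: scaleR_add_right)
    qed
    then have "f x0 \<le> (1 - s / (1 + s)) * f y + s / (1 + s) * f x"
      using convex_onD[OF assms(3), of "s / (1 + s)" y x] s r(2) y x by auto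
    then have "(1 + s) * f x0 \<le> (1 + s) * ((1 - s / (1 + s)) * f y + s / (1 + s) * f x)"
      using s by (intro mult_left_mono) auto
    also have "\<dots> = f y + s * f x"
    proof -
      have "1 - s / (1 + s) = 1 / (1 + s)" using s by (simp add: field_simps)
      then show ?thesis using s by (simp add: distrib_left)
    qed
    finally have "(1 + s) * f x0 - M \<le> f x * s" using M[OF y] by (simp add: mult.commute)
    then show ?thesis using s by (simp add: pos_divide_le_eq)
  qed
  then show ?thesis by (rule that)
qed (use that in auto)

section \<open>Minkowski combinations and rescaled truncations\<close>

lemma minkowski_combination_eq:
  "minkowski_combination t A B = (\<Union>x\<in>(*\<^sub>R) (1 - t) ` A. \<Union>y\<in>(*\<^sub>R) t ` B. {x + y})"
  unfolding minkowski_combination_def by blast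

lemma minkowski_combination_subset_hull:
  assumes "0 \<le> t" "t \<le> 1"
  shows "minkowski_combination t A B \<subseteq> convex hull (A \<union> B)"
proof
  fix z assume "z \<in> minkowski_combination t A B"
  then obtain x y where z: "z = (1 - t) *\<^sub>R x + t *\<^sub>R y" "x \<in> A" "y \<in> B"
    unfolding minkowski_combination_def by blast
  then have "x \<in> convex hull (A \<union> B)" "y \<in> convex hull (A \<union> B)"
    by (auto intro: hull_inc)
  then show "z \<in> convex hull (A \<union> B)"
    unfolding z(1) using assms by (intro convexD[OF convex_convex_hull]) auto
qed

lemma
  fixes A B :: "'a::euclidean_space set"
  assumes "open A" "bounded A" "bounded B" "0 \<le> t" "t < 1"
  shows open_minkowski_combination: "open (minkowski_combination t A B)"
    and bounded_minkowski_combination: "bounded (minkowski_combination t A B)"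
proof -
  have "open ((*\<^sub>R) (1 - t) ` A)" using assms(1,5) by (intro open_scaling) auto
  then show "open (minkowski_combination t A B)"
    unfolding minkowski_combination_eq by (intro open_sums) simp
  show "bounded (minkowski_combination t A B)"
    unfolding minkowski_combination_eq by (intro bounded_sums bounded_scaling assms)
qed

text \<open>The scaling \<open>x \<mapsto> x / a\<close> turns the convolution of two profiles into an integral over
  \<open>a \<Omega>\<^sub>0 + t \<Omega>\<^sub>1\<close>.\<close>

definition profile :: "'a::euclidean_space set \<Rightarrow> ('a \<Rightarrow> real) \<Rightarrow> real \<Rightarrow> real \<Rightarrow> real \<Rightarrow> 'a \<Rightarrow> real" where
  "profile \<Omega> u a \<epsilon> q x = trunc \<Omega> u \<epsilon> ((1 / a) *\<^sub>R x) powr q"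

lemma profile_nonneg: "0 \<le> profile \<Omega> u a \<epsilon> q x"
  by (simp add: profile_def)

lemma profile_antimono:
  assumes "\<epsilon> \<le> \<epsilon>'" "0 \<le> q"
  shows "profile \<Omega> u a \<epsilon>' q x \<le> profile \<Omega> u a \<epsilon> q x"
  unfolding profile_def using assms by (intro powr_mono2) (auto simp: trunc_def)

lemma profile_le:
  assumes "\<And>x. x \<in> \<Omega> \<Longrightarrow> u x \<le> M" "0 \<le> M" "0 < \<epsilon>" "0 \<le> q"
  shows "profile \<Omega> u a \<epsilon> q x \<le> M powr q"
  unfolding profile_def using assms(1)[of "(1 / a) *\<^sub>R x"] assms(2-4)
  by (intro powr_mono2) (auto simp: trunc_def)

lemma profile_outside: "(1 / a) *\<^sub>R x \<notin> \<Omega> \<Longrightarrow> profile \<Omega> u a \<epsilon> q x = 0"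
  by (simp add: profile_def trunc_def)

text \<open>The scaling by \<open>1 / a\<close> cancels the \<open>a\<close> in the exponent
  \<open>a * p\<close>: both profiles get the same factor \<open>p\<close> in their gradients, and
  the Laplacian gets \<open>(1 / a)^2 * (a * p) = p / a\<close>.\<close>

lemma
  fixes \<Omega> :: "'a::euclidean_space set"
  assumes \<Omega>: "open \<Omega>" "bounded \<Omega>" "continuous_on (closure \<Omega>) u" "\<And>x. x \<in> frontier \<Omega> \<Longrightarrow> u x = 0"
    and \<epsilon>: "0 < \<epsilon>" and a: "0 < a"
  shows csupp_profile: "0 < q \<Longrightarrow> Ck_on 2 u \<Omega> \<Longrightarrow> csupp (profile \<Omega> u a \<epsilon> q)"
    and Ck_on_profile: "Ck_on 2 u \<Omega> \<Longrightarrow> 2 < q \<Longrightarrow> Ck_on 2 (profile \<Omega> u a \<epsilon> q) UNIV"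
    and partial_deriv_profile: "Ck_on 2 u \<Omega> \<Longrightarrow> 2 < a * p \<Longrightarrow> b \<in> Basis \<Longrightarrow>
      partial_deriv b (profile \<Omega> u a \<epsilon> (a * p)) x =
      p * (profile \<Omega> u a \<epsilon> (a * p) x * (partial_deriv b u ((1 / a) *\<^sub>R x) / trunc \<Omega> u \<epsilon> ((1 / a) *\<^sub>R x)))"
    and laplacian_profile_ge: "Ck_on 2 u \<Omega> \<Longrightarrow> 2 < a * p \<Longrightarrow>
      (\<And>x. x \<in> \<Omega> \<Longrightarrow> laplacian u x = v x * u x) \<Longrightarrow> (\<And>x. x \<in> \<Omega> \<Longrightarrow> - c \<le> v x) \<Longrightarrow>
      p / a * (profile \<Omega> u a \<epsilon> (a * p) x * ((a * p - 1) *
        (\<Sum>b\<in>Basis. (partial_deriv b u ((1 / a) *\<^sub>R x) / trunc \<Omega> u \<epsilon> ((1 / a) *\<^sub>R x))\<^sup>2) + v ((1 / a) *\<^sub>R x))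
        - c * \<epsilon> * profile \<Omega> u a \<epsilon> (a * p - 1) x)
      \<le> laplacian (profile \<Omega> u a \<epsilon> (a * p)) x"
proof -
  let ?f = "\<lambda>q x. trunc \<Omega> u \<epsilon> x powr q"
  have eq: "profile \<Omega> u a \<epsilon> q = (\<lambda>x. ?f q ((1 / a) *\<^sub>R x))" for q
    by (rule ext) (simp add: profile_def)
  show "csupp (profile \<Omega> u a \<epsilon> q)" if "0 < q" "Ck_on 2 u \<Omega>" for q
  proof -
    have U: "csupp (trunc \<Omega> u \<epsilon>)"
      by (rule csupp_in_csupp[OF csupp_in_trunc[OF \<Omega> \<epsilon> that(2), where q = "3 :: real"]]) simp_all
    have "csupp (?f q)"
      using that(1) trunc_nonneg[of \<Omega> u \<epsilon>]
      by (intro csupp_subset[OF U] continuous_on_powr' csupp_continuous[OF U] continuous_on_const) auto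
    then show ?thesis unfolding eq using a by (intro csupp_scale) auto
  qed
  show Ck: "Ck_on 2 (profile \<Omega> u a \<epsilon> q) UNIV" if "Ck_on 2 u \<Omega>" "2 < q" for q
    unfolding eq by (intro Ck_on_scale Ck_on_trunc_powr[OF \<Omega> \<epsilon> that])
  assume u: "Ck_on 2 u \<Omega>" and p: "2 < a * p"
  have f2: "Ck_on 2 (?f (a * p)) UNIV" by (rule Ck_on_trunc_powr[OF \<Omega> \<epsilon> u p])
  have fd: "?f (a * p) differentiable (at y)" for y using Ck_on_2D(1)[OF f2] by simp
  show "partial_deriv b (profile \<Omega> u a \<epsilon> (a * p)) x =
      p * (profile \<Omega> u a \<epsilon> (a * p) x * (partial_deriv b u ((1 / a) *\<^sub>R x) / trunc \<Omega> u \<epsilon> ((1 / a) *\<^sub>R x)))"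
    if b: "b \<in> Basis"
  proof -
    have "partial_deriv b (profile \<Omega> u a \<epsilon> (a * p)) x = 1 / a * partial_deriv b (?f (a * p)) ((1 / a) *\<^sub>R x)"
      unfolding eq by (rule partial_deriv_scale[OF fd])
    also have "partial_deriv b (?f (a * p)) ((1 / a) *\<^sub>R x) = a * p * (?f (a * p) ((1 / a) *\<^sub>R x) *
        (partial_deriv b u ((1 / a) *\<^sub>R x) / trunc \<Omega> u \<epsilon> ((1 / a) *\<^sub>R x)))"
      by (rule partial_deriv_trunc_powr'[OF \<Omega> \<epsilon> u p b])
    finally show ?thesis using a unfolding eq by simp
  qed
  assume pde: "\<And>x. x \<in> \<Omega> \<Longrightarrow> laplacian u x = v x * u x" and v: "\<And>x. x \<in> \<Omega> \<Longrightarrow> - c \<le> v x"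
  let ?y = "(1 / a) *\<^sub>R x"
  have "p / a * (?f (a * p) ?y * ((a * p - 1) * (\<Sum>b\<in>Basis. (partial_deriv b u ?y / trunc \<Omega> u \<epsilon> ?y)\<^sup>2) + v ?y)
        - c * \<epsilon> * ?f (a * p - 1) ?y) =
      (1 / a)\<^sup>2 * (a * p * (?f (a * p) ?y * ((a * p - 1) * (\<Sum>b\<in>Basis. (partial_deriv b u ?y / trunc \<Omega> u \<epsilon> ?y)\<^sup>2) + v ?y)
        - c * \<epsilon> * ?f (a * p - 1) ?y))"
    using a by (simp add: power2_eq_square)
  also have "\<dots> \<le> (1 / a)\<^sup>2 * laplacian (?f (a * p)) ?y"
    by (intro mult_left_mono laplacian_trunc_powr_ge[OF \<Omega> \<epsilon> u p] pde v) auto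
  also have "\<dots> = laplacian (profile \<Omega> u a \<epsilon> (a * p)) x"
    unfolding eq by (rule laplacian_scale[OF f2, symmetric])
  finally show "p / a * (profile \<Omega> u a \<epsilon> (a * p) x * ((a * p - 1) *
        (\<Sum>b\<in>Basis. (partial_deriv b u ?y / trunc \<Omega> u \<epsilon> ?y)\<^sup>2) + v ?y)
        - c * \<epsilon> * profile \<Omega> u a \<epsilon> (a * p - 1) x)
      \<le> laplacian (profile \<Omega> u a \<epsilon> (a * p)) x"
    unfolding profile_def .
qed

section \<open>The eigenvalue of a Minkowski combination\<close>

lemma eigenfunctionD:
  assumes "bounded_domain \<Omega>" "first_dirichlet_eigenfunction V \<Omega> u"
  shows "open \<Omega>" "bounded \<Omega>" "continuous_on (closure \<Omega>) u" "\<And>x. x \<in> frontier \<Omega> \<Longrightarrow> u x = 0"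
    and "Ck_on 2 u \<Omega>" "\<And>x. x \<in> \<Omega> \<Longrightarrow> 0 < u x"
    and "\<And>x. x \<in> \<Omega> \<Longrightarrow> laplacian u x = (V x - dirichlet_eigenvalue V \<Omega>) * u x"
proof -
  note e = assms(2)[unfolded first_dirichlet_eigenfunction_def]
  show "open \<Omega>" "bounded \<Omega>" using assms(1) by (simp_all add: bounded_domain_def)
  show "continuous_on (closure \<Omega>) u" "Ck_on 2 u \<Omega>" using e by blast+
  show "u x = 0" if "x \<in> frontier \<Omega>" for x using e that by blast
  show "0 < u x" if "x \<in> \<Omega>" for x using e that by blast
  show "laplacian u x = (V x - dirichlet_eigenvalue V \<Omega>) * u x" if "x \<in> \<Omega>" for x
  proof -
    have "- laplacian u x + V x * u x = dirichlet_eigenvalue V \<Omega> * u x" using e that by blast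
    then show ?thesis by (simp add: algebra_simps)
  qed
qed

lemma continuous_on_closure_bounded_above:
  fixes u :: "'a::euclidean_space \<Rightarrow> real"
  assumes "bounded \<Omega>" "continuous_on (closure \<Omega>) u"
  obtains M where "0 \<le> M" "\<And>x. x \<in> \<Omega> \<Longrightarrow> u x \<le> M"
proof -
  have "compact (u ` closure \<Omega>)"
    using assms by (intro compact_continuous_image) (simp_all add: compact_closure)
  then have "bounded (u ` closure \<Omega>)" by (rule compact_imp_bounded)
  then obtain M where M: "\<forall>y\<in>u ` closure \<Omega>. norm y \<le> M" unfolding bounded_iff by blast
  have "u x \<le> \<bar>M\<bar>" if "x \<in> \<Omega>" for x
  proof -
    have "norm (u x) \<le> M" using M that closure_subset by blast
    then show ?thesis by simp
  qed
  then show ?thesis using that[of "\<bar>M\<bar>"] by simp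
qed

text \<open>If the integrand is non-zero at \<open>x\<close>, then \<open>x / (1 - t)\<close> lies
  in a compact \<open>K\<close> inside the first domain and \<open>(z - x) / t\<close> in a compact
  \<open>L\<close> inside the second, so \<open>z\<close> lies in the compact set
  \<open>(1 - t) K + t L\<close>.\<close>

lemma csupp_in_conv_profile:
  fixes \<Omega>0 \<Omega>1 :: "'a::euclidean_space set"
  assumes 0: "open \<Omega>0" "bounded \<Omega>0" "continuous_on (closure \<Omega>0) u0" "\<And>x. x \<in> frontier \<Omega>0 \<Longrightarrow> u0 x = 0" "Ck_on 2 u0 \<Omega>0"
    and 1: "open \<Omega>1" "bounded \<Omega>1" "continuous_on (closure \<Omega>1) u1" "\<And>x. x \<in> frontier \<Omega>1 \<Longrightarrow> u1 x = 0" "Ck_on 2 u1 \<Omega>1"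
    and "0 < \<epsilon>" "0 < t" "t < 1" "0 < q" "0 < q'"
  shows "csupp_in (minkowski_combination t \<Omega>0 \<Omega>1) (conv (profile \<Omega>0 u0 (1 - t) \<epsilon> q) (profile \<Omega>1 u1 t \<epsilon> q'))"
proof -
  obtain K where K: "compact K" "K \<subseteq> \<Omega>0" "\<forall>x. x \<notin> K \<longrightarrow> trunc \<Omega>0 u0 \<epsilon> x = 0"
    by (rule trunc_support[OF 0(1-4) assms(11)])
  obtain L where L: "compact L" "L \<subseteq> \<Omega>1" "\<forall>x. x \<notin> L \<longrightarrow> trunc \<Omega>1 u1 \<epsilon> x = 0"
    by (rule trunc_support[OF 1(1-4) assms(11)])
  let ?h0 = "profile \<Omega>0 u0 (1 - t) \<epsilon> q" and ?h1 = "profile \<Omega>1 u1 t \<epsilon> q'"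
  let ?S = "{x + y |x y. x \<in> (*\<^sub>R) (1 - t) ` K \<and> y \<in> (*\<^sub>R) t ` L}"
  have "csupp ?h0" by (rule csupp_profile[OF 0(1-4) assms(11) _ assms(14) 0(5)]) (use assms(13) in simp_all)
  moreover have "csupp ?h1" by (rule csupp_profile[OF 1(1-4) assms(11,12,15) 1(5)])
  ultimately have "continuous_on UNIV (conv ?h0 ?h1)" by (rule continuous_on_conv)
  moreover have "compact ?S" by (intro compact_sums compact_scaling K(1) L(1))
  moreover have "?S \<subseteq> minkowski_combination t \<Omega>0 \<Omega>1"
    unfolding minkowski_combination_def using K(2) L(2) by blast
  moreover have "conv ?h0 ?h1 z = 0" if z: "z \<notin> ?S" for z
  proof (rule ccontr)
    assume "conv ?h0 ?h1 z \<noteq> 0"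
    then obtain x where x: "?h0 x \<noteq> 0" "?h1 (z - x) \<noteq> 0" by (rule conv_support)
    then have "(1 / (1 - t)) *\<^sub>R x \<in> K" "(1 / t) *\<^sub>R (z - x) \<in> L"
      using K(3) L(3) unfolding profile_def by fastforce+
    moreover have "x = (1 - t) *\<^sub>R ((1 / (1 - t)) *\<^sub>R x)" "z - x = t *\<^sub>R ((1 / t) *\<^sub>R (z - x))"
      using assms(12,13) by simp_all
    ultimately have "x \<in> (*\<^sub>R) (1 - t) ` K" "z - x \<in> (*\<^sub>R) t ` L" by (metis imageI)+
    moreover have "z = x + (z - x)" by simp
    ultimately have "z \<in> ?S" by blast
    then show False using z by blast
  qed
  ultimately show ?thesis unfolding csupp_in_def by blast
qed

text \<open>The error terms are linear in the trial function while the eigenvalue estimate is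
  quadratic; \<open>v \<le> 1 + v^2\<close> on a bounded set links the two.\<close>

lemma csupp_in_integral_le:
  assumes "csupp_in \<Omega> v" "\<Omega> \<subseteq> ball (0::'a::euclidean_space) R"
  shows "(LINT x|lborel. v x) \<le> measure lborel (ball (0::'a) R) + (LINT x|lborel. (v x)\<^sup>2)"
proof (rule has_bochner_integral_mono)
  show "has_bochner_integral lborel v (LINT x|lborel. v x)"
    by (intro has_bochner_integral_integrable csupp_integrable csupp_in_csupp[OF assms(1)])
  have "has_bochner_integral lborel (indicator (ball (0::'a) R)) (measure lborel (ball (0::'a) R))"
    using integrable_real_indicator[of "ball (0::'a) R" lborel] emeasure_lborel_ball_finite[of "0::'a" R]
    by (simp add: has_bochner_integral_iff)
  then show "has_bochner_integral lborel (\<lambda>x. indicator (ball (0::'a) R) x + (v x)\<^sup>2)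
      (measure lborel (ball (0::'a) R) + (LINT x|lborel. (v x)\<^sup>2))"
    by (intro has_bochner_integral_add has_bochner_integral_integrable csupp_integrable
        csupp_in_csupp[OF csupp_in_power2[OF assms(1)]])
  show "v x \<le> indicator (ball 0 R) x + (v x)\<^sup>2" for x
  proof (cases "x \<in> \<Omega>")
    case True
    have "2 * v x \<le> 1 + (v x)\<^sup>2" using zero_le_power2[of "v x - 1"] by (simp add: power2_eq_square algebra_simps)
    moreover have "0 \<le> 1 + (v x)\<^sup>2" by simp
    ultimately have "v x \<le> 1 + (v x)\<^sup>2" by linarith
    then show ?thesis using True assms(2) by (auto simp: indicator_def)
  next
    case False
    then show ?thesis using csupp_in_outside[OF assms(1)] by simp
  qed
qed

text \<open>With \<open>p\<close> and the tolerance \<open>\<beta>\<close> fixed, the order of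
  choices matters. First a lower bound \<open>s0\<close> for the integral of \<open>v^2\<close>
  valid for all small parameters, then \<open>\<delta>\<close>, and last \<open>\<epsilon>\<close>,
  whose error carries the large factor \<open>\<delta> powr (1 / p - 1)\<close>.\<close>

lemma eigenvalue_minkowski_bound:
  fixes \<Omega>0 \<Omega>1 :: "'a::euclidean_space set" and V u0 u1 :: "'a \<Rightarrow> real"
  defines "\<Omega> t \<equiv> minkowski_combination t \<Omega>0 \<Omega>1"
    and "l t \<equiv> (1 - t) * dirichlet_eigenvalue V \<Omega>0 + t * dirichlet_eigenvalue V \<Omega>1"
  assumes d0: "bounded_domain \<Omega>0" and d1: "bounded_domain \<Omega>1"
    and V: "convex_on (convex hull (\<Omega>0 \<union> \<Omega>1)) V"
    and e0: "first_dirichlet_eigenfunction V \<Omega>0 u0" and e1: "first_dirichlet_eigenfunction V \<Omega>1 u1"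
    and t: "0 < t" "t < 1" and p: "2 + 2 / ((1 - t) * t) \<le> p" and c0: "0 \<le> c"
    and c: "\<And>x. x \<in> \<Omega>0 \<Longrightarrow> - c \<le> V x - dirichlet_eigenvalue V \<Omega>0"
      "\<And>x. x \<in> \<Omega>1 \<Longrightarrow> - c \<le> V x - dirichlet_eigenvalue V \<Omega>1"
      "\<And>x. x \<in> \<Omega> t \<Longrightarrow> - c \<le> V x - l t"
  shows "(1 - 2 / p) * (dirichlet_eigenvalue V (\<Omega> t) - l t) \<le> 4 * c / p"
proof (rule field_le_epsilon)
  fix \<beta> :: real assume \<beta>: "0 < \<beta>"
  define a where "a = 1 - t"
  have a: "0 < a" "a < 1" using t by (simp_all add: a_def)
  note E0 = eigenfunctionD[OF d0 e0] and E1 = eigenfunctionD[OF d1 e1]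
  let ?H = "convex hull (\<Omega>0 \<union> \<Omega>1)"
  have \<Omega>: "open (\<Omega> t)" "bounded (\<Omega> t)" "\<Omega> t \<subseteq> ?H"
    unfolding \<Omega>_def using open_minkowski_combination[OF E0(1,2) E1(2)]
      bounded_minkowski_combination[OF E0(1,2) E1(2)] minkowski_combination_subset_hull[of t \<Omega>0 \<Omega>1] t by auto
  have "open ?H" using E0(1) E1(1) by (intro open_convex_hull open_Un)
  then have contV: "continuous_on (\<Omega> t) V"
    using V \<Omega>(3) by (intro continuous_on_subset[OF convex_on_continuous])
  \<comment> \<open>Exponents above 2 are what the smoothness of the profiles takes; both follow
    from \<open>2 / (a * t) < p\<close>, as \<open>a\<close> and \<open>t\<close> are below
    1.\<close>
  have q: "2 < a * p" "2 < t * p" "2 < p"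
  proof -
    have "2 / (a * t) < p" using p by (simp add: a_def)
    then have "2 < p * (a * t)" using a t by (simp add: pos_divide_less_eq)
    moreover have "2 < p"
    proof -
      have "0 < 2 / ((1 - t) * t)" using t by simp
      then show ?thesis using p by linarith
    qed
    moreover from this have "p * (a * t) \<le> a * p" "p * (a * t) \<le> t * p"
      using a t by (auto simp: mult.commute mult.left_commute mult_le_cancel_left1 mult_le_cancel_left2 intro!: mult_left_le)
    ultimately show "2 < a * p" "2 < t * p" "2 < p" by linarith+
  qed
  define h0 where "h0 \<epsilon> = profile \<Omega>0 u0 a \<epsilon> (a * p)" for \<epsilon>
  define h1 where "h1 \<epsilon> = profile \<Omega>1 u1 t \<epsilon> (t * p)" for \<epsilon>
  define k0 where "k0 \<epsilon> = profile \<Omega>0 u0 a \<epsilon> (a * p - 1)" for \<epsilon>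
  define k1 where "k1 \<epsilon> = profile \<Omega>1 u1 t \<epsilon> (t * p - 1)" for \<epsilon>
  define W where "W \<epsilon> = conv (h0 \<epsilon>) (h1 \<epsilon>)" for \<epsilon>
  have cs: "csupp (h0 \<epsilon>)" "csupp (h1 \<epsilon>)" "csupp (k0 \<epsilon>)" "csupp (k1 \<epsilon>)" if "0 < \<epsilon>" for \<epsilon>
    unfolding h0_def h1_def k0_def k1_def
    using q a t that by (auto intro!: csupp_profile E0 E1)
  have nn: "0 \<le> h0 \<epsilon> x" "0 \<le> h1 \<epsilon> x" "0 \<le> k0 \<epsilon> x" "0 \<le> k1 \<epsilon> x" for \<epsilon> x
    by (simp_all add: h0_def h1_def k0_def k1_def profile_nonneg)
  have W0: "0 \<le> W \<epsilon> z" for \<epsilon> z unfolding W_def by (intro conv_nonneg nn)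
  have WC: "Ck_on 2 (W \<epsilon>) UNIV" if "0 < \<epsilon>" for \<epsilon>
    unfolding W_def using Ck_on_profile[OF E1(1-4) that t(1) E1(5) q(2)]
    by (intro Ck_on_conv cs that) (simp_all add: h1_def)
  have Ws: "csupp_in (\<Omega> t) (W \<epsilon>)" if "0 < \<epsilon>" for \<epsilon>
    unfolding \<Omega>_def W_def h0_def h1_def a_def
    by (rule csupp_in_conv_profile[OF E0(1-5) E1(1-5) that t]) (use q in \<open>simp_all add: a_def\<close>)
  obtain M0 where M0: "0 \<le> M0" "\<And>x. x \<in> \<Omega>0 \<Longrightarrow> u0 x \<le> M0"
    by (rule continuous_on_closure_bounded_above[OF E0(2,3)]) blast
  obtain M1 where M1: "0 \<le> M1" "\<And>x. x \<in> \<Omega>1 \<Longrightarrow> u1 x \<le> M1"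
    by (rule continuous_on_closure_bounded_above[OF E1(2,3)]) blast
  obtain R where R: "\<Omega>0 \<union> \<Omega> t \<subseteq> ball 0 R" "0 < R"
    using bounded_subset_ballD[of "\<Omega>0 \<union> \<Omega> t" 0] E0(2) \<Omega>(2) by auto
  define \<mu> where "\<mu> = measure lborel (ball (0::'a) R)"
  have \<mu>: "0 \<le> \<mu>" by (simp add: \<mu>_def)
  have out: "h0 \<epsilon> x = 0" "k0 \<epsilon> x = 0" if "x \<notin> ball 0 R" for \<epsilon> x
  proof -
    have "(1 / a) *\<^sub>R x \<notin> \<Omega>0"
    proof
      assume "(1 / a) *\<^sub>R x \<in> \<Omega>0"
      then have "norm ((1 / a) *\<^sub>R x) < R" using R(1) by auto
      then have "norm x < R * a" using a by (simp add: pos_divide_less_eq)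
      moreover have "R * a \<le> R" using a R(2) by (simp add: mult_left_le)
      ultimately show False using that by simp
    qed
    then show "h0 \<epsilon> x = 0" "k0 \<epsilon> x = 0" unfolding h0_def k0_def by (simp_all add: profile_outside)
  qed
  \<comment> \<open>Bounds the error convolutions for all \<open>\<epsilon>\<close> and
    \<open>z\<close> at once, so that \<open>c * \<epsilon> * C\<close> tends to 0 with
    \<open>\<epsilon>\<close>.\<close>
  define C where "C = a * (M0 powr (a * p - 1) * M1 powr (t * p) * \<mu>) + t * (M0 powr (a * p) * M1 powr (t * p - 1) * \<mu>)"
  have C0: "0 \<le> C" using a t \<mu> by (simp add: C_def)
  have C: "a * conv (k0 \<epsilon>) (h1 \<epsilon>) z + t * conv (h0 \<epsilon>) (k1 \<epsilon>) z \<le> C" if "0 < \<epsilon>" for \<epsilon> z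
  proof -
    have "conv (k0 \<epsilon>) (h1 \<epsilon>) z \<le> M0 powr (a * p - 1) * M1 powr (t * p) * \<mu>"
      unfolding \<mu>_def using q M0 M1 that
      by (intro conv_le cs nn out that) (simp_all add: k0_def h1_def profile_le)
    moreover have "conv (h0 \<epsilon>) (k1 \<epsilon>) z \<le> M0 powr (a * p) * M1 powr (t * p - 1) * \<mu>"
      unfolding \<mu>_def using q M0 M1 that
      by (intro conv_le cs nn out that) (simp_all add: h0_def k1_def profile_le)
    ultimately show ?thesis
      unfolding C_def using a t by (intro add_mono mult_left_mono) auto
  qed
  have ineq: "(p + 2) * (V z - l t) * W \<epsilon> z
      + (p\<^sup>2 - p - 2) * (\<Sum>b\<in>Basis. 2 / p * \<xi> b * partial_deriv b (W \<epsilon>) z - (\<xi> b)\<^sup>2 * W \<epsilon> z) - (p + 2) * (c * \<epsilon> * C)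
      \<le> laplacian (W \<epsilon>) z" if \<epsilon>: "0 < \<epsilon>" and z: "z \<in> \<Omega> t" for \<epsilon> z \<xi>
  proof -
    let ?w0 = "\<lambda>x. V ((1 / a) *\<^sub>R x) - dirichlet_eigenvalue V \<Omega>0"
    let ?w1 = "\<lambda>x. V ((1 / t) *\<^sub>R x) - dirichlet_eigenvalue V \<Omega>1"
    have w: "V z - l t \<le> a * ?w0 x + t * ?w1 (z - x)" if "h0 \<epsilon> x \<noteq> 0" "h1 \<epsilon> (z - x) \<noteq> 0" for x
    proof -
      let ?x = "(1 / a) *\<^sub>R x" and ?y = "(1 / t) *\<^sub>R (z - x)"
      have "?x \<in> \<Omega>0" "?y \<in> \<Omega>1"
        using that profile_outside unfolding h0_def h1_def by blast+
      then have "?x \<in> ?H" "?y \<in> ?H" by (auto intro: hull_inc)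
      then have "V ((1 - t) *\<^sub>R ?x + t *\<^sub>R ?y) \<le> (1 - t) * V ?x + t * V ?y"
        using t by (intro convex_onD[OF V]) auto
      moreover have "(1 - t) *\<^sub>R ?x + t *\<^sub>R ?y = z" using a t unfolding a_def[symmetric] by simp
      ultimately show ?thesis by (simp add: l_def a_def algebra_simps)
    qed
    have "(p + 2) * (V z - l t) * W \<epsilon> z
      + (p\<^sup>2 - p - 2) * (\<Sum>b\<in>Basis. 2 / p * \<xi> b * partial_deriv b (W \<epsilon>) z - (\<xi> b)\<^sup>2 * W \<epsilon> z)
      - (p + 2) * (c * \<epsilon>) * (a * conv (k0 \<epsilon>) (h1 \<epsilon>) z + t * conv (h0 \<epsilon>) (k1 \<epsilon>) z)
      \<le> laplacian (W \<epsilon>) z"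
      unfolding W_def
    proof (rule laplacian_conv_ge[where ?g0.0 = "\<lambda>b x. partial_deriv b u0 ((1 / a) *\<^sub>R x) / trunc \<Omega>0 u0 \<epsilon> ((1 / a) *\<^sub>R x)"
          and ?g1.0 = "\<lambda>b x. partial_deriv b u1 ((1 / t) *\<^sub>R x) / trunc \<Omega>1 u1 \<epsilon> ((1 / t) *\<^sub>R x)"
          and ?w0.0 = ?w0 and ?w1.0 = ?w1])
      show "0 < t" "t < 1" "a = 1 - t" "2 + 2 / (a * t) \<le> p"
        using t p by (simp_all add: a_def)
      show "csupp (h0 \<epsilon>)" "csupp (h1 \<epsilon>)" "csupp (k0 \<epsilon>)" "csupp (k1 \<epsilon>)"
        by (rule cs[OF \<epsilon>])+
      show "0 \<le> h0 \<epsilon> x" "0 \<le> h1 \<epsilon> x" for x by (rule nn)+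
      show "V z - l t \<le> a * ?w0 x + t * ?w1 (z - x)" if "h0 \<epsilon> x \<noteq> 0" "h1 \<epsilon> (z - x) \<noteq> 0" for x
        by (rule w[OF that])
      show "Ck_on 2 (h0 \<epsilon>) UNIV" "Ck_on 2 (h1 \<epsilon>) UNIV"
        using Ck_on_profile[OF E0(1-4) \<epsilon> a(1) E0(5) q(1)] Ck_on_profile[OF E1(1-4) \<epsilon> t(1) E1(5) q(2)]
        by (simp_all add: h0_def h1_def)
      show "partial_deriv b (h0 \<epsilon>) x = p * (h0 \<epsilon> x * (partial_deriv b u0 ((1 / a) *\<^sub>R x) / trunc \<Omega>0 u0 \<epsilon> ((1 / a) *\<^sub>R x)))"
        if "b \<in> Basis" for b x
        unfolding h0_def by (rule partial_deriv_profile[OF E0(1-4) \<epsilon> a(1) E0(5) q(1) that])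
      show "partial_deriv b (h1 \<epsilon>) x = p * (h1 \<epsilon> x * (partial_deriv b u1 ((1 / t) *\<^sub>R x) / trunc \<Omega>1 u1 \<epsilon> ((1 / t) *\<^sub>R x)))"
        if "b \<in> Basis" for b x
        unfolding h1_def by (rule partial_deriv_profile[OF E1(1-4) \<epsilon> t(1) E1(5) q(2) that])
      show "p / a * (h0 \<epsilon> x * ((a * p - 1) * (\<Sum>b\<in>Basis. (partial_deriv b u0 ((1 / a) *\<^sub>R x) / trunc \<Omega>0 u0 \<epsilon> ((1 / a) *\<^sub>R x))\<^sup>2)
          + ?w0 x) - c * \<epsilon> * k0 \<epsilon> x) \<le> laplacian (h0 \<epsilon>) x" for x
        unfolding h0_def k0_def
        by (rule laplacian_profile_ge[OF E0(1-4) \<epsilon> a(1) E0(5) q(1), where v = "\<lambda>x. V x - dirichlet_eigenvalue V \<Omega>0"])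
          (use E0(7) c(1) in auto)
      show "p / t * (h1 \<epsilon> x * ((t * p - 1) * (\<Sum>b\<in>Basis. (partial_deriv b u1 ((1 / t) *\<^sub>R x) / trunc \<Omega>1 u1 \<epsilon> ((1 / t) *\<^sub>R x))\<^sup>2)
          + ?w1 x) - c * \<epsilon> * k1 \<epsilon> x) \<le> laplacian (h1 \<epsilon>) x" for x
        unfolding h1_def k1_def
        by (rule laplacian_profile_ge[OF E1(1-4) \<epsilon> t(1) E1(5) q(2), where v = "\<lambda>x. V x - dirichlet_eigenvalue V \<Omega>1"])
          (use E1(7) c(2) in auto)
    qed
    moreover have "(p + 2) * (c * \<epsilon>) * (a * conv (k0 \<epsilon>) (h1 \<epsilon>) z + t * conv (h0 \<epsilon>) (k1 \<epsilon>) z) \<le> (p + 2) * (c * \<epsilon>) * C"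
      using C[OF \<epsilon>] q(3) c0 \<epsilon> by (intro mult_left_mono) auto
    ultimately show ?thesis by simp
  qed
  obtain x0 y0 where x0: "x0 \<in> \<Omega>0" and y0: "y0 \<in> \<Omega>1"
    using d0 d1 unfolding bounded_domain_def by blast
  \<comment> \<open>At this level both truncations are still positive at \<open>x0\<close> and
    \<open>y0\<close>, which makes the convolution positive at \<open>z0\<close>.\<close>
  define \<epsilon>0 where "\<epsilon>0 = min (u0 x0) (u1 y0) / 2"
  have \<epsilon>0: "0 < \<epsilon>0" "\<epsilon>0 < u0 x0" "\<epsilon>0 < u1 y0"
    using E0(6)[OF x0] E1(6)[OF y0] by (auto simp: \<epsilon>0_def min_def)
  define z0 where "z0 = a *\<^sub>R x0 + t *\<^sub>R y0"
  have Wz0: "0 < W \<epsilon>0 z0"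
    unfolding W_def conv_def
  proof (rule csupp_integral_pos[where a = "a *\<^sub>R x0"])
    show "csupp (\<lambda>x. h0 \<epsilon>0 x * h1 \<epsilon>0 (z0 - x))"
      by (intro csupp_conv_integrand csupp_continuous cs \<epsilon>0)
    show "0 \<le> h0 \<epsilon>0 x * h1 \<epsilon>0 (z0 - x)" for x by (intro mult_nonneg_nonneg nn)
    show "0 < h0 \<epsilon>0 (a *\<^sub>R x0) * h1 \<epsilon>0 (z0 - a *\<^sub>R x0)"
      using a t x0 y0 \<epsilon>0 by (simp add: z0_def h0_def h1_def profile_def trunc_def)
  qed
  define w1 where "w1 = W \<epsilon>0 z0 / 2"
  have w1: "0 < w1" using Wz0 by (simp add: w1_def)
  obtain \<rho> where \<rho>: "0 < \<rho>" "\<And>x y. norm (x - y) < \<rho> \<Longrightarrow> \<bar>W \<epsilon>0 x - W \<epsilon>0 y\<bar> < w1"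
    using csupp_uniformly_continuous[OF csupp_in_csupp[OF Ws[OF \<epsilon>0(1)]] w1] by blast
  \<comment> \<open>The lower bound at level \<open>\<epsilon>0\<close> persists for smaller
    \<open>\<epsilon>\<close> by monotonicity, hence does not depend on
    \<open>\<epsilon>\<close>.\<close>
  have Wlow: "w1 \<le> W \<epsilon> z" if "0 < \<epsilon>" "\<epsilon> \<le> \<epsilon>0" "z \<in> ball z0 \<rho>" for \<epsilon> z
  proof -
    have "\<bar>W \<epsilon>0 z - W \<epsilon>0 z0\<bar> < w1"
      using that(3) by (intro \<rho>(2)) (simp add: dist_norm norm_minus_commute)
    then have "w1 \<le> W \<epsilon>0 z" by (simp add: w1_def abs_if split: if_splits)
    also have "\<dots> \<le> W \<epsilon> z"
      unfolding W_def using that q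
      by (intro conv_mono cs \<epsilon>0 nn) (auto simp: h0_def h1_def intro!: profile_antimono)
    finally show ?thesis .
  qed
  \<comment> \<open>Half of \<open>w1 powr (1 / p)\<close>: the subtraction of
    \<open>\<delta> powr (1 / p) \<le> m\<close> in the trial function then still leaves at least
    \<open>m\<close> on the ball.\<close>
  define m where "m = w1 powr (1 / p) / 2"
  have m: "0 < m" using w1 by (simp add: m_def)
  define s0 where "s0 = m\<^sup>2 * measure lborel (ball z0 \<rho>)"
  have s0: "0 < s0" using m content_ball_pos[OF \<rho>(1), of z0] by (simp add: s0_def)
  \<comment> \<open>The integral of \<open>v\<close> is at most \<open>\<mu> + ?D\<close>, and
    \<open>s0 \<le> ?D\<close> turns \<open>\<mu>\<close> into at most \<open>\<mu> / s0\<close>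
    times \<open>?D\<close>.\<close>
  define J where "J = \<mu> / s0 + 1"
  have J: "0 < J" using \<mu> s0 by (simp add: J_def add_nonneg_pos)
  \<comment> \<open>The value intended for \<open>\<delta> powr (1 / p)\<close>. The second bound
    keeps the error of the shift within \<open>\<beta> / 2\<close>; \<open>c + 1\<close> avoids
    division by 0.\<close>
  define \<kappa> where "\<kappa> = min m (\<beta> / (4 * (c + 1) * J))"
  have \<kappa>: "0 < \<kappa>" "\<kappa> \<le> m" using m \<beta> c0 J by (auto simp: \<kappa>_def)
  have \<kappa>c: "2 * c * \<kappa> * J \<le> \<beta> / 2"
  proof -
    have "\<kappa> \<le> \<beta> / (4 * (c + 1) * J)" by (simp add: \<kappa>_def)
    then have "\<kappa> * (4 * (c + 1) * J) \<le> \<beta>" using c0 J by (simp add: pos_le_divide_eq)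
    moreover have "0 \<le> \<kappa> * J" using \<kappa>(1) J by simp
    ultimately show ?thesis by (simp add: algebra_simps)
  qed
  define \<delta> where "\<delta> = \<kappa> powr p"
  have \<delta>: "0 < \<delta>" "\<delta> powr (1 / p) = \<kappa>" using \<kappa>(1) q(3) by (simp_all add: \<delta>_def powr_powr)
  define Q where "Q = \<delta> powr (1 / p - 1)"
  have Q: "0 < Q" using \<delta>(1) by (simp add: Q_def)
  \<comment> \<open>Chosen after \<open>\<delta>\<close>, hence after \<open>Q\<close>, to keep the
    truncation error within the other \<open>\<beta> / 2\<close>.\<close>
  define \<epsilon> where "\<epsilon> = min \<epsilon>0 (\<beta> / (4 * (c * C + 1) * Q * J))"
  have cC: "0 \<le> c * C" using c0 C0 by simp
  have \<epsilon>: "0 < \<epsilon>" "\<epsilon> \<le> \<epsilon>0" using \<epsilon>0(1) \<beta> cC Q J by (auto simp: \<epsilon>_def intro!: divide_pos_pos mult_pos_pos)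
  have \<epsilon>c: "2 * (c * \<epsilon> * C) * Q * J \<le> \<beta> / 2"
  proof -
    have "\<epsilon> \<le> \<beta> / (4 * (c * C + 1) * Q * J)" by (simp add: \<epsilon>_def)
    then have "\<epsilon> * (4 * (c * C + 1) * Q * J) \<le> \<beta>"
      using cC Q J by (subst (asm) pos_le_divide_eq) (auto intro!: mult_pos_pos)
    moreover have "0 \<le> \<epsilon> * Q * J" using \<epsilon>(1) Q J by simp
    ultimately show ?thesis by (simp add: algebra_simps)
  qed
  define v where "v = (\<lambda>z. (W \<epsilon> z + \<delta>) powr (1 / p) - \<delta> powr (1 / p))"
  let ?D = "LINT x|lborel. (v x)\<^sup>2"
  have vs: "csupp_in (\<Omega> t) v"
  proof (rule csupp_in_subset[OF Ws[OF \<epsilon>(1)]])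
    show "continuous_on UNIV v"
      unfolding v_def using W0[of \<epsilon>] \<delta>(1) csupp_continuous[OF csupp_in_csupp[OF Ws[OF \<epsilon>(1)]]]
      by (intro continuous_intros) (auto simp: add_nonneg_pos less_imp_neq[symmetric])
  qed (simp add: v_def)
  have D: "s0 \<le> ?D"
    unfolding s0_def
  proof (rule csupp_integral_ge[OF csupp_in_csupp[OF csupp_in_power2[OF vs]]])
    show "m\<^sup>2 \<le> (v x)\<^sup>2" if "x \<in> ball z0 \<rho>" for x
    proof -
      have "w1 powr (1 / p) \<le> (W \<epsilon> x + \<delta>) powr (1 / p)"
        using Wlow[OF \<epsilon> that] w1 \<delta>(1) q(3) by (intro powr_mono2) auto
      then have "m \<le> v x" using \<kappa>(2) by (simp add: v_def \<delta>(2) m_def)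
      then show ?thesis using m by (intro power_mono) auto
    qed
  qed simp
  have pos: "0 < ?D" using D s0 by linarith
  have "(LINT x|lborel. v x) \<le> \<mu> + ?D"
    unfolding \<mu>_def using R(1) by (intro csupp_in_integral_le[OF vs]) auto
  also have "\<mu> = \<mu> / s0 * s0" using s0 by simp
  also have "\<mu> / s0 * s0 + ?D \<le> \<mu> / s0 * ?D + ?D"
    using D \<mu> s0 by (intro add_right_mono mult_left_mono) auto
  finally have vJ: "(LINT x|lborel. v x) \<le> J * ?D" by (simp add: J_def algebra_simps)
  let ?B = "2 * c * \<delta> powr (1 / p) + 2 * (c * \<epsilon> * C) * \<delta> powr (1 / p - 1)"
  have "(1 - 2 / p) * (dirichlet_eigenvalue V (\<Omega> t) - l t) * ?D \<le> 4 * c / p * ?D + ?B * (LINT x|lborel. v x)"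
    by (rule trial_function(1)[OF \<Omega>(1,2) contV c(3) c0 WC[OF \<epsilon>(1)] Ws[OF \<epsilon>(1)] W0 q(3) \<delta>(1) _ ineq[OF \<epsilon>(1)] v_def pos])
      (use c0 C0 \<epsilon>(1) in auto)
  also have "?B * (LINT x|lborel. v x) \<le> ?B * (J * ?D)"
    using vJ c0 C0 \<epsilon>(1) by (intro mult_left_mono) auto
  also have "\<dots> = (2 * c * \<kappa> * J + 2 * (c * \<epsilon> * C) * Q * J) * ?D"
    by (simp add: \<delta>(2) Q_def algebra_simps)
  also have "\<dots> \<le> \<beta> * ?D"
    using \<kappa>c \<epsilon>c pos by (intro mult_right_mono) auto
  finally have "(1 - 2 / p) * (dirichlet_eigenvalue V (\<Omega> t) - l t) * ?D \<le> (4 * c / p + \<beta>) * ?D"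
    by (simp add: algebra_simps)
  then show "(1 - 2 / p) * (dirichlet_eigenvalue V (\<Omega> t) - l t) \<le> 4 * c / p + \<beta>"
    using pos by (simp only: mult_le_cancel_right_pos)
qed

theorem theorem1p2:
  fixes \<Omega>0 \<Omega>1 :: "(real ^ 'n) set"
    and V u0 u1 :: "real ^ 'n \<Rightarrow> real"
    and t :: real
  assumes "bounded_domain \<Omega>0" and "bounded_domain \<Omega>1"
    and "convex_on (convex hull (\<Omega>0 \<union> \<Omega>1)) V"
    and "first_dirichlet_eigenfunction V \<Omega>0 u0" and "C1_up_to_boundary \<Omega>0 u0"
    and "first_dirichlet_eigenfunction V \<Omega>1 u1" and "C1_up_to_boundary \<Omega>1 u1"
    and "0 \<le> t" and "t \<le> 1"
  shows "dirichlet_eigenvalue V (minkowski_combination t \<Omega>0 \<Omega>1)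
    \<le> (1 - t) * dirichlet_eigenvalue V \<Omega>0 + t * dirichlet_eigenvalue V \<Omega>1"
proof -
  have ne: "\<Omega>0 \<noteq> {}" "\<Omega>1 \<noteq> {}" and op: "open \<Omega>0" "open \<Omega>1" and bd: "bounded \<Omega>0" "bounded \<Omega>1"
    using assms(1,2) by (auto simp: bounded_domain_def)
  \<comment> \<open>The construction divides by \<open>t\<close> and \<open>1 - t\<close>. At the
    end points the combination is one of the two domains, because the other is non-empty.\<close>
  consider "t = 0" | "t = 1" | "0 < t" "t < 1" using assms(8,9) by linarith
  then show ?thesis
  proof cases
    case 1
    then have "minkowski_combination t \<Omega>0 \<Omega>1 = \<Omega>0"
      using ne(2) by (auto simp: minkowski_combination_def)
    then show ?thesis using 1 by simp
  next
    case 2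
    then have "minkowski_combination t \<Omega>0 \<Omega>1 = \<Omega>1"
      using ne(1) by (auto simp: minkowski_combination_def)
    then show ?thesis using 2 by simp
  next
    case 3
    let ?H = "convex hull (\<Omega>0 \<union> \<Omega>1)"
    define l0 where "l0 = dirichlet_eigenvalue V \<Omega>0"
    define l1 where "l1 = dirichlet_eigenvalue V \<Omega>1"
    define d where "d = dirichlet_eigenvalue V (minkowski_combination t \<Omega>0 \<Omega>1) - ((1 - t) * l0 + t * l1)"
    have "open ?H" "bounded ?H"
      using op bd by (simp_all add: open_convex_hull open_Un bounded_convex_hull)
    then obtain m where m: "\<And>x. x \<in> ?H \<Longrightarrow> m \<le> V x"
      using convex_on_bounded_below[OF _ _ assms(3)] by blast
    \<comment> \<open>One constant for the lower bounds of the potential minus \<open>l0\<close>,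
      \<open>l1\<close> and their average, so that it can stay fixed while \<open>p\<close>
      grows.\<close>
    define c where "c = \<bar>m\<bar> + \<bar>l0\<bar> + \<bar>l1\<bar>"
    have c: "0 \<le> c" by (simp add: c_def)
    have sub: "\<Omega>0 \<subseteq> ?H" "\<Omega>1 \<subseteq> ?H" using hull_subset[of "\<Omega>0 \<union> \<Omega>1" convex] by auto
    have "(1 - t) * l0 + t * l1 \<le> \<bar>l0\<bar> + \<bar>l1\<bar>"
    proof -
      have "(1 - t) * l0 \<le> (1 - t) * \<bar>l0\<bar>" "t * l1 \<le> t * \<bar>l1\<bar>"
        using 3 by (intro mult_left_mono; simp)+
      moreover have "(1 - t) * \<bar>l0\<bar> \<le> 1 * \<bar>l0\<bar>" "t * \<bar>l1\<bar> \<le> 1 * \<bar>l1\<bar>"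
        using 3 by (intro mult_right_mono; simp)+
      ultimately show ?thesis by linarith
    qed
    then have lb: "- c \<le> V x - l0" "- c \<le> V x - l1" "- c \<le> V x - ((1 - t) * l0 + t * l1)" if "x \<in> ?H" for x
      using m[OF that] unfolding c_def by linarith+
    have key: "(1 - 2 / p) * d \<le> 4 * c / p" if "2 + 2 / ((1 - t) * t) \<le> p" for p
      unfolding d_def l0_def l1_def
      by (rule eigenvalue_minkowski_bound[OF assms(1-4,6) 3 that c])
        (use lb sub minkowski_combination_subset_hull[OF assms(8,9), of \<Omega>0 \<Omega>1] in
          \<open>auto simp: l0_def l1_def\<close>)
    have "d \<le> 0"
    proof (rule ccontr)
      assume "\<not> d \<le> 0"
      then have d: "0 < d" by simp
      \<comment> \<open>\<open>key\<close> amounts to \<open>(p - 2) * d \<le> 4 * c\<close>; the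
        last summand of \<open>p\<close> alone contributes \<open>4 * c\<close> to the left side,
        and the middle one makes the inequality fail.\<close>
      define p where "p = 2 + 2 / ((1 - t) * t) + 4 * c / d"
      have p: "2 + 2 / ((1 - t) * t) \<le> p" "0 < 2 / ((1 - t) * t)" using d c 3 by (simp_all add: p_def)
      then have p2: "2 < p" by linarith
      have "p * ((1 - 2 / p) * d) \<le> p * (4 * c / p)"
        using key[OF p(1)] p2 by (intro mult_left_mono) auto
      moreover have "p * ((1 - 2 / p) * d) = (p - 2) * d" "p * (4 * c / p) = 4 * c"
        using p2 by (simp_all add: field_simps)
      ultimately have "(p - 2) * d \<le> 4 * c" by simp
      moreover have "(p - 2) * d = 2 / ((1 - t) * t) * d + 4 * c"
        using d by (simp add: p_def distrib_right)
      ultimately show False using mult_pos_pos[OF p(2) d] by linarith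
    qed
    then show ?thesis by (simp add: d_def l0_def l1_def)
  qed
qed

end
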